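(* Let $M$ be a smooth manifold of dimension $m+n$, let $\mathcal{D}=\langle\omega^1,\dots,\omega^n\rangle$ be a completely integrable $m$-dimensional smooth distribution on $M$, and let $X\in\mathcal{D}$. Then for all $t$ the differential $1$-forms $(\mathrm{Fl}^X_t)^*\omega^1,\dots,(\mathrm{Fl}^X_t)^*\omega^n$ vanish on $\mathcal{D}$.
   Context: An $m$-dimensional tangent distribution $\mathcal{D}$ on $M$ assigns to each $x\in M$ an $m$-dimensional subspace $\mathcal{D}_x\subseteq T_xM$, smoothly: locally $\mathcal{D}$ is spanned by $m$ smooth vector fields. As a standing convention these may be taken globally. Writing $\mathcal{D}=\langle\omega^1,\dots,\omega^n\rangle$ means that $\omega^1,\dots,\omega^n$ are smooth $1$-forms on $M$ spanning, at each $x\in M$, the annihilator $\{\alpha\in T_x^*M : \alpha|_{\mathcal{D}_x}=0\}$, which is $n$-dimensional. For a vector field $X$ on $M$, $X\in\mathcal{D}$ means that $X$ is smooth and $X(x)\in\mathcal{D}_x$ for all $x\in M$. A $1$-form vanishes on $\mathcal{D}$ if its value at each point $x$ (of its domain) vanishes on $\mathcal{D}_x$. An integral manifold of $\mathcal{D}$ is an injectively immersed submanifold $N\subset M$ with $T_xN\subseteq\mathcal{D}_x$ for all $x\in N$. An integral manifold $N$ is maximal if for each $x\in N$ there is an open neighborhood $U$ of $x$ in $M$ such that no integral manifold $N'$ with $\dim N'>\dim N$ contains $N\cap U$. The distribution $\mathcal{D}$ is completely integrable if every maximal integral manifold $N$ satisfies $\dim N=m$ (equivalently, $T_xN=\mathcal{D}_x$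 for all $x\in N$). $\mathrm{Fl}^X_t$ denotes the flow of $X$ (if $X$ is not complete, the local flow, with statements understood wherever it is defined). *)

theory Defs
  imports "HOL-Analysis.Analysis" "HOL-Library.Function_Algebras"
begin

section \<open>Pointwise vector space structure on functions\<close>

text \<open>Tangent vectors and covectors are represented by functions below. The pointwise structure
  makes \<^const>\<open>span\<close>, \<^const>\<open>subspace\<close> and \<^const>\<open>dim\<close> available for them.\<close>

instantiation "fun" :: (type, real_vector) real_vector
begin

definition scaleR_fun :: "real \<Rightarrow> ('a \<Rightarrow> 'b) \<Rightarrow> 'a \<Rightarrow> 'b"
  where "scaleR_fun r f = (\<lambda>x. r *\<^sub>R f x)"

instance
  by standard (simp_all add: scaleR_fun_def fun_eq_iff scaleR_add_right scaleR_add_left)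

end


section \<open>Smooth maps between subsets of Euclidean spaces\<close>

primrec C_times_on :: "nat \<Rightarrow> 'a::real_normed_vector set \<Rightarrow> ('a \<Rightarrow> 'b::real_normed_vector) \<Rightarrow> bool"
  where
    "C_times_on 0 S f \<longleftrightarrow> continuous_on S f"
  | "C_times_on (Suc k) S f \<longleftrightarrow>
       (\<forall>x\<in>S. f differentiable (at x)) \<and>
       (\<forall>v. C_times_on k S (\<lambda>x. frechet_derivative f (at x) v))"

text \<open>As usual, a map on an arbitrary subset of a Euclidean space is smooth if near every point it
  extends to a smooth map on an open set. For open sets this is ordinary smoothness, and for
  relatively open subsets of a linear subspace it is smoothness on that subspace.\<close>

definition smooth_on :: "'a::euclidean_space set \<Rightarrow> ('a \<Rightarrow> 'b::euclidean_space) \<Rightarrow> bool"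
  where "smooth_on S f \<longleftrightarrow>
    (\<forall>x\<in>S. \<exists>U g. open U \<and> x \<in> U \<and> (\<forall>k. C_times_on k U g) \<and> (\<forall>y\<in>U \<inter> S. g y = f y))"


section \<open>Smooth manifolds\<close>

text \<open>A chart is given by its domain and its coordinate map; the values of the coordinate map
  outside the domain are irrelevant.\<close>

type_synonym ('a, 'e) chart = "'a set \<times> ('a \<Rightarrow> 'e)"

definition chart_inv :: "('a, 'e) chart \<Rightarrow> 'e \<Rightarrow> 'a"
  where "chart_inv c = inv_into (fst c) (snd c)"

text \<open>Charts take values in a linear subspace \<open>model\<close> of a Euclidean space, and its dimension is the
  dimension of the manifold. Thus the dimension is a natural number rather than a type, so that
  one can quantify over submanifolds of varying dimension; dimension 0 is included.
  The topology is a component of its own because an immersed submanifold need not carry the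
  subspace topology.\<close>

record ('a, 'e) manifold =
  topol :: "'a topology"
  model :: "'e set"
  atlas :: "('a, 'e) chart set"

abbreviation points :: "('a, 'e) manifold \<Rightarrow> 'a set"
  where "points M \<equiv> topspace (topol M)"

definition mdim :: "('a, 'e::euclidean_space) manifold \<Rightarrow> nat"
  where "mdim M = dim (model M)"

definition charts_at :: "('a, 'e) manifold \<Rightarrow> 'a \<Rightarrow> ('a, 'e) chart set"
  where "charts_at M p = {c \<in> atlas M. p \<in> fst c}"

definition second_countable_space :: "'a topology \<Rightarrow> bool"
  where "second_countable_space T \<longleftrightarrow>
    (\<exists>B. countable B \<and> (\<forall>W\<in>B. openin T W) \<and>
         (\<forall>U x. openin T U \<and> x \<in> U \<longrightarrow> (\<exists>W\<in>B. x \<in> W \<and> W \<subseteq> U)))"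

definition smooth_manifold :: "('a, 'e::euclidean_space) manifold \<Rightarrow> bool"
  where "smooth_manifold M \<longleftrightarrow>
    Hausdorff_space (topol M) \<and> second_countable_space (topol M) \<and>
    subspace (model M) \<and>
    (\<forall>c\<in>atlas M.
       openin (topol M) (fst c) \<and>
       openin (top_of_set (model M)) (snd c ` fst c) \<and>
       homeomorphic_map (subtopology (topol M) (fst c)) (top_of_set (snd c ` fst c)) (snd c)) \<and>
    \<Union> (fst ` atlas M) = points M \<and>
    (\<forall>c\<in>atlas M. \<forall>c'\<in>atlas M. smooth_on (snd c ` (fst c \<inter> fst c')) (snd c' \<circ> chart_inv c))"

definition smooth_map ::
  "('a, 'e::euclidean_space) manifold \<Rightarrow> ('b, 'f::euclidean_space) manifold \<Rightarrow> ('a \<Rightarrow> 'b) \<Rightarrow> bool"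
  where "smooth_map M M' F \<longleftrightarrow>
    continuous_map (topol M) (topol M') F \<and>
    (\<forall>c\<in>atlas M. \<forall>c'\<in>atlas M'.
       smooth_on (snd c ` (fst c \<inter> F -` fst c')) (snd c' \<circ> F \<circ> chart_inv c))"


section \<open>Tangent vectors, differentials, vector fields\<close>

text \<open>The derivative at \<open>p\<close> of the coordinate expression of \<open>F\<close> with respect to the charts \<open>c\<close> and
  \<open>c'\<close>. The domain \<open>snd c ` fst c\<close> is relatively open in the model space, so the derivative is
  uniquely determined on vectors of the model space (and is applied to such vectors only).\<close>

definition local_deriv ::
  "('a, 'e::euclidean_space) chart \<Rightarrow> ('b, 'f::euclidean_space) chart \<Rightarrow> ('a \<Rightarrow> 'b) \<Rightarrow> 'a \<Rightarrow> 'e \<Rightarrow> 'f"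
  where "local_deriv c c' F p =
    frechet_derivative (snd c' \<circ> F \<circ> chart_inv c) (at (snd c p) within snd c ` fst c)"

text \<open>A tangent vector at \<open>p\<close> is the family of its coordinate vectors in all the charts around \<open>p\<close>
  (extended by 0 to an argument that is not a chart around \<open>p\<close>).\<close>

type_synonym ('a, 'e) tvec = "('a, 'e) chart \<Rightarrow> 'e"

definition tangent_space :: "('a, 'e::euclidean_space) manifold \<Rightarrow> 'a \<Rightarrow> ('a, 'e) tvec set"
  where "tangent_space M p =
    {v. (\<forall>c. c \<notin> charts_at M p \<longrightarrow> v c = 0) \<and>
        (\<forall>c\<in>charts_at M p. v c \<in> model M) \<and>
        (\<forall>c\<in>charts_at M p. \<forall>c'\<in>charts_at M p. v c' = local_deriv c c' (\<lambda>q. q) p (v c))}"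

definition coord_vector ::
  "('a, 'e::euclidean_space) manifold \<Rightarrow> ('a, 'e) chart \<Rightarrow> 'a \<Rightarrow> 'e \<Rightarrow> ('a, 'e) tvec"
  where "coord_vector M c p w =
    (\<lambda>c'. if c' \<in> charts_at M p then local_deriv c c' (\<lambda>q. q) p w else 0)"

text \<open>The differential of a map that is defined and differentiable in a neighborhood of \<open>p\<close>. By the
  chain rule the choice of the chart around \<open>p\<close> is immaterial.\<close>

definition differential ::
  "('a, 'e::euclidean_space) manifold \<Rightarrow> ('b, 'f::euclidean_space) manifold \<Rightarrow> ('a \<Rightarrow> 'b) \<Rightarrow> 'a \<Rightarrow>
   ('a, 'e) tvec \<Rightarrow> ('b, 'f) tvec"
  where "differential M M' F p v =
    (let c = (SOME c. c \<in> charts_at M p)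
     in (\<lambda>c'. if c' \<in> charts_at M' (F p) then local_deriv c c' F p (v c) else 0))"

definition smooth_vector_field_on ::
  "('a, 'e::euclidean_space) manifold \<Rightarrow> 'a set \<Rightarrow> ('a \<Rightarrow> ('a, 'e) tvec) \<Rightarrow> bool"
  where "smooth_vector_field_on M U X \<longleftrightarrow>
    (\<forall>p\<in>U. X p \<in> tangent_space M p) \<and>
    (\<forall>c\<in>atlas M. smooth_on (snd c ` (fst c \<inter> U)) (\<lambda>y. X (chart_inv c y) c))"


section \<open>Differential 1-forms\<close>

text \<open>A covector is a linear functional on the tangent space, extended by 0.\<close>

definition cotangent_space ::
  "('a, 'e::euclidean_space) manifold \<Rightarrow> 'a \<Rightarrow> (('a, 'e) tvec \<Rightarrow> real) set"
  where "cotangent_space M p =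
    {\<alpha>. (\<forall>u\<in>tangent_space M p. \<forall>v\<in>tangent_space M p. \<alpha> (u + v) = \<alpha> u + \<alpha> v) \<and>
        (\<forall>r. \<forall>v\<in>tangent_space M p. \<alpha> (r *\<^sub>R v) = r * \<alpha> v) \<and>
        (\<forall>v. v \<notin> tangent_space M p \<longrightarrow> \<alpha> v = 0)}"

text \<open>Smoothness of a 1-form means smoothness of its coefficients in every chart.\<close>

definition smooth_one_form ::
  "('a, 'e::euclidean_space) manifold \<Rightarrow> ('a \<Rightarrow> ('a, 'e) tvec \<Rightarrow> real) \<Rightarrow> bool"
  where "smooth_one_form M \<omega> \<longleftrightarrow>
    (\<forall>p\<in>points M. \<omega> p \<in> cotangent_space M p) \<and>
    (\<forall>c\<in>atlas M. \<forall>w\<in>model M.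
       smooth_on (snd c ` fst c)
         (\<lambda>y. \<omega> (chart_inv c y) (coord_vector M c (chart_inv c y) w)))"

definition pullback_form ::
  "('a, 'e::euclidean_space) manifold \<Rightarrow> ('b, 'f::euclidean_space) manifold \<Rightarrow> ('a \<Rightarrow> 'b) \<Rightarrow>
   ('b \<Rightarrow> ('b, 'f) tvec \<Rightarrow> real) \<Rightarrow> 'a \<Rightarrow> ('a, 'e) tvec \<Rightarrow> real"
  where "pullback_form M M' F \<omega> p v =
    (if v \<in> tangent_space M p then \<omega> (F p) (differential M M' F p v) else 0)"


section \<open>Distributions and integral manifolds\<close>

definition smooth_distribution ::
  "('a, 'e::euclidean_space) manifold \<Rightarrow> nat \<Rightarrow> ('a \<Rightarrow> ('a, 'e) tvec set) \<Rightarrow> bool"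
  where "smooth_distribution M m D \<longleftrightarrow>
    (\<forall>p\<in>points M. subspace (D p) \<and> D p \<subseteq> tangent_space M p \<and> dim (D p) = m) \<and>
    (\<forall>p\<in>points M. \<exists>U Y. openin (topol M) U \<and> p \<in> U \<and>
       (\<forall>i\<in>{1..m}. smooth_vector_field_on M U (Y i)) \<and>
       (\<forall>q\<in>U. D q = span ((\<lambda>i::nat. Y i q) ` {1..m})))"

definition annihilator ::
  "('a, 'e::euclidean_space) manifold \<Rightarrow> ('a \<Rightarrow> ('a, 'e) tvec set) \<Rightarrow> 'a \<Rightarrow> (('a, 'e) tvec \<Rightarrow> real) set"
  where "annihilator M D p = {\<alpha> \<in> cotangent_space M p. \<forall>v\<in>D p. \<alpha> v = 0}"

definition distribution_given_by ::
  "('a, 'e::euclidean_space) manifold \<Rightarrow> ('a \<Rightarrow> ('a, 'e) tvec set) \<Rightarrow> nat \<Rightarrow>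
   (nat \<Rightarrow> 'a \<Rightarrow> ('a, 'e) tvec \<Rightarrow> real) \<Rightarrow> bool"
  where "distribution_given_by M D n \<omega> \<longleftrightarrow>
    (\<forall>i\<in>{1..n}. smooth_one_form M (\<omega> i)) \<and>
    (\<forall>p\<in>points M. span ((\<lambda>i. \<omega> i p) ` {1..n}) = annihilator M D p)"

definition vector_field_in ::
  "('a, 'e::euclidean_space) manifold \<Rightarrow> ('a \<Rightarrow> ('a, 'e) tvec) \<Rightarrow> ('a \<Rightarrow> ('a, 'e) tvec set) \<Rightarrow> bool"
  where "vector_field_in M X D \<longleftrightarrow>
    smooth_vector_field_on M (points M) X \<and> (\<forall>p\<in>points M. X p \<in> D p)"

text \<open>The model space of a submanifold lies in the same Euclidean space as that of the ambient
  manifold. This is no restriction, since the dimension cannot increase.\<close>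

definition immersed_submanifold ::
  "('a, 'e::euclidean_space) manifold \<Rightarrow> ('a, 'e) manifold \<Rightarrow> bool"
  where "immersed_submanifold N M \<longleftrightarrow>
    smooth_manifold N \<and> points N \<subseteq> points M \<and> smooth_map N M (\<lambda>q. q) \<and>
    (\<forall>p\<in>points N. inj_on (differential N M (\<lambda>q. q) p) (tangent_space N p))"

text \<open>The empty set, which would be a maximal integral manifold of every dimension, is excluded.\<close>

definition integral_manifold ::
  "('a, 'e::euclidean_space) manifold \<Rightarrow> ('a \<Rightarrow> ('a, 'e) tvec set) \<Rightarrow> ('a, 'e) manifold \<Rightarrow> bool"
  where "integral_manifold M D N \<longleftrightarrow>
    immersed_submanifold N M \<and> points N \<noteq> {} \<and>
    (\<forall>p\<in>points N. differential N M (\<lambda>q. q) p ` tangent_space N p \<subseteq> D p)"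

definition maximal_integral_manifold ::
  "('a, 'e::euclidean_space) manifold \<Rightarrow> ('a \<Rightarrow> ('a, 'e) tvec set) \<Rightarrow> ('a, 'e) manifold \<Rightarrow> bool"
  where "maximal_integral_manifold M D N \<longleftrightarrow>
    integral_manifold M D N \<and>
    (\<forall>p\<in>points N. \<exists>U. openin (topol M) U \<and> p \<in> U \<and>
       \<not> (\<exists>N'. integral_manifold M D N' \<and> mdim N' > mdim N \<and> points N \<inter> U \<subseteq> points N'))"

definition completely_integrable ::
  "('a, 'e::euclidean_space) manifold \<Rightarrow> nat \<Rightarrow> ('a \<Rightarrow> ('a, 'e) tvec set) \<Rightarrow> bool"
  where "completely_integrable M m D \<longleftrightarrow>
    (\<forall>N. maximal_integral_manifold M D N \<longrightarrow> mdim N = m)"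

definition vanishes_on ::
  "'a set \<Rightarrow> ('a \<Rightarrow> ('a, 'e) tvec \<Rightarrow> real) \<Rightarrow> ('a \<Rightarrow> ('a, 'e) tvec set) \<Rightarrow> bool"
  where "vanishes_on W \<alpha> D \<longleftrightarrow> (\<forall>p\<in>W. \<forall>v\<in>D p. \<alpha> p v = 0)"


section \<open>Flows\<close>

definition integral_curve ::
  "('a, 'e::euclidean_space) manifold \<Rightarrow> ('a \<Rightarrow> ('a, 'e) tvec) \<Rightarrow> real set \<Rightarrow> (real \<Rightarrow> 'a) \<Rightarrow> bool"
  where "integral_curve M X I \<gamma> \<longleftrightarrow>
    open I \<and> is_interval I \<and> continuous_map (top_of_set I) (topol M) \<gamma> \<and>
    (\<forall>t\<in>I. \<forall>c\<in>charts_at M (\<gamma> t).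
       ((\<lambda>s. snd c (\<gamma> s)) has_vector_derivative X (\<gamma> t) c) (at t))"

definition flow_rel ::
  "('a, 'e::euclidean_space) manifold \<Rightarrow> ('a \<Rightarrow> ('a, 'e) tvec) \<Rightarrow> real \<Rightarrow> 'a \<Rightarrow> 'a \<Rightarrow> bool"
  where "flow_rel M X t x y \<longleftrightarrow>
    (\<exists>I \<gamma>. integral_curve M X I \<gamma> \<and> 0 \<in> I \<and> t \<in> I \<and> \<gamma> 0 = x \<and> \<gamma> t = y)"

definition flow_domain ::
  "('a, 'e::euclidean_space) manifold \<Rightarrow> ('a \<Rightarrow> ('a, 'e) tvec) \<Rightarrow> real \<Rightarrow> 'a set"
  where "flow_domain M X t = {x. \<exists>y. flow_rel M X t x y}"

text \<open>The time-\<open>t\<close> map of the maximal local flow. It is well-defined on its domain by uniqueness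
  of integral curves; values outside the domain are irrelevant.\<close>

definition flow ::
  "('a, 'e::euclidean_space) manifold \<Rightarrow> ('a \<Rightarrow> ('a, 'e) tvec) \<Rightarrow> real \<Rightarrow> 'a \<Rightarrow> 'a"
  where "flow M X t x = (THE y. flow_rel M X t x y)"

end

theory Submission
  imports Defs
begin

text \<open>Every nonempty open set contains an \<open>m\<close>-dimensional integral manifold: among the integral
  manifolds inside the open set (points are such) one of largest dimension is maximal. The forms
  \<open>\<omega>\<^sup>i\<close> vanish along it, and so do their differentials; by density and continuity
  \<open>d\<omega>\<^sup>i\<close> vanishes on pairs of vectors of \<open>D\<close> everywhere. In a chart, let \<open>Y\<close> be the image of a vector
  of \<open>D\<close> under the differential of the flow of \<open>X\<close>. Since \<open>\<omega>\<^sup>i(X) = 0\<close>, the derivative of \<open>\<omega>\<^sup>i(Y)\<close>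
  along the trajectory is \<open>d\<omega>\<^sup>i(X, Y)\<close>, which is bounded by a multiple of \<open>\<Sum>\<^sub>j \<bar>\<omega>\<^sup>j(Y)\<bar>\<close>, so Gronwall's
  inequality gives \<open>\<omega>\<^sup>i(Y) = 0\<close>. The statement for all times follows by connectedness of the interval on
  which an integral curve is defined. Flows are differentiable by the variational equation.\<close>

section \<open>Gronwall's inequality\<close>

text \<open>Maximality is demanded near every point of an integral manifold. One of largest
  dimension through a prescribed \<open>p\<close> may still lie in a larger one near its other
  points, so it need not be maximal, and complete integrability reaches only a dense set of points.
  What passes to the remaining points is a closed condition, involutivity; no foliation is built. On
  an integral manifold the forms pull back to zero, and symmetry of second derivatives is the
  coordinate version of d commuting with pullback. Gronwall's inequality needs one constant along a
  whole piece of trajectory, which compactness of a coordinate ball supplies. Charts take values in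
  a subspace of a Euclidean space. Coordinate expressions are therefore precomposed with a
  projection onto it, so that derivatives become ordinary ones on open balls. The flow is merely the
  endpoint of an integral curve. Its continuity, its differentiability and a neighbourhood in its
  domain are carried along the curve together with the invariance of \<open>D\<close>.\<close>

lemma gronwall_forward:
  fixes q :: "real \<Rightarrow> real"
  assumes "0 \<le> t"
    and der: "\<And>s. s \<in> {0..t} \<Longrightarrow> (q has_real_derivative q' s) (at s)"
    and le: "\<And>s. s \<in> {0..t} \<Longrightarrow> q' s \<le> K * q s"
  shows "q t \<le> q 0 * exp (K * t)"
proof -
  define h where "h s = q s * exp (- K * s)" for s
  have "h t \<le> h 0"
  proof (rule DERIV_nonpos_imp_nonincreasing[OF \<open>0 \<le> t\<close>])
    fix s assume s: "0 \<le> s" "s \<le> t"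
    have "(h has_real_derivative (q' s - K * q s) * exp (- K * s)) (at s)"
      unfolding h_def using s by (auto intro!: derivative_eq_intros der simp: algebra_simps)
    moreover have "(q' s - K * q s) * exp (- K * s) \<le> 0"
      using le[of s] s by (intro mult_nonpos_nonneg) auto
    ultimately show "\<exists>y. (h has_real_derivative y) (at s) \<and> y \<le> 0" by blast
  qed
  then have "q t * exp (- K * t) * exp (K * t) \<le> q 0 * exp (K * t)"
    unfolding h_def by (intro mult_right_mono) auto
  then show ?thesis by (simp add: mult.assoc flip: exp_add)
qed

text \<open>A bound on the absolute value of \<open>q'\<close> survives reflection of time, which
  reduces negative \<open>t\<close> to the forward case.\<close>

lemma gronwall:
  fixes q :: "real \<Rightarrow> real"
  assumes der: "\<And>s. s \<in> closed_segment 0 t \<Longrightarrow> (q has_real_derivative q' s) (at s)"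
    and le: "\<And>s. s \<in> closed_segment 0 t \<Longrightarrow> \<bar>q' s\<bar> \<le> K * q s"
  shows "q t \<le> q 0 * exp (K * \<bar>t\<bar>)"
proof (cases "0 \<le> t")
  case True
  have "q t \<le> q 0 * exp (K * t)"
  proof (rule gronwall_forward[OF True])
    fix s assume s: "s \<in> {0..t}"
    show "(q has_real_derivative q' s) (at s)" using der s by (simp add: closed_segment_eq_real_ivl)
    show "q' s \<le> K * q s" using le[of s] s by (simp add: closed_segment_eq_real_ivl)
  qed
  then show ?thesis using True by simp
next
  case False
  have "q (- (- t)) \<le> q (- 0) * exp (K * (- t))"
  proof (rule gronwall_forward[where q = "\<lambda>s. q (- s)" and q' = "\<lambda>s. - q' (- s)"])
    show "0 \<le> - t" using False by simp
    fix s assume s: "s \<in> {0..-t}"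
    then have m: "- s \<in> closed_segment 0 t" using False by (simp add: closed_segment_eq_real_ivl)
    show "((\<lambda>s. q (- s)) has_real_derivative - q' (- s)) (at s)"
      using DERIV_mirror[of q "q' (- s)" s] der[OF m] by simp
    show "- q' (- s) \<le> K * q (- s)" using le[OF m] by linarith
  qed
  then show ?thesis using False by simp
qed

text \<open>The squared norm is differentiable even where \<open>u\<close> vanishes. Adding the
  constant \<open>\<eta>\<^sup>2\<close> absorbs the inhomogeneous term, since
  \<open>2 * norm (u s) * \<eta>\<close> is at most the sum of the two squares; this is the 1 in the
  exponent. Zero \<open>\<eta>\<close> serves uniqueness and Lipschitz dependence, small
  \<open>\<eta>\<close> differentiability of flows.\<close>

lemma gronwall_norm:
  fixes u :: "real \<Rightarrow> 'e::real_inner"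
  assumes der: "\<And>s. s \<in> closed_segment 0 t \<Longrightarrow> (u has_vector_derivative u' s) (at s)"
    and le: "\<And>s. s \<in> closed_segment 0 t \<Longrightarrow> norm (u' s) \<le> L * norm (u s) + \<eta>"
    and "L \<ge> 0"
  shows "(norm (u t))\<^sup>2 \<le> ((norm (u 0))\<^sup>2 + \<eta>\<^sup>2) * exp ((2 * L + 1) * \<bar>t\<bar>)"
proof -
  have "(norm (u t))\<^sup>2 + \<eta>\<^sup>2 \<le> ((norm (u 0))\<^sup>2 + \<eta>\<^sup>2) * exp ((2 * L + 1) * \<bar>t\<bar>)"
  proof (rule gronwall[where q' = "\<lambda>s. 2 * (u s \<bullet> u' s)"])
    fix s assume s: "s \<in> closed_segment 0 t"
    have "((\<lambda>s. u s \<bullet> u s + \<eta>\<^sup>2) has_real_derivative 2 * (u s \<bullet> u' s)) (at s)"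
      using der[OF s] unfolding has_vector_derivative_def has_field_derivative_def
      by (auto intro!: derivative_eq_intros simp: inner_commute algebra_simps)
    then show "((\<lambda>s. (norm (u s))\<^sup>2 + \<eta>\<^sup>2) has_real_derivative 2 * (u s \<bullet> u' s)) (at s)"
      by (simp add: power2_norm_eq_inner)
    have "\<bar>2 * (u s \<bullet> u' s)\<bar> \<le> 2 * (norm (u s) * norm (u' s))"
      using Cauchy_Schwarz_ineq2[of "u s" "u' s"] by (simp add: abs_mult)
    also have "\<dots> \<le> 2 * (norm (u s) * (L * norm (u s) + \<eta>))"
      using le[OF s] by (intro mult_left_mono) auto
    also have "\<dots> = 2 * L * (norm (u s))\<^sup>2 + 2 * norm (u s) * \<eta>"
      by (simp add: power2_eq_square algebra_simps)
    also have "2 * norm (u s) * \<eta> \<le> (norm (u s))\<^sup>2 + \<eta>\<^sup>2"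
      using sum_squares_bound[of "norm (u s)" \<eta>] by simp
    also have "2 * L * (norm (u s))\<^sup>2 + ((norm (u s))\<^sup>2 + \<eta>\<^sup>2)
        \<le> (2 * L + 1) * ((norm (u s))\<^sup>2 + \<eta>\<^sup>2)"
      using \<open>L \<ge> 0\<close> by (simp add: algebra_simps)
    finally show "\<bar>2 * (u s \<bullet> u' s)\<bar> \<le> (2 * L + 1) * ((norm (u s))\<^sup>2 + \<eta>\<^sup>2)" by simp
  qed
  then show ?thesis by (smt (verit) zero_le_power2)
qed

section \<open>Local flows in Euclidean spaces\<close>

text \<open>Banach's fixed point theorem for the integral equation, on bounded continuous functions
  on the whole line. Each of the two integrals in \<open>T\<close> changes by at most
  \<open>2 * \<epsilon> * L\<close> times the distance, so the bound 1/6 yields the contraction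
  factor 2/3.\<close>

lemma picard_lipschitz:
  fixes G :: "real \<Rightarrow> 'e::euclidean_space \<Rightarrow> 'e"
  assumes "\<epsilon> > 0" "L \<ge> 0" "\<epsilon> * L \<le> 1/6"
    and lip: "\<And>t x y. norm (G t x - G t y) \<le> L * norm (x - y)"
    and cont: "\<And>g. continuous_on UNIV g \<Longrightarrow> continuous_on UNIV (\<lambda>t. G t (g t))"
  obtains g where "g 0 = x0" "continuous_on UNIV g"
    "\<And>t. \<bar>t\<bar> < \<epsilon> \<Longrightarrow> (g has_vector_derivative G t (g t)) (at t)"
proof -
  \<comment> \<open>Clamping time to the interval from \<open>-\<epsilon>\<close> to
    \<open>\<epsilon>\<close> makes \<open>T g\<close> bounded on the whole line and changes nothing
    inside the interval.\<close>
  define cl where "cl t = max (- \<epsilon>) (min \<epsilon> t)" for t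
  have cl: "cl t \<in> {-\<epsilon>..\<epsilon>}" for t using \<open>\<epsilon> > 0\<close> by (auto simp: cl_def)
  have contcl: "continuous_on UNIV cl" unfolding cl_def by (intro continuous_intros)
  \<comment> \<open>Integrating from \<open>-\<epsilon>\<close> and subtracting the value at 0
    treats both signs of \<open>t\<close> at once.\<close>
  define J where "J g t = integral {-\<epsilon>..t} (\<lambda>s. G s (apply_bcontfun g s))" for g :: "real \<Rightarrow>\<^sub>C 'e" and t
  define T where "T g t = x0 + (J g (cl t) - J g 0)" for g and t
  have cG: "continuous_on A (\<lambda>s. G s (apply_bcontfun g s))" for A g
    using cont[of "apply_bcontfun g"] continuous_on_subset by fastforce
  have iG: "(\<lambda>s. G s (apply_bcontfun g s)) integrable_on {a..b}" for g a b
    by (rule integrable_continuous_real[OF cG])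
  have contT: "continuous_on UNIV (T g)" for g
  proof -
    have "continuous_on {-\<epsilon>..\<epsilon>} (J g)"
      unfolding J_def by (rule indefinite_integral_continuous_1[OF iG])
    then have "continuous_on UNIV (\<lambda>t. J g (cl t))"
      by (rule continuous_on_compose2[OF _ contcl]) (use cl in auto)
    then show ?thesis unfolding T_def by (intro continuous_intros)
  qed
  have bT: "T g \<in> bcontfun" for g
  proof -
    have "T g ` UNIV \<subseteq> T g ` {-\<epsilon>..\<epsilon>}"
    proof safe
      fix t
      have "T g t = T g (cl t)" using \<open>\<epsilon> > 0\<close> unfolding T_def by (simp add: cl_def)
      then show "T g t \<in> T g ` {-\<epsilon>..\<epsilon>}" using cl[of t] by blast
    qed
    moreover have "bounded (T g ` {-\<epsilon>..\<epsilon>})"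
      by (intro compact_imp_bounded compact_continuous_image continuous_on_subset[OF contT]) auto
    ultimately show ?thesis using contT bounded_subset by (auto simp: bcontfun_def)
  qed
  define F where "F g = Bcontfun (T g)" for g
  have F: "apply_bcontfun (F g) = T g" for g
    unfolding F_def using Bcontfun_inverse[OF bT] by simp
  have Jd: "norm (J g1 t - J g2 t) \<le> 2 * \<epsilon> * L * dist g1 g2" if t: "t \<in> {-\<epsilon>..\<epsilon>}" for g1 g2 t
  proof -
    have "norm (integral {-\<epsilon>..t} (\<lambda>s. G s (apply_bcontfun g1 s) - G s (apply_bcontfun g2 s)))
      \<le> (L * dist g1 g2) * (t - (-\<epsilon>))"
    proof (rule integral_bound)
      fix s
      have "norm (G s (apply_bcontfun g1 s) - G s (apply_bcontfun g2 s))
          \<le> L * norm (apply_bcontfun g1 s - apply_bcontfun g2 s)" by (rule lip)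
      also have "\<dots> \<le> L * dist g1 g2"
        using dist_bounded[of g1 s g2] \<open>L \<ge> 0\<close> by (intro mult_left_mono) (auto simp: dist_norm)
      finally show "norm (G s (apply_bcontfun g1 s) - G s (apply_bcontfun g2 s)) \<le> L * dist g1 g2" .
    qed (use t cG in \<open>auto intro!: continuous_intros\<close>)
    also have "\<dots> \<le> (L * dist g1 g2) * (2 * \<epsilon>)"
      using t \<open>L \<ge> 0\<close> by (intro mult_left_mono) auto
    finally show ?thesis
      unfolding J_def by (subst Henstock_Kurzweil_Integration.integral_diff[symmetric])
        (auto intro: iG simp: mult_ac)
  qed
  have "\<exists>!g. F g = g"
  proof (rule banach_fix_type[of "2/3"]; (intro allI)?)
    fix g1 g2 :: "real \<Rightarrow>\<^sub>C 'e"
    show "dist (F g1) (F g2) \<le> 2/3 * dist g1 g2"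
    proof (rule dist_bound)
      fix t
      have "dist (T g1 t) (T g2 t) = norm ((J g1 (cl t) - J g2 (cl t)) - (J g1 0 - J g2 0))"
        unfolding T_def dist_norm by (simp add: algebra_simps)
      also have "\<dots> \<le> norm (J g1 (cl t) - J g2 (cl t)) + norm (J g1 0 - J g2 0)"
        by (rule norm_triangle_ineq4)
      also have "\<dots> \<le> 4 * (\<epsilon> * L) * dist g1 g2"
        using Jd[OF cl, of g1 t g2] Jd[of 0 g1 g2] \<open>\<epsilon> > 0\<close> by auto
      also have "\<dots> \<le> 2/3 * dist g1 g2"
        using \<open>\<epsilon> * L \<le> 1/6\<close> by (intro mult_right_mono) (linarith, simp)
      finally show "dist (apply_bcontfun (F g1) t) (apply_bcontfun (F g2) t) \<le> 2/3 * dist g1 g2"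
        by (simp add: F)
    qed
  qed auto
  then obtain g where "F g = g" by blast
  then have fp: "apply_bcontfun g = T g" using F[of g] by simp
  show thesis
  proof (rule that[of "apply_bcontfun g"])
    show "apply_bcontfun g 0 = x0" unfolding fp T_def using \<open>\<epsilon> > 0\<close> by (simp add: cl_def)
    show "continuous_on UNIV (apply_bcontfun g)" by simp
    fix t :: real assume t: "\<bar>t\<bar> < \<epsilon>"
    then have tin: "t \<in> {-\<epsilon><..<\<epsilon>}" by auto
    have "((J g) has_vector_derivative G t (apply_bcontfun g t)) (at t within {-\<epsilon>..\<epsilon>})"
      unfolding J_def by (rule integral_has_vector_derivative[OF cG]) (use tin in auto)
    moreover have "at t within {-\<epsilon>..\<epsilon>} = at t"
      by (rule at_within_interior) (use tin in \<open>simp add: interior_atLeastAtMost_real\<close>)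
    ultimately have "((\<lambda>t. x0 + (J g t - J g 0)) has_vector_derivative G t (apply_bcontfun g t)) (at t)"
      by (auto intro!: derivative_eq_intros)
    then show "(apply_bcontfun g has_vector_derivative G t (apply_bcontfun g t)) (at t)"
    proof (rule has_vector_derivative_transform_within_open)
      show "open {-\<epsilon><..<\<epsilon>}" "t \<in> {-\<epsilon><..<\<epsilon>}" using tin by auto
      fix s assume "s \<in> {-\<epsilon><..<\<epsilon>}"
      then show "x0 + (J g s - J g 0) = apply_bcontfun g s" unfolding fp T_def by (simp add: cl_def)
    qed
  qed
qed

text \<open>The derivative is a map into bounded linear functions, so its continuity is in operator
  norm. On compact balls this gives both uniform bounds and the uniform continuity that controls
  remainders.\<close>

definition C1_on :: "'a::real_normed_vector set \<Rightarrow> ('a \<Rightarrow> 'b::real_normed_vector) \<Rightarrow> ('a \<Rightarrow> 'a \<Rightarrow>\<^sub>L 'b) \<Rightarrow> bool"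
  where "C1_on S f f' \<longleftrightarrow>
    (\<forall>x\<in>S. (f has_derivative blinfun_apply (f' x)) (at x)) \<and> continuous_on S f'"

text \<open>In finite dimension, continuity of every directional derivative is continuity in
  operator norm. This links \<open>C_times_on\<close>, which speaks of single directions, with
  \<open>C1_on\<close>.\<close>

lemma C1_onI:
  fixes f :: "'a::euclidean_space \<Rightarrow> 'b::real_normed_vector"
  assumes "\<And>x. x \<in> S \<Longrightarrow> (f has_derivative F x) (at x)"
    and "\<And>v. continuous_on S (\<lambda>x. F x v)"
  shows "C1_on S f (\<lambda>x. Blinfun (F x))"
proof -
  have bl: "blinfun_apply (Blinfun (F x)) = F x" if "x \<in> S" for x
    using assms(1)[OF that] by (simp add: bounded_linear_Blinfun_apply has_derivative_bounded_linear)
  have "continuous_on S (\<lambda>x. Blinfun (F x))"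
    by (rule continuous_on_blinfun_componentwise) (use assms(2) bl in \<open>simp cong: continuous_on_cong\<close>)
  then show ?thesis using assms(1) bl by (simp add: C1_on_def)
qed

lemma C1_on_subset: "C1_on S f f' \<Longrightarrow> T \<subseteq> S \<Longrightarrow> C1_on T f f'"
  unfolding C1_on_def using continuous_on_subset[of S f' T] by blast

lemma C1_on_imp_continuous_on: "C1_on S f f' \<Longrightarrow> continuous_on S f"
  by (meson C1_on_def continuous_at_imp_continuous_on has_derivative_continuous)

text \<open>Composition with the nearest-point map of the closed ball \<open>K\<close> makes the
  field bounded and globally Lipschitz. A solution starting within \<open>r/4\<close> of the centre
  cannot leave \<open>K\<close> in the time allotted, and on \<open>K\<close> the modified field is
  \<open>f\<close>. The Lipschitz data are returned because the variational equation and the error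
  estimates reuse the same \<open>L\<close> and time span.\<close>

lemma local_flow_exists:
  fixes f :: "'e::euclidean_space \<Rightarrow> 'e"
  assumes "r > 0" and C1: "C1_on (ball y0 r) f f'"
  obtains \<epsilon> \<delta> L \<phi> where "\<epsilon> > 0" "\<delta> > 0" "\<delta> \<le> r/4" "L \<ge> 0"
    "\<And>x. x \<in> ball y0 \<delta> \<Longrightarrow> \<phi> x 0 = x"
    "\<And>x t. x \<in> ball y0 \<delta> \<Longrightarrow> \<bar>t\<bar> < \<epsilon> \<Longrightarrow> \<phi> x t \<in> ball y0 (r/2)"
    "\<And>x t. x \<in> ball y0 \<delta> \<Longrightarrow> \<bar>t\<bar> < \<epsilon> \<Longrightarrow> (\<phi> x has_vector_derivative f (\<phi> x t)) (at t)"
    "\<epsilon> * L \<le> 1/6"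
    "\<And>y. y \<in> cball y0 (r/2) \<Longrightarrow> norm (f' y) \<le> L"
    "\<And>y z. y \<in> cball y0 (r/2) \<Longrightarrow> z \<in> cball y0 (r/2) \<Longrightarrow> norm (f y - f z) \<le> L * norm (y - z)"
proof -
  define K where "K = cball y0 (r/2)"
  have K: "compact K" "convex K" "closed K" "K \<noteq> {}" "K \<subseteq> ball y0 r"
    using \<open>r > 0\<close> by (auto simp: K_def)
  have der: "(f has_derivative (f' x)) (at x)" if "x \<in> K" for x
    using C1 K that by (auto simp: C1_on_def)
  have cf': "continuous_on K f'"
    using C1 K continuous_on_subset by (auto simp: C1_on_def)
  have cf: "continuous_on K f"
    using der by (auto intro!: continuous_at_imp_continuous_on has_derivative_continuous)
  obtain L where L: "L > 0" "\<And>y. y \<in> K \<Longrightarrow> norm (f' y) \<le> L"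
    using compact_imp_bounded[OF compact_continuous_image[OF cf' K(1)]]
    unfolding bounded_pos by auto
  obtain B where B: "B > 0" "\<And>y. y \<in> K \<Longrightarrow> norm (f y) \<le> B"
    using compact_imp_bounded[OF compact_continuous_image[OF cf K(1)]]
    unfolding bounded_pos by auto
  have lip: "norm (f y - f z) \<le> L * norm (y - z)" if "y \<in> K" "z \<in> K" for y z
    by (rule differentiable_bound[OF K(2)])
       (use that L(2) der in \<open>auto simp: norm_blinfun.rep_eq[symmetric] intro: has_derivative_at_withinI\<close>)
  define F where "F x = f (closest_point K x)" for x
  have cp: "closest_point K x \<in> K" for x by (rule closest_point_in_set[OF K(3,4)])
  have Flip: "norm (F x - F y) \<le> L * norm (x - y)" for x y
  proof -
    have "norm (F x - F y) \<le> L * norm (closest_point K x - closest_point K y)"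
      unfolding F_def by (rule lip[OF cp cp])
    also have "\<dots> \<le> L * norm (x - y)"
      using closest_point_lipschitz[OF K(2,3,4), of x y] L(1)
      by (intro mult_left_mono) (auto simp: dist_norm)
    finally show ?thesis .
  qed
  have Fb: "norm (F x) \<le> B" for x unfolding F_def by (rule B(2)[OF cp])
  have Fc: "continuous_on UNIV (\<lambda>t. F (g t))" if "continuous_on UNIV g" for g :: "real \<Rightarrow> 'e"
    unfolding F_def
    by (rule continuous_on_compose2[OF cf])
       (use cp in \<open>auto intro: continuous_on_compose2[OF continuous_on_closest_point[OF K(2,3,4)] that]\<close>)
  \<comment> \<open>The first entry meets the requirement of \<open>picard_lipschitz\<close>; the
    second limits the distance travelled at speed \<open>B\<close> to \<open>r/4\<close>.\<close>
  define \<epsilon> where "\<epsilon> = min (1 / (6 * L)) (r / (4 * B))"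
  have \<epsilon>: "\<epsilon> > 0" "\<epsilon> * L \<le> 1/6" "\<epsilon> * B \<le> r/4"
    using L(1) B(1) \<open>r > 0\<close> by (auto simp: \<epsilon>_def min_def field_simps)
  have ex: "\<exists>g. g 0 = x \<and> (\<forall>t. \<bar>t\<bar> < \<epsilon> \<longrightarrow> (g has_vector_derivative F (g t)) (at t))" for x
    using picard_lipschitz[OF \<epsilon>(1) _ \<epsilon>(2), of "\<lambda>_. F" x] Flip Fc L(1) by (metis less_imp_le)
  then obtain \<phi> where \<phi>: "\<And>x. \<phi> x 0 = x"
    "\<And>x t. \<bar>t\<bar> < \<epsilon> \<Longrightarrow> (\<phi> x has_vector_derivative F (\<phi> x t)) (at t)" by metis
  have stay: "\<phi> x t \<in> ball y0 (r/2)" if x: "x \<in> ball y0 (r/4)" and t: "\<bar>t\<bar> < \<epsilon>" for x t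
  proof -
    have "norm (\<phi> x t - \<phi> x 0) \<le> B * norm (t - 0)"
    proof (rule differentiable_bound[where f' = "\<lambda>s h. h *\<^sub>R F (\<phi> x s)"])
      show "convex {-\<epsilon><..<\<epsilon>}" "t \<in> {-\<epsilon><..<\<epsilon>}" "0 \<in> {-\<epsilon><..<\<epsilon>}"
        using t \<epsilon> by (auto simp: convex_real_interval)
      fix s assume "s \<in> {-\<epsilon><..<\<epsilon>}"
      then show "(\<phi> x has_derivative (\<lambda>h. h *\<^sub>R F (\<phi> x s))) (at s within {-\<epsilon><..<\<epsilon>})"
        using \<phi>(2)[of s x] by (auto simp: has_vector_derivative_def intro: has_derivative_at_withinI)
      show "onorm (\<lambda>h. h *\<^sub>R F (\<phi> x s)) \<le> B"
        by (rule onorm_le) (use mult_left_mono[OF Fb[of "\<phi> x s"] abs_ge_zero] in \<open>simp add: mult.commute[of B]\<close>)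
    qed
    also have "\<dots> \<le> B * \<epsilon>" using t B(1) by (intro mult_left_mono) auto
    also have "\<dots> \<le> r/4" using \<epsilon>(3) by (simp add: mult.commute)
    finally have "dist x (\<phi> x t) \<le> r/4" by (simp add: \<phi> dist_norm norm_minus_commute)
    then show ?thesis using x dist_triangle[of y0 "\<phi> x t" x] by auto
  qed
  show thesis
  proof (rule that[of \<epsilon> "r/4" L \<phi>])
    fix x t assume xt: "x \<in> ball y0 (r/4)" "\<bar>t\<bar> < \<epsilon>"
    have "\<phi> x t \<in> K" using stay[OF xt] by (auto simp: K_def)
    then show "(\<phi> x has_vector_derivative f (\<phi> x t)) (at t)"
      using \<phi>(2)[OF xt(2), of x] by (simp add: F_def closest_point_self)
  qed (use \<epsilon> L \<open>r > 0\<close> \<phi> stay lip in \<open>auto simp: K_def\<close>)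
qed

text \<open>\<open>Y\<close> solves the variational equation. The remainder of the linear
  approximation of the flow satisfies a linear differential inequality whose inhomogeneity is small
  compared with \<open>norm (y - x)\<close>, and \<open>gronwall_norm\<close> transfers this
  smallness to the remainder.\<close>

lemma differentiable_local_flow_exists:
  fixes f :: "'e::euclidean_space \<Rightarrow> 'e"
  assumes "r > 0" and C1: "C1_on (ball y0 r) f f'"
  obtains \<epsilon> \<delta> \<phi> Y where "\<epsilon> > 0" "\<delta> > 0" "\<delta> \<le> r"
    "\<And>x. x \<in> ball y0 \<delta> \<Longrightarrow> \<phi> x 0 = x"
    "\<And>x t. x \<in> ball y0 \<delta> \<Longrightarrow> \<bar>t\<bar> < \<epsilon> \<Longrightarrow> \<phi> x t \<in> ball y0 (r/2)"
    "\<And>x t. x \<in> ball y0 \<delta> \<Longrightarrow> \<bar>t\<bar> < \<epsilon> \<Longrightarrow> (\<phi> x has_vector_derivative f (\<phi> x t)) (at t)"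
    "\<And>x t. x \<in> ball y0 \<delta> \<Longrightarrow> \<bar>t\<bar> < \<epsilon> \<Longrightarrow> ((\<lambda>x. \<phi> x t) has_derivative Y x t) (at x)"
    "\<And>x v. x \<in> ball y0 \<delta> \<Longrightarrow> Y x 0 v = v"
    "\<And>x t v. x \<in> ball y0 \<delta> \<Longrightarrow> \<bar>t\<bar> < \<epsilon> \<Longrightarrow>
      ((\<lambda>t. Y x t v) has_vector_derivative (f' (\<phi> x t)) (Y x t v)) (at t)"
proof -
  obtain e \<delta> L \<phi> where e: "e > 0" "\<delta> > 0" "\<delta> \<le> r/4" "L \<ge> 0"
    and \<phi>0: "\<And>x. x \<in> ball y0 \<delta> \<Longrightarrow> \<phi> x 0 = x"
    and \<phi>in: "\<And>x t. x \<in> ball y0 \<delta> \<Longrightarrow> \<bar>t\<bar> < e \<Longrightarrow> \<phi> x t \<in> ball y0 (r/2)"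
    and \<phi>d: "\<And>x t. x \<in> ball y0 \<delta> \<Longrightarrow> \<bar>t\<bar> < e \<Longrightarrow> (\<phi> x has_vector_derivative f (\<phi> x t)) (at t)"
    and eL: "e * L \<le> 1/6"
    and f'L: "\<And>y. y \<in> cball y0 (r/2) \<Longrightarrow> norm (f' y) \<le> L"
    and fL: "\<And>y z. y \<in> cball y0 (r/2) \<Longrightarrow> z \<in> cball y0 (r/2) \<Longrightarrow> norm (f y - f z) \<le> L * norm (y - z)"
    by (rule local_flow_exists[OF assms]) (rule that)
  \<comment> \<open>Clamping time to this shorter interval keeps the trajectory inside the range
    where it is a solution, so the coefficients of the linear equation are continuous on the whole
    line.\<close>
  define \<epsilon> where "\<epsilon> = e / 2"
  have \<epsilon>: "\<epsilon> > 0" "\<epsilon> < e" "\<epsilon> * L \<le> 1/6" using e eL mult_nonneg_nonneg[of e L] unfolding \<epsilon>_def by linarith+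
  define K where "K = cball y0 (r/2)"
  have K: "compact K" "K \<subseteq> ball y0 r" "convex K" using \<open>r > 0\<close> by (auto simp: K_def)
  have inK: "\<phi> x t \<in> K" if "x \<in> ball y0 \<delta>" "\<bar>t\<bar> < e" for x t
    using \<phi>in[OF that] by (simp add: K_def)
  have cf': "continuous_on K f'"
    using C1 K continuous_on_subset by (auto simp: C1_on_def)
  have fder: "(f has_derivative (f' z)) (at z)" if "z \<in> K" for z
    using C1 K(2) that unfolding C1_on_def by blast
  define cl where "cl t = max (- \<epsilon>) (min \<epsilon> t)" for t
  have cl: "\<bar>cl t\<bar> < e" for t using \<epsilon> by (auto simp: cl_def)
  have contcl: "continuous_on UNIV cl" unfolding cl_def by (intro continuous_intros)
  have c\<phi>: "continuous_on UNIV (\<lambda>t. \<phi> x (cl t))" if x: "x \<in> ball y0 \<delta>" for x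
  proof (rule continuous_on_compose2[OF _ contcl])
    show "continuous_on {-e<..<e} (\<phi> x)"
      using \<phi>d[OF x] has_vector_derivative_continuous
      by (intro continuous_at_imp_continuous_on) (fastforce simp: abs_less_iff)
    show "range cl \<subseteq> {-e<..<e}"
    proof safe
      fix t show "cl t \<in> {-e<..<e}" using cl[of t] by (auto simp: abs_less_iff)
    qed
  qed
  have "\<exists>g. g 0 = v \<and> (\<forall>t. \<bar>t\<bar> < \<epsilon> \<longrightarrow>
      (g has_vector_derivative (f' (\<phi> x t)) (g t)) (at t))"
    if x: "x \<in> ball y0 \<delta>" for x v
  proof (rule picard_lipschitz[OF \<epsilon>(1) e(4) \<epsilon>(3), of "\<lambda>t. (f' (\<phi> x (cl t)))" v])
    fix t u w
    have "norm ((f' (\<phi> x (cl t))) (u - w)) \<le> norm (f' (\<phi> x (cl t))) * norm (u - w)"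
      by (rule norm_blinfun)
    also have "\<dots> \<le> L * norm (u - w)"
      using f'L inK[OF x cl] by (intro mult_right_mono) (auto simp: K_def)
    finally show "norm ((f' (\<phi> x (cl t))) u - (f' (\<phi> x (cl t))) w)
        \<le> L * norm (u - w)" by (simp add: blinfun.diff_right)
  next
    fix g :: "real \<Rightarrow> 'e" assume "continuous_on UNIV g"
    moreover have "continuous_on UNIV (\<lambda>t. f' (\<phi> x (cl t)))"
      by (rule continuous_on_compose2[OF cf' c\<phi>[OF x]]) (use inK[OF x cl] in auto)
    ultimately show "continuous_on UNIV (\<lambda>t. (f' (\<phi> x (cl t))) (g t))"
      by (intro continuous_intros)
  next
    fix g assume g: "g 0 = v" "\<And>t. \<bar>t\<bar> < \<epsilon> \<Longrightarrow>
        (g has_vector_derivative (f' (\<phi> x (cl t))) (g t)) (at t)"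
    have "cl t = t" if "\<bar>t\<bar> < \<epsilon>" for t using that by (auto simp: cl_def)
    then show ?thesis using g by metis
  qed
  then obtain Z where Z0: "\<And>x v. x \<in> ball y0 \<delta> \<Longrightarrow> Z x v 0 = v"
    and Zd: "\<And>x v t. x \<in> ball y0 \<delta> \<Longrightarrow> \<bar>t\<bar> < \<epsilon> \<Longrightarrow>
      (Z x v has_vector_derivative (f' (\<phi> x t)) (Z x v t)) (at t)"
    by metis
  \<comment> \<open>Combining the solutions with basis vectors as initial values makes
    \<open>Y x t\<close> linear by construction, without an appeal to uniqueness.\<close>
  define Y where "Y x t v = (\<Sum>b\<in>Basis. (v \<bullet> b) *\<^sub>R Z x b t)" for x t v
  have Y0: "Y x 0 v = v" if "x \<in> ball y0 \<delta>" for x v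
    unfolding Y_def using that by (simp add: Z0 euclidean_representation)
  have Yd: "((\<lambda>t. Y x t v) has_vector_derivative (f' (\<phi> x t)) (Y x t v)) (at t)"
    if "x \<in> ball y0 \<delta>" "\<bar>t\<bar> < \<epsilon>" for x t v
    unfolding Y_def using that
    by (auto intro!: derivative_eq_intros has_vector_derivative_sum Zd
        simp: blinfun.sum_right blinfun.scaleR_right)
  have Ylin: "bounded_linear (Y x t)" for x t
    unfolding Y_def
    by (intro bounded_linear_sum bounded_linear_scaleR_left[THEN bounded_linear_compose] bounded_linear_inner_left)
  \<comment> \<open>An upper bound for the exponential factor in \<open>gronwall_norm\<close> at all
    admissible times. As \<open>C\<close> is at least 1, it may be replaced by its square when roots
    are taken.\<close>
  define C where "C = exp ((2 * L + 1) * e)"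
  have C: "C \<ge> 1" "C > 0" using e by (auto simp: C_def)
  have seg: "\<bar>s\<bar> \<le> \<bar>t\<bar>" if "s \<in> closed_segment 0 t" for s t :: real
    using that by (auto simp: closed_segment_eq_real_ivl split: if_splits)
  have expC: "exp ((2 * L + 1) * \<bar>t\<bar>) \<le> C" if "\<bar>t\<bar> < e" for t
    unfolding C_def using that e by (auto intro!: mult_left_mono)
  have \<Delta>: "norm (\<phi> x' t - \<phi> x t) \<le> C * norm (x' - x)"
    if x: "x \<in> ball y0 \<delta>" and x': "x' \<in> ball y0 \<delta>" and t: "\<bar>t\<bar> < e" for x x' t
  proof -
    have "(norm (\<phi> x' t - \<phi> x t))\<^sup>2 \<le> ((norm (\<phi> x' 0 - \<phi> x 0))\<^sup>2 + 0\<^sup>2) * exp ((2 * L + 1) * \<bar>t\<bar>)"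
    proof (rule gronwall_norm[where u' = "\<lambda>s. f (\<phi> x' s) - f (\<phi> x s)"])
      fix s assume "s \<in> closed_segment 0 t"
      then have s: "\<bar>s\<bar> < e" using seg t by fastforce
      show "((\<lambda>s. \<phi> x' s - \<phi> x s) has_vector_derivative f (\<phi> x' s) - f (\<phi> x s)) (at s)"
        by (intro derivative_intros \<phi>d x x' s)
      show "norm (f (\<phi> x' s) - f (\<phi> x s)) \<le> L * norm (\<phi> x' s - \<phi> x s) + 0"
        using fL inK[OF x s] inK[OF x' s] by (auto simp: K_def)
    qed (rule e)
    also have "\<dots> \<le> (norm (x' - x))\<^sup>2 * C"
      using expC[OF t] by (auto simp: \<phi>0[OF x] \<phi>0[OF x'] intro!: mult_left_mono)
    also have "\<dots> \<le> (norm (x' - x))\<^sup>2 * C\<^sup>2"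
      using C by (intro mult_left_mono) (auto simp: power2_eq_square)
    finally have "(norm (\<phi> x' t - \<phi> x t))\<^sup>2 \<le> (C * norm (x' - x))\<^sup>2"
      by (simp add: power_mult_distrib mult.commute)
    then show ?thesis by (rule power2_le_imp_le) (use C in auto)
  qed
  have der: "((\<lambda>x. \<phi> x t) has_derivative Y x t) (at x)"
    if x: "x \<in> ball y0 \<delta>" and t: "\<bar>t\<bar> < \<epsilon>" for x t
    unfolding has_derivative_at_alt
  proof (intro conjI allI impI Ylin)
    fix \<eta> :: real assume "\<eta> > 0"
    \<comment> \<open>One factor \<open>C\<close> is lost in comparing trajectories (inside
      \<open>\<kappa>\<close>), the other in Gronwall's inequality for the remainder.\<close>
    define \<eta>' where "\<eta>' = \<eta> / (C * C)"
    have "\<eta>' > 0" using \<open>\<eta> > 0\<close> C by (simp add: \<eta>'_def)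
    obtain d where d: "d > 0" "\<And>z z'. z \<in> K \<Longrightarrow> z' \<in> K \<Longrightarrow> dist z' z < d \<Longrightarrow> dist (f' z') (f' z) < \<eta>'"
      using compact_uniformly_continuous[OF cf' K(1)] \<open>\<eta>' > 0\<close>
      unfolding uniformly_continuous_on_def by metis
    obtain \<rho> where \<rho>: "\<rho> > 0" "ball x \<rho> \<subseteq> ball y0 \<delta>"
      using x open_ball open_contains_ball by blast
    show "\<exists>d>0. \<forall>y. norm (y - x) < d \<longrightarrow>
        norm (\<phi> y t - \<phi> x t - Y x t (y - x)) \<le> \<eta> * norm (y - x)"
    \<comment> \<open>\<open>\<rho>\<close> keeps \<open>y\<close> among the admissible initial
      values; \<open>d / C\<close> keeps the two trajectories closer than \<open>d\<close> at all
      times considered.\<close>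
    proof (intro exI[of _ "min \<rho> (d / C)"] conjI allI impI)
      show "0 < min \<rho> (d / C)" using \<rho> d C by simp
      fix y assume y: "norm (y - x) < min \<rho> (d / C)"
      have yb: "y \<in> ball y0 \<delta>" using y \<rho> by (auto simp: dist_norm norm_minus_commute)
      define \<kappa> where "\<kappa> = \<eta>' * (C * norm (y - x))"
      have "(norm (\<phi> y t - \<phi> x t - Y x t (y - x)))\<^sup>2
          \<le> ((norm (\<phi> y 0 - \<phi> x 0 - Y x 0 (y - x)))\<^sup>2 + \<kappa>\<^sup>2) * exp ((2 * L + 1) * \<bar>t\<bar>)"
      proof (rule gronwall_norm[where
            u' = "\<lambda>s. f (\<phi> y s) - f (\<phi> x s) - blinfun_apply (f' (\<phi> x s)) (Y x s (y - x))"])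
        fix s assume "s \<in> closed_segment 0 t"
        then have s: "\<bar>s\<bar> < e" "\<bar>s\<bar> < \<epsilon>" using seg t \<epsilon> by fastforce+
        show "((\<lambda>s. \<phi> y s - \<phi> x s - Y x s (y - x)) has_vector_derivative
            f (\<phi> y s) - f (\<phi> x s) - (f' (\<phi> x s)) (Y x s (y - x))) (at s)"
          by (intro derivative_intros \<phi>d Yd x yb s)
        let ?a = "\<phi> x s" and ?b = "\<phi> y s"
        have ab: "?a \<in> K" "?b \<in> K" using inK x yb s by auto
        have \<Delta>s: "norm (?b - ?a) \<le> C * norm (y - x)" by (rule \<Delta>[OF x yb s(1)])
        have dlt: "norm (?b - ?a) < d"
          using \<Delta>s y C by (simp add: pos_less_divide_eq mult.commute)
        have "norm (f ?b - f ?a - (f' ?a) (?b - ?a)) \<le> norm (?b - ?a) * \<eta>'"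
        proof (rule differentiable_bound_linearization[where S = "closed_segment ?a ?b"
              and f' = "\<lambda>x. blinfun_apply (f' x)" and ?x0.0 = ?a])
          fix \<tau> :: real assume "\<tau> \<in> {0..1}"
          then show "?a + \<tau> *\<^sub>R (?b - ?a) \<in> closed_segment ?a ?b"
            by (auto simp: closed_segment_def algebra_simps intro!: exI[of _ \<tau>])
        next
          fix z assume z: "z \<in> closed_segment ?a ?b"
          have zK: "z \<in> K" using closed_segment_subset[OF ab K(3)] z by auto
          then show "(f has_derivative (f' z)) (at z within closed_segment ?a ?b)"
            using fder has_derivative_at_withinI by blast
          have "dist z ?a < d"
            using segment_bound(1)[OF z] dlt by (simp add: dist_norm)
          then have "norm (f' z - f' ?a) < \<eta>'" using d(2)[OF ab(1) zK] by (simp add: dist_norm)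
          then show "onorm (blinfun_apply (f' z) - blinfun_apply (f' ?a)) \<le> \<eta>'"
            by (simp add: norm_blinfun.rep_eq minus_blinfun.rep_eq fun_diff_def)
        qed simp
        also have "\<dots> \<le> \<kappa>"
          unfolding \<kappa>_def using \<Delta>s \<open>\<eta>' > 0\<close> by (simp add: mult.commute)
        finally have R: "norm (f ?b - f ?a - (f' ?a) (?b - ?a)) \<le> \<kappa>" .
        have "norm ((f' ?a) (?b - ?a - Y x s (y - x))) \<le> L * norm (?b - ?a - Y x s (y - x))"
          using norm_blinfun[of "f' ?a" "?b - ?a - Y x s (y - x)"] f'L[of ?a] ab(1)
          by (smt (verit, best) K_def mult_right_mono norm_ge_zero)
        moreover have "f ?b - f ?a - (f' ?a) (Y x s (y - x))
            = (f ?b - f ?a - (f' ?a) (?b - ?a)) + (f' ?a) (?b - ?a - Y x s (y - x))"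
          by (simp add: blinfun.diff_right)
        ultimately show "norm (f ?b - f ?a - (f' ?a) (Y x s (y - x)))
            \<le> L * norm (?b - ?a - Y x s (y - x)) + \<kappa>"
          using R norm_triangle_ineq[of "f ?b - f ?a - blinfun_apply (f' ?a) (?b - ?a)"] by (smt (verit, best))
      qed (rule e)
      also have "\<dots> = \<kappa>\<^sup>2 * exp ((2 * L + 1) * \<bar>t\<bar>)" by (simp add: \<phi>0[OF x] \<phi>0[OF yb] Y0[OF x])
      also have "\<dots> \<le> \<kappa>\<^sup>2 * C" using expC[of t] t \<epsilon> by (intro mult_left_mono) auto
      also have "\<dots> \<le> \<kappa>\<^sup>2 * C\<^sup>2" using C by (intro mult_left_mono) (auto simp: power2_eq_square)
      also have "\<dots> = (\<eta> * norm (y - x))\<^sup>2"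
        using C by (simp add: \<kappa>_def \<eta>'_def power2_eq_square)
      finally show "norm (\<phi> y t - \<phi> x t - Y x t (y - x)) \<le> \<eta> * norm (y - x)"
        by (rule power2_le_imp_le) (use \<open>\<eta> > 0\<close> in auto)
    qed
  qed
  show thesis
    by (rule that[of \<epsilon> \<delta> \<phi> Y]) (use \<epsilon> e \<open>r > 0\<close> \<phi>0 \<phi>in \<phi>d der Y0 Yd in auto)
qed

section \<open>Smooth maps and second derivatives\<close>

lemma frechet_derivative_cong_open:
  assumes "open U" "x \<in> U" and eq: "\<And>y. y \<in> U \<Longrightarrow> f y = g y"
  shows "frechet_derivative f (at x) = frechet_derivative g (at x)"
proof -
  have "(f has_derivative F) (at x) \<longleftrightarrow> (g has_derivative F) (at x)" for F
    using has_derivative_transform_within_open[of f F x UNIV U g]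
      has_derivative_transform_within_open[of g F x UNIV U f] assms by auto
  then show ?thesis unfolding frechet_derivative_def by simp
qed

lemma C_times_on_cong:
  assumes "open U" "\<And>x. x \<in> U \<Longrightarrow> f x = g x" "C_times_on k U f"
  shows "C_times_on k U g"
  using assms(2,3)
proof (induction k arbitrary: f g)
  case 0
  then show ?case using continuous_on_cong by (metis C_times_on.simps(1))
next
  case (Suc k)
  have "g differentiable (at x)" if "x \<in> U" for x
  proof -
    obtain F where "(f has_derivative F) (at x)"
      using Suc.prems(2) \<open>x \<in> U\<close> by (auto simp: differentiable_def)
    then show ?thesis
      using has_derivative_transform_within_open[of f F x UNIV U g] \<open>open U\<close> \<open>x \<in> U\<close> Suc.prems(1)
      by (auto simp: differentiable_def)
  qed
  moreover have "C_times_on k U (\<lambda>x. frechet_derivative g (at x) v)" for v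
  proof (rule Suc.IH)
    show "C_times_on k U (\<lambda>x. frechet_derivative f (at x) v)" using Suc.prems(2) by simp
    show "frechet_derivative f (at x) v = frechet_derivative g (at x) v" if "x \<in> U" for x
      using frechet_derivative_cong_open[OF \<open>open U\<close> that Suc.prems(1)] by simp
  qed
  ultimately show ?case by simp
qed

lemma C_times_on_subset: "C_times_on k U f \<Longrightarrow> V \<subseteq> U \<Longrightarrow> C_times_on k V f"
  by (induction k arbitrary: f) (auto intro: continuous_on_subset)

lemma C_times_on_const: "C_times_on k U (\<lambda>x. c)"
  by (induction k arbitrary: c) (auto simp: frechet_derivative_const)

text \<open>The derivative of the composite along \<open>v\<close> is the derivative of
  \<open>g\<close> along \<open>P v\<close>, composed with \<open>P\<close>: again of the same
  shape, which closes the induction.\<close>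

lemma C_times_on_compose_linear:
  fixes P :: "'a::real_normed_vector \<Rightarrow> 'c::real_normed_vector"
  assumes P: "bounded_linear P" and "open U" and "C_times_on k U g"
  shows "C_times_on k (P -` U) (\<lambda>x. g (P x))"
  using assms(3)
proof (induction k arbitrary: g)
  case 0
  have "continuous_on (P -` U) P" using P by (simp add: linear_continuous_on)
  with 0 show ?case by (auto intro: continuous_on_compose2)
next
  case (Suc k)
  have oV: "open (P -` U)"
    using P \<open>open U\<close> by (simp add: open_vimage linear_continuous_on)
  have der: "((\<lambda>x. g (P x)) has_derivative (\<lambda>v. frechet_derivative g (at (P x)) (P v))) (at x)"
    if "x \<in> P -` U" for x
  proof -
    have "g differentiable (at (P x))" using Suc.prems that by simp
    then have "(g has_derivative frechet_derivative g (at (P x))) (at (P x))"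
      by (simp add: frechet_derivative_works)
    then show ?thesis
      by (rule has_derivative_compose[OF bounded_linear_imp_has_derivative[OF P]])
  qed
  have "C_times_on k (P -` U) (\<lambda>x. frechet_derivative (\<lambda>x. g (P x)) (at x) v)" for v
  proof (rule C_times_on_cong[OF oV])
    show "C_times_on k (P -` U) (\<lambda>x. frechet_derivative g (at (P x)) (P v))"
      using Suc.IH[of "\<lambda>y. frechet_derivative g (at y) (P v)"] Suc.prems by simp
    show "frechet_derivative g (at (P x)) (P v) = frechet_derivative (\<lambda>x. g (P x)) (at x) v"
      if "x \<in> P -` U" for x
      using frechet_derivative_at[OF der[OF that]] by (simp add: fun_eq_iff)
  qed
  moreover have "(\<lambda>x. g (P x)) differentiable (at x)" if "x \<in> P -` U" for x
    using der[OF that] by (auto simp: differentiable_def)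
  ultimately show ?case by simp
qed

lemma C_times_on_imp_C1_on:
  fixes f :: "'a::euclidean_space \<Rightarrow> 'b::real_normed_vector"
  assumes "C_times_on (Suc k) U f"
  shows "C1_on U f (\<lambda>x. Blinfun (frechet_derivative f (at x)))"
    and "x \<in> U \<Longrightarrow> blinfun_apply (Blinfun (frechet_derivative f (at x))) = frechet_derivative f (at x)"
proof -
  have der: "(f has_derivative frechet_derivative f (at x)) (at x)" if "x \<in> U" for x
    using assms that by (simp add: frechet_derivative_works)
  have bl: "blinfun_apply (Blinfun (frechet_derivative f (at x))) = frechet_derivative f (at x)"
    if "x \<in> U" for x
    using der[OF that] by (simp add: bounded_linear_Blinfun_apply has_derivative_bounded_linear)
  have C: "continuous_on U (\<lambda>x. frechet_derivative f (at x) v)" for v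
  proof -
    have "C_times_on k U (\<lambda>x. frechet_derivative f (at x) v)" using assms by simp
    then show ?thesis
      by (cases k) (auto intro!: continuous_at_imp_continuous_on differentiable_imp_continuous_within)
  qed
  show "C1_on U f (\<lambda>x. Blinfun (frechet_derivative f (at x)))"
    by (rule C1_onI[OF der C])
  show "x \<in> U \<Longrightarrow> blinfun_apply (Blinfun (frechet_derivative f (at x))) = frechet_derivative f (at x)"
    by (rule bl)
qed

text \<open>Mean value argument: the second difference is the increment over \<open>{0..h}\<close>
  of \<open>g s = f (x + s *\<^sub>R v + h *\<^sub>R w) - f (x + s *\<^sub>R v)\<close>, whose
  derivative is close to \<open>h *\<^sub>R A x w\<close>. Divided by \<open>h * h\<close>, the
  second difference thus tends to the mixed derivative.\<close>

lemma second_difference_bound: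
  fixes f :: "'a::real_normed_vector \<Rightarrow> 'b::real_normed_vector"
  assumes "open U" "x \<in> U" "\<eta> > 0"
    and f: "\<And>y. y \<in> U \<Longrightarrow> (f has_derivative f' y) (at y)"
    and A: "C1_on U (\<lambda>y. f' y v) A"
  shows "\<exists>h0>0. \<forall>h. 0 < h \<and> h < h0 \<longrightarrow>
    norm (f (x + h *\<^sub>R v + h *\<^sub>R w) - f (x + h *\<^sub>R v) - f (x + h *\<^sub>R w) + f x
      - (h * h) *\<^sub>R (A x) w) \<le> h * h * \<eta>"
proof -
  \<comment> \<open>The summand 1 avoids a division by zero when \<open>w\<close> vanishes.\<close>
  define e where "e = \<eta> / (norm w + 1)"
  have e: "e > 0" "norm w * e \<le> \<eta>"
    using \<open>\<eta> > 0\<close> norm_ge_zero[of w] by (auto simp: e_def field_simps add_pos_nonneg)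
  have "isCont A x"
    using A \<open>open U\<close> \<open>x \<in> U\<close> by (auto simp: C1_on_def continuous_on_eq_continuous_at)
  then obtain d where d: "d > 0" "\<And>y. dist y x < d \<Longrightarrow> dist (A y) (A x) < e"
    using e(1) by (auto simp: continuous_at_eps_delta)
  obtain \<rho> where \<rho>: "\<rho> > 0" "ball x \<rho> \<subseteq> U" using \<open>open U\<close> \<open>x \<in> U\<close> open_contains_ball by blast
  define r where "r = min d \<rho>"
  have r: "r > 0" "ball x r \<subseteq> U" "\<And>y. y \<in> ball x r \<Longrightarrow> norm (A y - A x) \<le> e"
    using d \<rho> by (auto simp: r_def dist_norm norm_minus_commute less_imp_le)
  show ?thesis
  \<comment> \<open>With this bound on \<open>h\<close> the whole parallelogram spanned by
    \<open>h *\<^sub>R v\<close> and \<open>h *\<^sub>R w\<close> at \<open>x\<close> stays in the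
    ball.\<close>
  proof (intro exI[of _ "r / (norm v + norm w + 1)"] conjI allI impI)
    show "0 < r / (norm v + norm w + 1)" using r by (simp add: add_nonneg_pos)
    fix h assume h: "0 < h \<and> h < r / (norm v + norm w + 1)"
    then have hr: "h * (norm v + norm w + 1) < r"
      by (simp add: pos_less_divide_eq add_nonneg_pos)
    have inb: "x + s *\<^sub>R v + \<tau> *\<^sub>R w \<in> ball x r" if "0 \<le> s" "s \<le> h" "0 \<le> \<tau>" "\<tau> \<le> h" for s \<tau>
    proof -
      have "dist x (x + s *\<^sub>R v + \<tau> *\<^sub>R w) = norm (s *\<^sub>R v + \<tau> *\<^sub>R w)"
        by (simp add: dist_norm add.assoc norm_minus_commute add.commute)
      also have "\<dots> \<le> s * norm v + \<tau> * norm w"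
        using that by (intro norm_triangle_le) simp
      also have "\<dots> \<le> h * norm v + h * norm w"
        using that by (intro add_mono mult_right_mono) auto
      also have "\<dots> < r" using hr h by (simp add: algebra_simps)
      finally show ?thesis by simp
    qed
    define g where "g s = f (x + s *\<^sub>R v + h *\<^sub>R w) - f (x + s *\<^sub>R v)" for s
    define g' where "g' s = f' (x + s *\<^sub>R v + h *\<^sub>R w) v - f' (x + s *\<^sub>R v) v" for s
    have gd: "(g has_vector_derivative g' s) (at s within {0..h})" if s: "s \<in> {0..h}" for s
    proof -
      have 1: "((\<lambda>s. f (x + s *\<^sub>R v + h *\<^sub>R w)) has_derivative
          (\<lambda>\<tau>. f' (x + s *\<^sub>R v + h *\<^sub>R w) (\<tau> *\<^sub>R v))) (at s within {0..h})"
        by (rule has_derivative_compose[OF _ f])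
          (use s inb[of s h] h r in \<open>auto intro!: derivative_eq_intros\<close>)
      have 2: "((\<lambda>s. f (x + s *\<^sub>R v)) has_derivative (\<lambda>\<tau>. f' (x + s *\<^sub>R v) (\<tau> *\<^sub>R v))) (at s within {0..h})"
        by (rule has_derivative_compose[OF _ f])
          (use s inb[of s 0] h r in \<open>auto intro!: derivative_eq_intros\<close>)
      have l: "linear (f' (x + s *\<^sub>R v + h *\<^sub>R w))" "linear (f' (x + s *\<^sub>R v))"
        using f[THEN has_derivative_linear] s inb[of s h] inb[of s 0] h r by auto
      show ?thesis
        unfolding g_def g'_def has_vector_derivative_def
        using has_derivative_diff[OF 1 2] by (simp add: l[THEN linear_scale] scaleR_diff_right)
    qed
    have g'b: "norm (g' s - h *\<^sub>R (A x) w) \<le> h * \<eta>" if s: "s \<in> {0..h}" for s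
    proof -
      have "norm (f' (x + s *\<^sub>R v + h *\<^sub>R w) v - f' (x + s *\<^sub>R v) v
          - (A x) ((x + s *\<^sub>R v + h *\<^sub>R w) - (x + s *\<^sub>R v)))
        \<le> norm ((x + s *\<^sub>R v + h *\<^sub>R w) - (x + s *\<^sub>R v)) * e"
      proof (rule differentiable_bound_linearization[where S = "ball x r"
            and f' = "\<lambda>y. blinfun_apply (A y)" and ?x0.0 = x])
        fix t :: real assume t: "t \<in> {0..1}"
        have "x + s *\<^sub>R v + (t * h) *\<^sub>R w \<in> ball x r"
          by (rule inb) (use s t h in \<open>auto simp: mult_left_le_one_le\<close>)
        then show "x + s *\<^sub>R v + t *\<^sub>R (x + s *\<^sub>R v + h *\<^sub>R w - (x + s *\<^sub>R v)) \<in> ball x r" by simp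
      next
        fix y assume y: "y \<in> ball x r"
        show "((\<lambda>y. f' y v) has_derivative (A y)) (at y within ball x r)"
          using A y r(2) unfolding C1_on_def by (blast intro: has_derivative_at_withinI)
        show "onorm (blinfun_apply (A y) - blinfun_apply (A x)) \<le> e"
          using r(3)[OF y] by (simp add: norm_blinfun.rep_eq minus_blinfun.rep_eq fun_diff_def)
      qed (use r in simp)
      then have "norm (g' s - h *\<^sub>R (A x) w) \<le> h * (norm w * e)"
        unfolding g'_def using h by (simp add: blinfun.scaleR_right mult.assoc)
      also have "\<dots> \<le> h * \<eta>" using e h by (intro mult_left_mono) auto
      finally show ?thesis .
    qed
    define k where "k s = g s - s *\<^sub>R (h *\<^sub>R blinfun_apply (A x) w)" for s
    have "norm (k h - k 0) \<le> (h * \<eta>) * norm (h - 0)"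
    proof (rule differentiable_bound[where f' = "\<lambda>s \<tau>. \<tau> *\<^sub>R (g' s - h *\<^sub>R blinfun_apply (A x) w)"])
      fix s assume s: "s \<in> {0..h}"
      show "(k has_derivative (\<lambda>\<tau>. \<tau> *\<^sub>R (g' s - h *\<^sub>R (A x) w))) (at s within {0..h})"
        using gd[OF s] unfolding k_def has_vector_derivative_def
        by (auto intro!: derivative_eq_intros simp: scaleR_diff_right)
      show "onorm (\<lambda>\<tau>. \<tau> *\<^sub>R (g' s - h *\<^sub>R (A x) w)) \<le> h * \<eta>"
      proof (rule onorm_le)
        fix \<tau> :: real
        show "norm (\<tau> *\<^sub>R (g' s - h *\<^sub>R (A x) w)) \<le> h * \<eta> * norm \<tau>"
          using mult_left_mono[OF g'b[OF s] abs_ge_zero[of \<tau>]] by (simp add: mult_ac)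
      qed
    qed (use h in auto)
    then show "norm (f (x + h *\<^sub>R v + h *\<^sub>R w) - f (x + h *\<^sub>R v) - f (x + h *\<^sub>R w) + f x
      - (h * h) *\<^sub>R (A x) w) \<le> h * h * \<eta>"
      using h unfolding k_def g_def by (simp add: mult_ac algebra_simps)
  qed
qed

text \<open>The second difference does not change when \<open>v\<close> and \<open>w\<close> are
  exchanged, and after division by \<open>h * h\<close> it approaches both mixed
  derivatives.\<close>

lemma second_derivative_symmetric:
  fixes f :: "'a::euclidean_space \<Rightarrow> 'b::real_normed_vector"
  assumes "open U" "x \<in> U" and C: "C_times_on (Suc (Suc 0)) U f"
  shows "frechet_derivative (\<lambda>y. frechet_derivative f (at y) v) (at x) w
    = frechet_derivative (\<lambda>y. frechet_derivative f (at y) w) (at x) v" (is "?l = ?r")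
proof -
  let ?f' = "\<lambda>y. frechet_derivative f (at y)"
  let ?A = "\<lambda>v y. Blinfun (frechet_derivative (\<lambda>y. ?f' y v) (at y))"
  have d: "(f has_derivative ?f' y) (at y)" if "y \<in> U" for y
    using C that by (simp add: frechet_derivative_works)
  have Cv: "C_times_on (Suc 0) U (\<lambda>y. ?f' y v)" for v
    using C C_times_on.simps(2)[of "Suc 0" U f] by blast
  have A: "C1_on U (\<lambda>y. ?f' y v) (?A v)"
    "blinfun_apply (?A v x) = frechet_derivative (\<lambda>y. ?f' y v) (at x)" for v
    using C_times_on_imp_C1_on[OF Cv[of v]] \<open>x \<in> U\<close> by auto
  have "norm (?l - ?r) \<le> e" if "e > 0" for e
  proof -
    have "e / 2 > 0" using that by simp
    obtain h1 where h1: "h1 > 0" "\<forall>h. 0 < h \<and> h < h1 \<longrightarrow>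
      norm (f (x + h *\<^sub>R v + h *\<^sub>R w) - f (x + h *\<^sub>R v) - f (x + h *\<^sub>R w) + f x
        - (h * h) *\<^sub>R ?l) \<le> h * h * (e/2)"
      using second_difference_bound[OF assms(1,2) \<open>e / 2 > 0\<close> d A(1)[of v], of w] A(2)[of v] by auto
    obtain h2 where h2: "h2 > 0" "\<forall>h. 0 < h \<and> h < h2 \<longrightarrow>
      norm (f (x + h *\<^sub>R w + h *\<^sub>R v) - f (x + h *\<^sub>R w) - f (x + h *\<^sub>R v) + f x
        - (h * h) *\<^sub>R ?r) \<le> h * h * (e/2)"
      using second_difference_bound[OF assms(1,2) \<open>e / 2 > 0\<close> d A(1)[of w], of v] A(2)[of w] by auto
    define h where "h = min h1 h2 / 2"
    have h: "0 < h" "h < h1" "h < h2" using h1 h2 by (auto simp: h_def)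
    define S where "S = f (x + h *\<^sub>R v + h *\<^sub>R w) - f (x + h *\<^sub>R v) - f (x + h *\<^sub>R w) + f x"
    have S2: "S = f (x + h *\<^sub>R w + h *\<^sub>R v) - f (x + h *\<^sub>R w) - f (x + h *\<^sub>R v) + f x"
      unfolding S_def by (simp add: algebra_simps)
    have "norm (S - (h * h) *\<^sub>R ?l) \<le> h * h * (e/2)" using h1 h unfolding S_def by blast
    moreover have "norm (S - (h * h) *\<^sub>R ?r) \<le> h * h * (e/2)" using h2 h unfolding S2 by blast
    ultimately have "norm ((S - (h * h) *\<^sub>R ?r) - (S - (h * h) *\<^sub>R ?l)) \<le> h * h * (e/2) + h * h * (e/2)"
      by (meson add_mono norm_triangle_ineq4 order_trans)
    also have "(S - (h * h) *\<^sub>R ?r) - (S - (h * h) *\<^sub>R ?l) = (h * h) *\<^sub>R (?l - ?r)"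
      by (simp add: scaleR_diff_right)
    finally have "(h * h) * norm (?l - ?r) \<le> (h * h) * e" by (simp add: mult_ac)
    then show ?thesis using h by simp
  qed
  then have "norm (?l - ?r) \<le> 0 + e" if "e > 0" for e :: real
    using that by simp
  then have "norm (?l - ?r) \<le> 0"
    by (rule field_le_epsilon)
  then show ?thesis by simp
qed

text \<open>Read \<open>a\<close> as a 1-form through the inner product: the difference of the two
  sides is da on a pair of tangent vectors of the image of \<open>\<phi>\<close>. Differentiating
  \<open>van\<close> along \<open>u\<close>, and then with \<open>u\<close> and \<open>w\<close>
  exchanged, gives two identities whose terms with second derivatives of \<open>\<phi>\<close>
  cancel.\<close>

lemma closed_along_integral_immersion:
  fixes \<phi> :: "'a::euclidean_space \<Rightarrow> 'b::euclidean_space"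
  assumes "open U" "x \<in> U" and C: "C_times_on (Suc (Suc 0)) U \<phi>"
    and a: "(a has_derivative a') (at (\<phi> x))"
    and van: "\<And>z w. z \<in> U \<Longrightarrow> a (\<phi> z) \<bullet> frechet_derivative \<phi> (at z) w = 0"
  shows "a' (frechet_derivative \<phi> (at x) u) \<bullet> frechet_derivative \<phi> (at x) w
    = a' (frechet_derivative \<phi> (at x) w) \<bullet> frechet_derivative \<phi> (at x) u"
proof -
  let ?p = "\<lambda>z. frechet_derivative \<phi> (at z)"
  have d\<phi>: "(\<phi> has_derivative ?p x) (at x)"
    using C \<open>x \<in> U\<close> by (simp add: frechet_derivative_works)
  have ddp: "((\<lambda>z. ?p z w) has_derivative frechet_derivative (\<lambda>z. ?p z w) (at x)) (at x)" for w
    using C \<open>x \<in> U\<close> by (simp add: frechet_derivative_works)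
  have *: "a' (?p x u) \<bullet> ?p x w + a (\<phi> x) \<bullet> frechet_derivative (\<lambda>z. ?p z w) (at x) u = 0" for u w
  proof -
    have "((\<lambda>z. a (\<phi> z) \<bullet> ?p z w) has_derivative
        (\<lambda>u. a (\<phi> x) \<bullet> frechet_derivative (\<lambda>z. ?p z w) (at x) u + a' (?p x u) \<bullet> ?p x w)) (at x)"
      by (rule has_derivative_inner[OF has_derivative_compose[OF d\<phi> a] ddp])
    moreover have "((\<lambda>z. a (\<phi> z) \<bullet> ?p z w) has_derivative (\<lambda>u. 0)) (at x)"
      by (rule has_derivative_transform_within_open[OF has_derivative_const[of 0] assms(1,2)])
         (simp add: van)
    ultimately have "(\<lambda>u. a (\<phi> x) \<bullet> frechet_derivative (\<lambda>z. ?p z w) (at x) u + a' (?p x u) \<bullet> ?p x w)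
      = (\<lambda>u. 0)" by (rule has_derivative_unique)
    from fun_cong[OF this, of u] show ?thesis by simp
  qed
  show ?thesis
    using *[of u w] *[of w u] second_derivative_symmetric[OF assms(1-3), of w u] by simp
qed

section \<open>Involutive distributions in Euclidean spaces\<close>

text \<open>If the kernel of the forms \<open>a i\<close> is spanned by continuous vector fields, then its orthogonal
  complement is closed over \<open>K\<close>, so that compactness applies to the unit vectors in it.\<close>

lemma kernel_bound:
  fixes a :: "'i \<Rightarrow> 'y::metric_space \<Rightarrow> 'e::euclidean_space"
  assumes "compact K" "subspace E" "finite I" "finite J"
    and a: "\<And>i. i \<in> I \<Longrightarrow> continuous_on K (a i)"
    and b: "continuous_on K b"
    and Z: "\<And>j. j \<in> J \<Longrightarrow> continuous_on K (Z j)"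
    and ker: "\<And>y. y \<in> K \<Longrightarrow> {w \<in> E. \<forall>i\<in>I. a i y \<bullet> w = 0} = span ((\<lambda>j. Z j y) ` J)"
    and van: "\<And>y w. y \<in> K \<Longrightarrow> w \<in> E \<Longrightarrow> (\<And>i. i \<in> I \<Longrightarrow> a i y \<bullet> w = 0) \<Longrightarrow> b y \<bullet> w = 0"
  obtains C where "C \<ge> 0" "\<And>y w. y \<in> K \<Longrightarrow> w \<in> E \<Longrightarrow> \<bar>b y \<bullet> w\<bar> \<le> C * (\<Sum>i\<in>I. \<bar>a i y \<bullet> w\<bar>)"
proof -
  define S where "S = K \<times> (sphere 0 1 \<inter> E)"
  define g where "g p = (\<Sum>j\<in>J. (Z j (fst p) \<bullet> snd p)\<^sup>2)" for p
  \<comment> \<open>Unit vectors of \<open>E\<close> orthogonal to the kernel, over all of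
    \<open>K\<close>; \<open>g\<close> tests orthogonality against the spanning fields.\<close>
  define Q where "Q = {p \<in> S. g p = 0}"
  define G where "G p = (\<Sum>i\<in>I. \<bar>a i (fst p) \<bullet> snd p\<bar>)" for p
  have cS: "compact S" unfolding S_def
    using assms by (intro compact_Times compact_Int_closed closed_subspace) auto
  have cf: "continuous_on S (\<lambda>p. h (fst p) \<bullet> snd p)" if "continuous_on K h" for h :: "'y \<Rightarrow> 'e"
    by (intro continuous_intros continuous_on_compose2[OF that]) (auto simp: S_def)
  have "continuous_on S g" unfolding g_def by (intro continuous_on_sum continuous_on_power cf Z)
  then have cQ: "compact Q"
    unfolding Q_def by (intro closedin_compact[OF cS] continuous_closedin_preimage_constant)
  have QS: "Q \<subseteq> S" by (simp add: Q_def)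
  have cG: "continuous_on Q G" unfolding G_def
    by (rule continuous_on_subset[OF _ QS]) (intro continuous_on_sum continuous_on_rabs cf a)
  have Zp: "snd p \<bullet> x = 0" if p: "p \<in> Q" and x: "x \<in> span ((\<lambda>j. Z j (fst p)) ` J)" for p x
  proof -
    have "Z j (fst p) \<bullet> snd p = 0" if "j \<in> J" for j
      using p that \<open>finite J\<close> by (auto simp: Q_def g_def sum_nonneg_eq_0_iff)
    then have "orthogonal (snd p) x"
      using x by (intro orthogonal_to_span[of x]) (auto simp: orthogonal_def inner_commute)
    then show ?thesis by (simp add: orthogonal_def)
  qed
  have Gpos: "G p > 0" if p: "p \<in> Q" for p
  proof (rule ccontr)
    assume "\<not> G p > 0"
    moreover have "G p \<ge> 0" by (simp add: G_def sum_nonneg)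
    ultimately have "G p = 0" by simp
    then have "\<forall>i\<in>I. a i (fst p) \<bullet> snd p = 0"
      using \<open>finite I\<close> by (simp add: G_def sum_nonneg_eq_0_iff)
    moreover have "snd p \<in> E" "fst p \<in> K" "norm (snd p) = 1" using p by (auto simp: Q_def S_def)
    ultimately have "snd p \<in> span ((\<lambda>j. Z j (fst p)) ` J)" using ker by blast
    from Zp[OF p this] \<open>norm (snd p) = 1\<close> show False by simp
  qed
  \<comment> \<open>The minimum of \<open>G\<close> on the compact set \<open>Q\<close>. If
    \<open>Q\<close> is empty, any positive constant serves.\<close>
  obtain c where c: "c > 0" "\<And>p. p \<in> Q \<Longrightarrow> G p \<ge> c"
  proof (cases "Q = {}")
    case True
    then show ?thesis using that[of 1] by simp
  next
    case False
    then show ?thesis using continuous_attains_inf[OF cQ False cG] Gpos that by blast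
  qed
  obtain B where B: "B > 0" "\<And>y. y \<in> K \<Longrightarrow> norm (b y) \<le> B"
    using compact_imp_bounded[OF compact_continuous_image[OF b \<open>compact K\<close>]]
    unfolding bounded_pos by auto
  show thesis
  proof (rule that[of "B / c"])
    show "B / c \<ge> 0" using B c by simp
    fix y w assume y: "y \<in> K" and w: "w \<in> E"
    let ?V = "span ((\<lambda>j. Z j y) ` J)"
    \<comment> \<open>The kernel part \<open>w1\<close> contributes to neither side of the estimate.
      The other part is a multiple of a vector belonging to \<open>Q\<close>, where \<open>B\<close>
      bounds the left side and \<open>c\<close> bounds the sum from below.\<close>
    obtain w1 w2 where w1: "w1 \<in> ?V" and w2: "\<And>x. x \<in> ?V \<Longrightarrow> orthogonal w2 x" and ww: "w = w1 + w2"
      using orthogonal_subspace_decomp_exists[of "(\<lambda>j. Z j y) ` J" w] by metis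
    have w1k: "w1 \<in> E" "\<And>i. i \<in> I \<Longrightarrow> a i y \<bullet> w1 = 0" using w1 ker[OF y] by blast+
    have w2E: "w2 \<in> E" using subspace_diff[OF \<open>subspace E\<close> w w1k(1)] ww by simp
    have bw: "b y \<bullet> w = b y \<bullet> w2" using van[OF y w1k] by (simp add: ww inner_add_right)
    have aw: "(\<Sum>i\<in>I. \<bar>a i y \<bullet> w\<bar>) = G (y, w2)"
      unfolding G_def by (intro sum.cong) (auto simp: ww inner_add_right w1k)
    show "\<bar>b y \<bullet> w\<bar> \<le> B / c * (\<Sum>i\<in>I. \<bar>a i y \<bullet> w\<bar>)"
    proof (cases "w2 = 0")
      case True
      then show ?thesis using B c by (simp add: bw aw G_def)
    next
      case False
      define u where "u = (1 / norm w2) *\<^sub>R w2"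
      have w2u: "w2 = norm w2 *\<^sub>R u" using False by (simp add: u_def)
      have "Z j y \<bullet> u = 0" if "j \<in> J" for j
        using w2[of "Z j y"] that by (auto simp: u_def orthogonal_def inner_commute span_base)
      then have uQ: "(y, u) \<in> Q"
        using y False subspace_scale[OF \<open>subspace E\<close> w2E] by (auto simp: Q_def S_def g_def u_def)
      have "\<bar>b y \<bullet> u\<bar> \<le> norm (b y) * norm u" by (rule Cauchy_Schwarz_ineq2)
      also have "\<dots> \<le> B" using B(2)[OF y] False by (simp add: u_def)
      also have "\<dots> \<le> B / c * G (y, u)" using c(2)[OF uQ] B c by (simp add: field_simps)
      finally have bu: "\<bar>b y \<bullet> u\<bar> \<le> B / c * G (y, u)" .
      have "\<bar>b y \<bullet> w2\<bar> = norm w2 * \<bar>b y \<bullet> u\<bar>"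
        by (subst w2u) (simp add: abs_mult)
      also have "\<dots> \<le> norm w2 * (B / c * G (y, u))" using bu by (intro mult_left_mono) auto
      also have "\<dots> = B / c * G (y, w2)"
      proof -
        have "G (y, w2) = norm w2 * G (y, u)"
          unfolding G_def by (subst w2u) (simp add: abs_mult sum_distrib_left)
        then show ?thesis by simp
      qed
      finally show ?thesis unfolding bw aw .
    qed
  qed
qed

text \<open>Along a trajectory of \<open>f\<close>, involutivity turns the derivatives of the numbers
  \<open>a i (y t) \<bullet> Y t\<close> into linear combinations of these numbers, with bounded coefficients.\<close>

lemma kernel_invariant_under_variation:
  fixes a :: "'i \<Rightarrow> 'e::euclidean_space \<Rightarrow> 'e"
  assumes "\<rho> < r" "subspace E" "finite I" "finite J"
    and f: "C1_on (ball y0 r) f f'"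
    and a: "\<And>i. i \<in> I \<Longrightarrow> C1_on (ball y0 r) (a i) (a' i)"
    and Z: "\<And>j. j \<in> J \<Longrightarrow> continuous_on (ball y0 r) (Z j)"
    and ker: "\<And>y. y \<in> ball y0 r \<inter> E \<Longrightarrow>
      {w \<in> E. \<forall>i\<in>I. a i y \<bullet> w = 0} = span ((\<lambda>j. Z j y) ` J)"
    and fE: "\<And>y. y \<in> ball y0 r \<Longrightarrow> f y \<in> E"
    and af: "\<And>i y. i \<in> I \<Longrightarrow> y \<in> ball y0 r \<Longrightarrow> a i y \<bullet> f y = 0"
    and invol: "\<And>i y u w. i \<in> I \<Longrightarrow> y \<in> ball y0 r \<inter> E \<Longrightarrow> u \<in> E \<Longrightarrow> w \<in> E \<Longrightarrow>
      (\<And>i. i \<in> I \<Longrightarrow> a i y \<bullet> u = 0) \<Longrightarrow> (\<And>i. i \<in> I \<Longrightarrow> a i y \<bullet> w = 0) \<Longrightarrow>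
      (a' i y) u \<bullet> w = (a' i y) w \<bullet> u"
    and yin: "\<And>t. \<bar>t\<bar> < \<epsilon> \<Longrightarrow> y t \<in> ball y0 \<rho> \<inter> E"
    and yd: "\<And>t. \<bar>t\<bar> < \<epsilon> \<Longrightarrow> (y has_vector_derivative f (y t)) (at t)"
    and YE: "\<And>t. \<bar>t\<bar> < \<epsilon> \<Longrightarrow> Y t \<in> E"
    and Yd: "\<And>t. \<bar>t\<bar> < \<epsilon> \<Longrightarrow> (Y has_vector_derivative (f' (y t)) (Y t)) (at t)"
    and Y0: "\<And>i. i \<in> I \<Longrightarrow> a i (y 0) \<bullet> Y 0 = 0"
    and t: "\<bar>t\<bar> < \<epsilon>" and i: "i \<in> I"
  shows "a i (y t) \<bullet> Y t = 0"
proof -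
  define K where "K = cball y0 \<rho> \<inter> E"
  have K: "compact K" "K \<subseteq> ball y0 r" "K \<subseteq> ball y0 r \<inter> E"
    using assms(1,2) by (auto simp: K_def intro: compact_Int_closed closed_subspace)
  have cK: "continuous_on K h" if "continuous_on (ball y0 r) h" for h :: "'e \<Rightarrow> 'c::topological_space"
    using continuous_on_subset[OF that K(2)] .
  have cf: "continuous_on K f"
    by (rule cK[OF C1_on_imp_continuous_on[OF f]])
  have ca: "continuous_on K (a i)" if "i \<in> I" for i
    by (rule cK[OF C1_on_imp_continuous_on[OF a[OF that]]])
  have ca': "continuous_on K (a' i)" if "i \<in> I" for i
    by (rule cK) (use a[OF that] in \<open>simp add: C1_on_def\<close>)
  \<comment> \<open>The vector representing the covector d(\<open>a i\<close>)(\<open>f\<close>, _).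
    The sum over \<open>Basis\<close> is the transpose of \<open>a' i y\<close> applied to
    \<open>f y\<close>.\<close>
  define b where "b i y = blinfun_apply (a' i y) (f y)
      - (\<Sum>e\<in>Basis. (blinfun_apply (a' i y) e \<bullet> f y) *\<^sub>R e)" for i y
  have b: "b i y \<bullet> w = (a' i y) (f y) \<bullet> w - (a' i y) w \<bullet> f y" for i y w
  proof -
    have "(a' i y) w = (\<Sum>e\<in>Basis. (w \<bullet> e) *\<^sub>R (a' i y) e)"
      by (subst (1) euclidean_representation[of w, symmetric])
        (simp only: blinfun.sum_right blinfun.scaleR_right)
    then show ?thesis
      unfolding b_def by (simp add: inner_diff_left inner_sum_left inner_commute[of w] mult.commute)
  qed
  have "\<exists>C\<ge>0. \<forall>y\<in>K. \<forall>w\<in>E. \<bar>b i y \<bullet> w\<bar> \<le> C * (\<Sum>i\<in>I. \<bar>a i y \<bullet> w\<bar>)" if i: "i \<in> I" for i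
  proof -
    have cb: "continuous_on K (b i)"
      unfolding b_def by (intro continuous_intros ca' cf i)
    have van: "b i y \<bullet> w = 0" if "y \<in> K" "w \<in> E" "\<And>j. j \<in> I \<Longrightarrow> a j y \<bullet> w = 0" for y w
    proof -
      have y: "y \<in> ball y0 r" "y \<in> ball y0 r \<inter> E" using \<open>y \<in> K\<close> K by auto
      have "(a' i y) (f y) \<bullet> w = (a' i y) w \<bullet> f y"
        by (rule invol[OF i y(2) fE[OF y(1)] \<open>w \<in> E\<close> af[OF _ y(1)] that(3)])
      then show ?thesis by (simp add: b)
    qed
    have kerK: "{w \<in> E. \<forall>i\<in>I. a i y \<bullet> w = 0} = span ((\<lambda>j. Z j y) ` J)" if "y \<in> K" for y
      using ker that K(3) by blast
    show ?thesis
      by (rule kernel_bound[OF K(1) assms(2,3,4) ca cb cK[OF Z] kerK van]) blast+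
  qed
  then obtain C where C0: "\<And>i. i \<in> I \<Longrightarrow> C i \<ge> 0"
    and C: "\<And>i y w. i \<in> I \<Longrightarrow> y \<in> K \<Longrightarrow> w \<in> E \<Longrightarrow> \<bar>b i y \<bullet> w\<bar> \<le> C i * (\<Sum>i\<in>I. \<bar>a i y \<bullet> w\<bar>)"
    by metis
  define \<alpha> where "\<alpha> i t = a i (y t) \<bullet> Y t" for i t
  define q where "q t = (\<Sum>i\<in>I. (\<alpha> i t)\<^sup>2)" for t
  define q' where "q' t = (\<Sum>i\<in>I. 2 * (\<alpha> i t * (b i (y t) \<bullet> Y t)))" for t
  have \<alpha>d: "(\<alpha> i has_real_derivative b i (y t) \<bullet> Y t) (at t)" if i: "i \<in> I" and t: "\<bar>t\<bar> < \<epsilon>" for i t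
  proof -
    have yb: "y t \<in> ball y0 r" using yin[OF t] \<open>\<rho> < r\<close> by auto
    have da: "(a i has_derivative (a' i (y t))) (at (y t))"
      using a[OF i] yb by (simp add: C1_on_def)
    have df: "(f has_derivative (f' (y t))) (at (y t))"
      using f yb by (simp add: C1_on_def)
    \<comment> \<open>Differentiating the identity \<open>af\<close> along \<open>Y t\<close> trades
      the term with \<open>f'\<close> for one with \<open>a' i\<close>. Together with the change of
      \<open>a i\<close> along the trajectory, only d(\<open>a i\<close>)(\<open>f\<close>,
      \<open>Y\<close>) remains.\<close>
    have "((\<lambda>z. a i z \<bullet> f z) has_derivative
        (\<lambda>v. a i (y t) \<bullet> (f' (y t)) v + (a' i (y t)) v \<bullet> f (y t))) (at (y t))"
      by (rule has_derivative_inner[OF da df])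
    moreover have "((\<lambda>z. a i z \<bullet> f z) has_derivative (\<lambda>v. 0)) (at (y t))"
      by (rule has_derivative_transform_within_open[OF has_derivative_const[of 0] open_ball yb])
         (simp add: af i)
    ultimately have "(\<lambda>v. a i (y t) \<bullet> (f' (y t)) v + (a' i (y t)) v \<bullet> f (y t))
        = (\<lambda>v. 0)" by (rule has_derivative_unique)
    from fun_cong[OF this, of "Y t"]
    have 1: "a i (y t) \<bullet> (f' (y t)) (Y t) = - ((a' i (y t)) (Y t) \<bullet> f (y t))"
      by simp
    have day: "((\<lambda>s. a i (y s)) has_derivative (\<lambda>s. (a' i (y t)) (s *\<^sub>R f (y t)))) (at t)"
      by (rule has_derivative_compose[where f = y, OF yd[OF t, unfolded has_vector_derivative_def] da])
    have "(\<alpha> i has_derivative (\<lambda>s. a i (y t) \<bullet> (s *\<^sub>R blinfun_apply (f' (y t)) (Y t))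
        + (a' i (y t)) (s *\<^sub>R f (y t)) \<bullet> Y t)) (at t)"
      unfolding \<alpha>_def
      by (rule has_derivative_inner[OF day]) (use Yd[OF t] in \<open>simp add: has_vector_derivative_def\<close>)
    moreover have "(\<lambda>s. a i (y t) \<bullet> (s *\<^sub>R (f' (y t)) (Y t))
        + (a' i (y t)) (s *\<^sub>R f (y t)) \<bullet> Y t) = (*) (b i (y t) \<bullet> Y t)"
      by (rule ext) (simp add: 1 b blinfun.scaleR_right algebra_simps)
    ultimately show ?thesis by (simp add: has_field_derivative_def)
  qed
  have qd: "(q has_real_derivative q' t) (at t)" if "\<bar>t\<bar> < \<epsilon>" for t
    unfolding q_def q'_def
    by (rule DERIV_sum) (use \<alpha>d that in \<open>auto intro!: derivative_eq_intros\<close>)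
  define CC where "CC = (\<Sum>i\<in>I. C i)"
  have CC: "C i \<le> CC" if "i \<in> I" for i
    unfolding CC_def using that C0 \<open>finite I\<close> by (intro member_le_sum) auto
  \<comment> \<open>In the double sum over \<open>I\<close> of \<open>CC\<close> times two squares,
    each square occurs \<open>2 * card I\<close> times.\<close>
  define N where "N = 2 * CC * real (card I)"
  have q'b: "\<bar>q' t\<bar> \<le> N * q t" if t: "\<bar>t\<bar> < \<epsilon>" for t
  proof -
    have yK: "y t \<in> K" using yin[OF t] by (auto simp: K_def)
    have "\<bar>q' t\<bar> \<le> (\<Sum>i\<in>I. \<bar>2 * (\<alpha> i t * (b i (y t) \<bullet> Y t))\<bar>)" unfolding q'_def by (rule sum_abs)
    also have "\<dots> \<le> (\<Sum>i\<in>I. \<Sum>j\<in>I. CC * ((\<alpha> i t)\<^sup>2 + (\<alpha> j t)\<^sup>2))"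
    proof (rule sum_mono)
      fix i assume i: "i \<in> I"
      have nn: "0 \<le> (\<Sum>j\<in>I. \<bar>\<alpha> j t\<bar>)" by (simp add: sum_nonneg)
      have CC0: "CC \<ge> 0" using CC[OF i] C0[OF i] by simp
      have "\<bar>2 * (\<alpha> i t * (b i (y t) \<bullet> Y t))\<bar> \<le> 2 * (\<bar>\<alpha> i t\<bar> * (C i * (\<Sum>j\<in>I. \<bar>\<alpha> j t\<bar>)))"
        using C[OF i yK YE[OF t]] by (simp add: abs_mult mult_left_mono flip: \<alpha>_def)
      also have "\<dots> \<le> 2 * (\<bar>\<alpha> i t\<bar> * (CC * (\<Sum>j\<in>I. \<bar>\<alpha> j t\<bar>)))"
        using CC[OF i] nn by (intro mult_left_mono mult_right_mono) auto
      also have "\<dots> = (\<Sum>j\<in>I. CC * (2 * \<bar>\<alpha> i t\<bar> * \<bar>\<alpha> j t\<bar>))"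
        by (simp add: sum_distrib_left mult_ac)
      also have "\<dots> \<le> (\<Sum>j\<in>I. CC * ((\<alpha> i t)\<^sup>2 + (\<alpha> j t)\<^sup>2))"
      proof (intro sum_mono mult_left_mono CC0)
        fix j show "2 * \<bar>\<alpha> i t\<bar> * \<bar>\<alpha> j t\<bar> \<le> (\<alpha> i t)\<^sup>2 + (\<alpha> j t)\<^sup>2"
          using sum_squares_bound[of "\<bar>\<alpha> i t\<bar>" "\<bar>\<alpha> j t\<bar>"] by simp
      qed
      finally show "\<bar>2 * (\<alpha> i t * (b i (y t) \<bullet> Y t))\<bar> \<le> (\<Sum>j\<in>I. CC * ((\<alpha> i t)\<^sup>2 + (\<alpha> j t)\<^sup>2))" .
    qed
    also have "\<dots> = N * q t"
      by (simp add: N_def q_def sum.distrib distrib_left flip: sum_distrib_left)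
    finally show ?thesis .
  qed
  have "q t \<le> q 0 * exp (N * \<bar>t\<bar>)"
  proof (rule gronwall)
    fix s assume "s \<in> closed_segment 0 t"
    then have s: "\<bar>s\<bar> < \<epsilon>" using t by (auto simp: closed_segment_eq_real_ivl split: if_splits)
    show "(q has_real_derivative q' s) (at s)" "\<bar>q' s\<bar> \<le> N * q s" using qd[OF s] q'b[OF s] by auto
  qed
  moreover have "q 0 = 0" using Y0 by (simp add: q_def \<alpha>_def)
  ultimately have "q t \<le> 0" by simp
  moreover have "(\<alpha> i t)\<^sup>2 \<le> q t" unfolding q_def using i \<open>finite I\<close> by (intro member_le_sum) auto
  ultimately have "(\<alpha> i t)\<^sup>2 \<le> 0" by linarith
  then show ?thesis by (simp add: \<alpha>_def)
qed

section \<open>Smooth maps on relatively open subsets of a subspace\<close>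

text \<open>A retraction of the whole space onto a subspace \<open>E\<close>. Composing with it
  turns a map on a relatively open part of \<open>E\<close> into one on an open set. The norm
  condition makes it send every ball centred in \<open>E\<close> into itself.\<close>

definition proj :: "'e::euclidean_space set \<Rightarrow> 'e \<Rightarrow> 'e"
  where "proj E = (SOME P. bounded_linear P \<and> (\<forall>x. P x \<in> E) \<and> (\<forall>x\<in>E. P x = x) \<and> (\<forall>x. norm (P x) \<le> norm x))"

lemma proj:
  assumes "subspace E"
  shows "bounded_linear (proj E)" "proj E x \<in> E" "x \<in> E \<Longrightarrow> proj E x = x" "norm (proj E x) \<le> norm x"
proof -
  obtain B where B: "B \<subseteq> E" "pairwise orthogonal B" "\<And>x. x \<in> B \<Longrightarrow> norm x = 1" "independent B" "span B = E"
    using orthonormal_basis_subspace[OF assms] by metis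
  have "finite B" using B(4) independent_imp_finite by blast
  define P where "P x = (\<Sum>b\<in>B. (x \<bullet> b) *\<^sub>R b)" for x
  have "bounded_linear P" unfolding P_def
    by (intro bounded_linear_sum bounded_linear_scaleR_left[THEN bounded_linear_compose] bounded_linear_inner_left)
  moreover have PE: "P x \<in> E" for x
    unfolding P_def using B(1) assms by (auto intro!: subspace_sum subspace_scale)
  moreover have orth: "(x - P x) \<bullet> y = 0" if "y \<in> E" for x y
  proof -
    have "(x - P x) \<bullet> b = 0" if "b \<in> B" for b
    proof -
      have "P x \<bullet> b = (\<Sum>b'\<in>B. if b' = b then x \<bullet> b else 0)"
        unfolding P_def inner_sum_left
        using B(2,3) that by (intro sum.cong) (auto simp: pairwise_def orthogonal_def dot_square_norm)
      then show ?thesis using \<open>finite B\<close> that by (simp add: inner_diff_left)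
    qed
    then have "orthogonal (x - P x) y"
      using that B(5) by (intro orthogonal_to_span[of y]) (auto simp: orthogonal_def)
    then show ?thesis by (simp add: orthogonal_def)
  qed
  moreover have "P x = x" if "x \<in> E" for x
    using orth[of "x - P x" x] subspace_diff[OF assms that PE] by simp
  moreover have "norm (P x) \<le> norm x" for x
  proof -
    have "(norm x)\<^sup>2 = (norm (x - P x))\<^sup>2 + (norm (P x))\<^sup>2"
      using orth[OF PE, of x x] norm_add_Pythagorean[of "x - P x" "P x"] by (simp add: orthogonal_def)
    then show ?thesis by (simp add: power2_le_imp_le)
  qed
  ultimately have "\<exists>P. bounded_linear P \<and> (\<forall>x. P x \<in> E) \<and> (\<forall>x\<in>E. P x = x) \<and> (\<forall>x. norm (P x) \<le> norm x)"
    by blast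
  from someI_ex[OF this, folded proj_def] show "bounded_linear (proj E)" "proj E x \<in> E" "x \<in> E \<Longrightarrow> proj E x = x" "norm (proj E x) \<le> norm x"
    by blast+
qed

lemma proj_in_ball:
  assumes "subspace E" "x \<in> E" "y \<in> ball x r"
  shows "proj E y \<in> ball x r" "proj E y \<in> ball x r \<inter> E"
proof -
  have "proj E y - x = proj E (y - x)"
    using proj[OF assms(1)] assms(2) by (simp add: linear_diff bounded_linear.linear)
  then have "norm (proj E y - x) \<le> norm (y - x)" using proj(4)[OF assms(1)] by simp
  then show "proj E y \<in> ball x r" using assms(3) by (simp add: dist_norm norm_minus_commute)
  then show "proj E y \<in> ball x r \<inter> E" using proj(2)[OF assms(1)] by blast
qed

text \<open>An arbitrary local extension \<open>g\<close> agrees with \<open>f\<close> on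
  \<open>S\<close>, and the projection lands in \<open>S\<close>, so \<open>g\<close> and
  \<open>f\<close> have the same composite with \<open>proj E\<close>. The extension thereby becomes
  one explicit formula for all orders of differentiability.\<close>

lemma smooth_on_extension:
  fixes f :: "'e::euclidean_space \<Rightarrow> 'b::euclidean_space"
  assumes E: "subspace E" and S: "openin (top_of_set E) S" and f: "smooth_on S f" and x: "x \<in> S"
  obtains r where "r > 0" "ball x r \<inter> E \<subseteq> S" "\<And>k. C_times_on k (ball x r) (\<lambda>y. f (proj E y))"
proof -
  obtain U g where U: "open U" "x \<in> U" "\<And>k. C_times_on k U g" "\<And>y. y \<in> U \<inter> S \<Longrightarrow> g y = f y"
    using f x unfolding smooth_on_def by metis
  obtain r1 where r1: "r1 > 0" "ball x r1 \<inter> E \<subseteq> S"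
    using S x unfolding openin_contains_ball by blast
  obtain r2 where r2: "r2 > 0" "ball x r2 \<subseteq> U"
    using U open_contains_ball by blast
  define r where "r = min r1 r2"
  have xE: "x \<in> E" using S x openin_imp_subset by blast
  have r: "r > 0" "ball x r \<inter> E \<subseteq> S" "ball x r \<subseteq> U" using r1 r2 by (auto simp: r_def)
  have pin: "proj E y \<in> U" "proj E y \<in> S" if "y \<in> ball x r" for y
    using proj_in_ball[OF E xE that] r by auto
  show thesis
  proof (rule that[OF r(1,2)])
    fix k
    have "C_times_on k (proj E -` U) (\<lambda>y. g (proj E y))"
      by (rule C_times_on_compose_linear[OF proj(1)[OF E] U(1,3)])
    then have "C_times_on k (ball x r) (\<lambda>y. g (proj E y))"
      by (rule C_times_on_subset) (use pin in auto)
    then show "C_times_on k (ball x r) (\<lambda>y. f (proj E y))"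
      by (rule C_times_on_cong[OF open_ball, rotated]) (use pin U in auto)
  qed
qed

lemma smooth_on_differentiable:
  assumes "subspace E" "openin (top_of_set E) S" "smooth_on S f" "x \<in> S" "S \<subseteq> T" "T \<subseteq> E"
  shows "f differentiable (at x within T)"
proof -
  obtain r where r: "r > 0" "ball x r \<inter> E \<subseteq> S" "\<And>k. C_times_on k (ball x r) (\<lambda>y. f (proj E y))"
    by (rule smooth_on_extension[OF assms(1-4)]) blast
  have "(\<lambda>y. f (proj E y)) differentiable (at x)"
    using r(3)[of "Suc 0"] r(1) by simp
  then obtain F where "((\<lambda>y. f (proj E y)) has_derivative F) (at x within T)"
    unfolding differentiable_def using has_derivative_at_withinI by blast
  then have "(f has_derivative F) (at x within T)"
    by (rule has_derivative_transform[rotated 2]) (use assms proj(3)[OF assms(1)] in auto)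
  then show ?thesis by (auto simp: differentiable_def)
qed

lemma has_derivative_compose_proj:
  fixes f :: "'e::euclidean_space \<Rightarrow> 'b::real_normed_vector"
  assumes E: "subspace E" and T: "openin (top_of_set E) T" "x \<in> T"
    and F: "(f has_derivative F) (at x within T)"
  shows "((\<lambda>y. f (proj E y)) has_derivative (\<lambda>w. F (proj E w))) (at x)"
proof -
  obtain r where r: "r > 0" "ball x r \<inter> E \<subseteq> T"
    using T unfolding openin_contains_ball by blast
  have xE: "x \<in> E" using T openin_imp_subset by blast
  have sub: "proj E ` ball x r \<subseteq> T" using proj_in_ball[OF E xE] r by blast
  have "(f has_derivative F) (at (proj E x) within proj E ` ball x r)"
    using has_derivative_subset[OF F sub] proj(3)[OF E xE] by simp
  then have "((\<lambda>y. f (proj E y)) has_derivative (\<lambda>w. F (proj E w))) (at x within ball x r)"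
    by (rule has_derivative_in_compose[OF bounded_linear_imp_has_derivative[OF proj(1)[OF E]]])
  then show ?thesis using r by (simp add: at_within_open[of x "ball x r"])
qed

text \<open>A derivative within a subset of \<open>E\<close> is determined only on vectors of
  \<open>E\<close>. Both candidates, composed with the projection, are ordinary derivatives of the
  same function.\<close>

lemma has_derivative_within_unique:
  fixes f :: "'e::euclidean_space \<Rightarrow> 'b::real_normed_vector"
  assumes E: "subspace E" and T: "openin (top_of_set E) T" "x \<in> T"
    and F: "(f has_derivative F) (at x within T)" and G: "(f has_derivative G) (at x within T)"
    and w: "w \<in> E"
  shows "F w = G w"
proof -
  have "(\<lambda>w. F (proj E w)) = (\<lambda>w. G (proj E w))"
    by (rule has_derivative_unique[OF has_derivative_compose_proj[OF E T F] has_derivative_compose_proj[OF E T G]])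
  from fun_cong[OF this, of w] show ?thesis using proj(3)[OF E w] by simp
qed

text \<open>Projecting the values to \<open>E'\<close> does not change \<open>f\<close> on
  \<open>T\<close>, so uniqueness forces \<open>F w\<close> to be fixed by the projection.\<close>

lemma has_derivative_in_subspace:
  fixes f :: "'e::euclidean_space \<Rightarrow> 'b::euclidean_space"
  assumes E: "subspace E" and T: "openin (top_of_set E) T" "x \<in> T"
    and F: "(f has_derivative F) (at x within T)" and E': "subspace E'" "f ` T \<subseteq> E'" and w: "w \<in> E"
  shows "F w \<in> E'"
proof -
  have "((\<lambda>y. proj E' (f y)) has_derivative (\<lambda>w. proj E' (F w))) (at x within T)"
    by (rule bounded_linear.has_derivative[OF proj(1)[OF E'(1)] F])
  then have "(f has_derivative (\<lambda>w. proj E' (F w))) (at x within T)"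
    by (rule has_derivative_transform[OF T(2), rotated]) (use E'(2) in \<open>auto simp: image_subset_iff proj(3)[OF E'(1)]\<close>)
  then have "F w = proj E' (F w)" by (rule has_derivative_within_unique[OF E T F _ w])
  then show ?thesis using proj(2)[OF E'(1)] by metis
qed

lemma at_within_openin:
  fixes x :: "'b::metric_space"
  assumes "openin (top_of_set E) T" "x \<in> T" "T \<subseteq> S" "S \<subseteq> E"
  shows "at x within T = at x within S"
proof -
  obtain r where r: "r > 0" "ball x r \<inter> E \<subseteq> T"
    using assms unfolding openin_contains_ball by blast
  show ?thesis
    by (rule at_within_nhd[of x "ball x r"]) (use r assms in auto)
qed


section \<open>Charts\<close>

lemma charts_atD: "c \<in> charts_at M p \<Longrightarrow> c \<in> atlas M" "c \<in> charts_at M p \<Longrightarrow> p \<in> fst c"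
  by (simp_all add: charts_at_def)

lemma charts_at_ex:
  assumes "smooth_manifold M" "p \<in> points M"
  obtains c where "c \<in> charts_at M p"
proof -
  have "p \<in> \<Union> (fst ` atlas M)" using assms by (simp add: smooth_manifold_def)
  then show thesis using that by (auto simp: charts_at_def)
qed

lemma smooth_manifold_subspace: "smooth_manifold M \<Longrightarrow> subspace (model M)"
  by (simp add: smooth_manifold_def)

context
  fixes M :: "('a, 'e::euclidean_space) manifold" and c :: "('a, 'e) chart"
  assumes M: "smooth_manifold M" and c: "c \<in> atlas M"
begin

lemma chart_openin: "openin (topol M) (fst c)"
  and chart_image_openin: "openin (top_of_set (model M)) (snd c ` fst c)"
  and chart_homeo: "homeomorphic_map (subtopology (topol M) (fst c)) (top_of_set (snd c ` fst c)) (snd c)"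
  using M c by (simp_all add: smooth_manifold_def)

lemma chart_subset_points: "fst c \<subseteq> points M"
  using chart_openin openin_subset by blast

lemma chart_inj: "inj_on (snd c) (fst c)"
  using homeomorphic_imp_injective_map[OF chart_homeo] chart_subset_points
  by (simp add: Int_absorb1)

lemma chart_inv_left: "q \<in> fst c \<Longrightarrow> chart_inv c (snd c q) = q"
  unfolding chart_inv_def by (rule inv_into_f_f[OF chart_inj])

lemma chart_inv_right: "y \<in> snd c ` fst c \<Longrightarrow> snd c (chart_inv c y) = y"
  unfolding chart_inv_def by (rule f_inv_into_f)

lemma chart_inv_in: "y \<in> snd c ` fst c \<Longrightarrow> chart_inv c y \<in> fst c"
  unfolding chart_inv_def by (rule inv_into_into)

lemma chart_image_subset: "snd c ` fst c \<subseteq> model M"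
  using chart_image_openin openin_imp_subset by blast

lemma chart_image_openin_Int:
  assumes "openin (topol M) V"
  shows "openin (top_of_set (model M)) (snd c ` (fst c \<inter> V))"
proof -
  have "openin (subtopology (topol M) (fst c)) (fst c \<inter> V)"
    using assms openin_subtopology_Int2 by blast
  then have "openin (top_of_set (snd c ` fst c)) (snd c ` (fst c \<inter> V))"
    using homeomorphic_map_openness[OF chart_homeo, of "fst c \<inter> V"] chart_subset_points by auto
  then show ?thesis using chart_image_openin openin_trans by blast
qed

lemma chart_preimage_openin:
  assumes "open W"
  shows "openin (topol M) {q \<in> fst c. snd c q \<in> W}"
proof -
  have "openin (top_of_set (snd c ` fst c)) (snd c ` fst c \<inter> W)"
    using assms by (simp add: openin_open_Int)
  from openin_continuous_map_preimage[OF homeomorphic_imp_continuous_map[OF chart_homeo] this]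
  have "openin (subtopology (topol M) (fst c)) {q \<in> fst c. snd c q \<in> W}"
    using chart_subset_points by (simp add: Int_absorb1 conj_commute cong: conj_cong)
  then show ?thesis using chart_openin openin_trans_full by blast
qed

lemma chart_ball:
  assumes "openin (topol M) V" "q \<in> fst c" "q \<in> V"
  obtains r where "r > 0" "ball (snd c q) r \<inter> model M \<subseteq> snd c ` (fst c \<inter> V)"
  using chart_image_openin_Int[OF assms(1)] assms(2,3) unfolding openin_contains_ball by blast

lemma chart_inv_continuous_map:
  "continuous_map (top_of_set (snd c ` fst c)) (topol M) (chart_inv c)"
proof -
  have "openin (top_of_set (snd c ` fst c)) {y \<in> snd c ` fst c. chart_inv c y \<in> V}"
    if "openin (topol M) V" for V
  proof -
    have "{y \<in> snd c ` fst c. chart_inv c y \<in> V} = snd c ` (fst c \<inter> V)"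
      using chart_inv_left by fastforce
    then show ?thesis
      using openin_subset_trans[OF chart_image_openin_Int[OF that] _ chart_image_subset] by auto
  qed
  then show ?thesis
    using chart_inv_in chart_subset_points by (auto simp: continuous_map_def)
qed

end

section \<open>Differentials in charts\<close>

definition chart_diff :: "('a, 'e::euclidean_space) chart \<Rightarrow> ('b, 'f::euclidean_space) chart \<Rightarrow> ('a \<Rightarrow> 'b) \<Rightarrow> 'a \<Rightarrow> bool"
  where "chart_diff c c' F p \<longleftrightarrow>
    (snd c' \<circ> F \<circ> chart_inv c) differentiable (at (snd c p) within snd c ` fst c)"

lemma chart_diff_has_derivative:
  "chart_diff c c' F p \<Longrightarrow>
    ((snd c' \<circ> F \<circ> chart_inv c) has_derivative local_deriv c c' F p) (at (snd c p) within snd c ` fst c)"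
  by (simp add: chart_diff_def local_deriv_def frechet_derivative_works)

lemma chart_diff_linear: "chart_diff c c' F p \<Longrightarrow> linear (local_deriv c c' F p)"
  by (rule has_derivative_linear[OF chart_diff_has_derivative])

lemma local_deriv_unique:
  assumes M: "smooth_manifold M" and c: "c \<in> charts_at M p"
    and A: "((snd c' \<circ> F \<circ> chart_inv c) has_derivative A) (at (snd c p) within snd c ` fst c)"
    and w: "w \<in> model M"
  shows "local_deriv c c' F p w = A w"
proof (rule has_derivative_within_unique[OF smooth_manifold_subspace[OF M] _ _ _ A w])
  show "openin (top_of_set (model M)) (snd c ` fst c)"
    using chart_image_openin[OF M] c by (simp add: charts_at_def)
  show "snd c p \<in> snd c ` fst c" using c by (simp add: charts_at_def)
  have "chart_diff c c' F p" using A by (auto simp: chart_diff_def differentiable_def)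
  then show "((snd c' \<circ> F \<circ> chart_inv c) has_derivative local_deriv c c' F p) (at (snd c p) within snd c ` fst c)"
    by (rule chart_diff_has_derivative)
qed

text \<open>On the image of \<open>V\<close> the coordinate expression of the composite is the
  composite of the coordinate expressions. The chart \<open>c'\<close> enters through its inverse
  property, so it may belong to another manifold; this is how chart transitions of \<open>M\<close>
  are applied after the inclusion of a submanifold.\<close>

lemma local_deriv_chain:
  assumes M: "smooth_manifold M" and c: "c \<in> charts_at M p"
    and V: "openin (topol M) V" "p \<in> V" "\<And>q. q \<in> V \<Longrightarrow> F q \<in> fst c'"
    and c'inv: "\<And>q. q \<in> fst c' \<Longrightarrow> chart_inv c' (snd c' q) = q"
    and dF: "chart_diff c c' F p" and dG: "chart_diff c' c'' G (F p)"
  shows "chart_diff c c'' (\<lambda>q. G (F q)) p"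
    and "w \<in> model M \<Longrightarrow> local_deriv c c'' (\<lambda>q. G (F q)) p w
      = local_deriv c' c'' G (F p) (local_deriv c c' F p w)"
proof -
  note ca = charts_atD[OF c]
  let ?S = "snd c ` fst c" and ?T = "snd c ` (fst c \<inter> V)" and ?y = "snd c p"
  have T: "openin (top_of_set (model M)) ?T" "?y \<in> ?T"
    using chart_image_openin_Int[OF M ca(1) V(1)] ca V by auto
  have within: "at ?y within ?T = at ?y within ?S"
    by (rule at_within_openin[OF T]) (use chart_image_subset[OF M ca(1)] in auto)
  let ?\<phi> = "snd c' \<circ> F \<circ> chart_inv c" and ?\<psi> = "snd c'' \<circ> G \<circ> chart_inv c'"
  have \<phi>y: "?\<phi> ?y = snd c' (F p)" by (simp add: chart_inv_left[OF M ca])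
  have sub: "?\<phi> ` ?T \<subseteq> snd c' ` fst c'"
    using V(3) by (auto simp: chart_inv_left[OF M ca(1)])
  have 1: "(?\<phi> has_derivative local_deriv c c' F p) (at ?y within ?T)"
    using chart_diff_has_derivative[OF dF] within by simp
  have "(?\<psi> has_derivative local_deriv c' c'' G (F p)) (at (?\<phi> ?y) within ?\<phi> ` ?T)"
    using has_derivative_subset[OF chart_diff_has_derivative[OF dG] sub] \<phi>y by simp
  from has_derivative_in_compose[OF 1 this]
  have 2: "((\<lambda>y. ?\<psi> (?\<phi> y)) has_derivative
      (\<lambda>w. local_deriv c' c'' G (F p) (local_deriv c c' F p w))) (at ?y within ?T)" .
  have "((snd c'' \<circ> (\<lambda>q. G (F q)) \<circ> chart_inv c) has_derivative
      (\<lambda>w. local_deriv c' c'' G (F p) (local_deriv c c' F p w))) (at ?y within ?T)"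
    by (rule has_derivative_transform[OF T(2) _ 2])
      (use V(3) c'inv in \<open>auto simp: chart_inv_left[OF M ca(1)]\<close>)
  then have 3: "((snd c'' \<circ> (\<lambda>q. G (F q)) \<circ> chart_inv c) has_derivative
      (\<lambda>w. local_deriv c' c'' G (F p) (local_deriv c c' F p w))) (at ?y within ?S)"
    by (simp only: within)
  then show "chart_diff c c'' (\<lambda>q. G (F q)) p" by (auto simp: chart_diff_def differentiable_def)
  show "w \<in> model M \<Longrightarrow> local_deriv c c'' (\<lambda>q. G (F q)) p w
      = local_deriv c' c'' G (F p) (local_deriv c c' F p w)"
    by (rule local_deriv_unique[OF M c 3])
qed

abbreviation id_deriv :: "('a, 'e::euclidean_space) chart \<Rightarrow> ('a, 'e) chart \<Rightarrow> 'a \<Rightarrow> 'e \<Rightarrow> 'e"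
  where "id_deriv c c' \<equiv> local_deriv c c' (\<lambda>q. q)"

lemma chart_diff_id:
  assumes M: "smooth_manifold M" and c: "c \<in> charts_at M p" "c' \<in> charts_at M p"
  shows "chart_diff c c' (\<lambda>q. q) p"
proof -
  have a: "c \<in> atlas M" "c' \<in> atlas M" "p \<in> fst c" "p \<in> fst c'" using c by (auto simp: charts_at_def)
  have "smooth_on (snd c ` (fst c \<inter> fst c')) (snd c' \<circ> chart_inv c)"
    using M a by (simp add: smooth_manifold_def)
  then have "(snd c' \<circ> chart_inv c) differentiable (at (snd c p) within snd c ` fst c)"
    by (rule smooth_on_differentiable[OF smooth_manifold_subspace[OF M]
          chart_image_openin_Int[OF M a(1) chart_openin[OF M a(2)]]])
       (use a chart_image_subset[OF M a(1)] in auto)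
  then show ?thesis by (simp add: chart_diff_def o_def)
qed

lemma local_deriv_self:
  assumes M: "smooth_manifold M" and c: "c \<in> charts_at M p" and w: "w \<in> model M"
  shows "id_deriv c c p w = w"
proof (rule local_deriv_unique[OF M c _ w])
  note a = charts_atD[OF c]
  show "((snd c \<circ> (\<lambda>q. q) \<circ> chart_inv c) has_derivative (\<lambda>w. w)) (at (snd c p) within snd c ` fst c)"
    by (rule has_derivative_transform[OF _ _ has_derivative_ident])
      (use a chart_inv_right[OF M a(1)] in auto)
qed

lemma local_deriv_cocycle:
  assumes M: "smooth_manifold M"
    and c: "c \<in> charts_at M p" "c' \<in> charts_at M p" "c'' \<in> charts_at M p" and w: "w \<in> model M"
  shows "id_deriv c c'' p w = id_deriv c' c'' p (id_deriv c c' p w)"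
proof -
  have a: "c' \<in> atlas M" "p \<in> fst c'" using c by (auto simp: charts_at_def)
  show ?thesis
    using local_deriv_chain(2)[OF M c(1) chart_openin[OF M a(1)] a(2), of "\<lambda>q. q" c' c'' "\<lambda>q. q" w]
      chart_inv_left[OF M a(1)] chart_diff_id[OF M] c w by simp
qed

lemma local_deriv_in_model:
  assumes M: "smooth_manifold M" and c: "c \<in> charts_at M p" "c' \<in> charts_at M p" and w: "w \<in> model M"
  shows "id_deriv c c' p w \<in> model M"
proof -
  have a: "c \<in> atlas M" "c' \<in> atlas M" "p \<in> fst c" "p \<in> fst c'" using c by (auto simp: charts_at_def)
  let ?T = "snd c ` (fst c \<inter> fst c')"
  show ?thesis
  proof (rule has_derivative_in_subspace[OF smooth_manifold_subspace[OF M] _ _ _ smooth_manifold_subspace[OF M] _ w])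
    show "openin (top_of_set (model M)) ?T"
      by (rule chart_image_openin_Int[OF M a(1) chart_openin[OF M a(2)]])
    show "((snd c' \<circ> (\<lambda>q. q) \<circ> chart_inv c) has_derivative id_deriv c c' p) (at (snd c p) within ?T)"
      by (rule has_derivative_subset[OF chart_diff_has_derivative[OF chart_diff_id[OF M c]]]) auto
    show "snd c p \<in> ?T" using a by auto
    show "(snd c' \<circ> (\<lambda>q. q) \<circ> chart_inv c) ` ?T \<subseteq> model M"
      using chart_image_subset[OF M a(2)] chart_inv_left[OF M a(1)] by auto
  qed
qed

section \<open>Tangent vectors in charts\<close>

lemma tangent_space_coord:
  assumes "v \<in> tangent_space M p" "c \<in> charts_at M p"
  shows "v c \<in> model M" "v = coord_vector M c p (v c)"
proof -
  show "v c \<in> model M" using assms unfolding tangent_space_def by blast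
  show "v = coord_vector M c p (v c)"
  proof
    fix c' show "v c' = coord_vector M c p (v c) c'"
    proof (cases "c' \<in> charts_at M p")
      case True
      then have "v c' = id_deriv c c' p (v c)"
        using assms unfolding tangent_space_def by blast
      then show ?thesis using True by (simp add: coord_vector_def)
    next
      case False
      then have "v c' = 0" using assms unfolding tangent_space_def by blast
      then show ?thesis using False by (simp add: coord_vector_def)
    qed
  qed
qed

lemma coord_vector_tangent:
  assumes M: "smooth_manifold M" and c: "c \<in> charts_at M p" and w: "w \<in> model M"
  shows "coord_vector M c p w \<in> tangent_space M p" "coord_vector M c p w c = w"
proof -
  show "coord_vector M c p w \<in> tangent_space M p"
    unfolding tangent_space_def
  proof (intro CollectI conjI allI ballI impI)
    fix c' c'' assume "c' \<in> charts_at M p" "c'' \<in> charts_at M p"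
    then show "coord_vector M c p w c'' = id_deriv c' c'' p (coord_vector M c p w c')"
      using local_deriv_cocycle[OF M c _ _ w, of c' c''] by (simp add: coord_vector_def)
  qed (simp_all add: coord_vector_def local_deriv_in_model[OF M c _ w])
  show "coord_vector M c p w c = w"
    unfolding coord_vector_def using local_deriv_self[OF M c w] c by simp
qed

lemma scaleR_fun_apply: "(r *\<^sub>R f) x = r *\<^sub>R f x"
  by (simp only: scaleR_fun_def)

lemma linear_component: "linear (\<lambda>u :: ('a, 'e::real_vector) tvec. u c)"
  by (rule linearI) (simp_all only: plus_fun_apply scaleR_fun_apply)

lemma linear_coord_vector:
  assumes M: "smooth_manifold M" and c: "c \<in> charts_at M p"
  shows "linear (coord_vector M c p)"
proof -
  have l: "linear (id_deriv c c' p)" if "c' \<in> charts_at M p" for c'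
    by (rule chart_diff_linear[OF chart_diff_id[OF M c that]])
  show ?thesis
  proof (rule linearI)
    fix x y r
    show "coord_vector M c p (x + y) = coord_vector M c p x + coord_vector M c p y"
      using linear_add[OF l] by (auto simp: coord_vector_def fun_eq_iff)
    show "coord_vector M c p (r *\<^sub>R x) = r *\<^sub>R coord_vector M c p x"
      using linear_scale[OF l] by (auto simp: coord_vector_def fun_eq_iff scaleR_fun_apply)
  qed
qed

text \<open>Replaces the chart chosen by \<open>SOME\<close> in \<open>differential\<close> with any
  chart \<open>c\<close>: the components of \<open>v\<close> in the two charts are related by the
  transition derivative, which the chain rule absorbs.\<close>

lemma differential_coord:
  assumes M: "smooth_manifold M" and c: "c \<in> charts_at M p" and c': "c' \<in> charts_at M' (F p)"
    and d: "\<And>c. c \<in> charts_at M p \<Longrightarrow> chart_diff c c' F p" and v: "v \<in> tangent_space M p"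
  shows "differential M M' F p v c' = local_deriv c c' F p (v c)"
proof -
  define c0 where "c0 = (SOME c. c \<in> charts_at M p)"
  have c0: "c0 \<in> charts_at M p" unfolding c0_def using c by (rule someI)
  note a = charts_atD[OF c0]
  have vc: "v c \<in> model M" "v c0 = id_deriv c c0 p (v c)"
    using v c c0 unfolding tangent_space_def by blast+
  have "differential M M' F p v c' = local_deriv c0 c' F p (v c0)"
    unfolding differential_def Let_def c0_def[symmetric] using c' by simp
  also have "\<dots> = local_deriv c c' F p (v c)"
    unfolding vc(2)
    by (rule local_deriv_chain(2)[where F = "\<lambda>q. q" and G = F, symmetric,
          OF M c chart_openin[OF M a(1)] a(2) _ chart_inv_left[OF M a(1)] chart_diff_id[OF M c c0]
            d[OF c0] vc(1)])
  finally show ?thesis .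
qed

section \<open>Distributions in charts\<close>

lemma C1_on_sum_scaleR:
  fixes g :: "'i \<Rightarrow> 'a::euclidean_space \<Rightarrow> real" and u :: "'i \<Rightarrow> 'b::euclidean_space"
  assumes "\<And>b. b \<in> B \<Longrightarrow> C_times_on (Suc 0) S (g b)"
  shows "\<exists>f'. C1_on S (\<lambda>x. \<Sum>b\<in>B. g b x *\<^sub>R u b) f'"
proof -
  let ?F = "\<lambda>x v. \<Sum>b\<in>B. frechet_derivative (g b) (at x) v *\<^sub>R u b"
  have "C1_on S (\<lambda>x. \<Sum>b\<in>B. g b x *\<^sub>R u b) (\<lambda>x. Blinfun (?F x))"
  proof (rule C1_onI)
    fix x assume x: "x \<in> S"
    have "(g b has_derivative frechet_derivative (g b) (at x)) (at x)" if "b \<in> B" for b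
      using assms[OF that] x by (simp add: frechet_derivative_works)
    then show "((\<lambda>x. \<Sum>b\<in>B. g b x *\<^sub>R u b) has_derivative ?F x) (at x)"
      by (intro has_derivative_sum has_derivative_scaleR_left)
  next
    fix v show "continuous_on S (\<lambda>x. ?F x v)"
      using assms by (intro continuous_intros) auto
  qed
  then show ?thesis by blast
qed

text \<open>The one-forms, evaluated at a point of a chart, are represented by vectors through the
  inner product.\<close>

definition form_coord ::
  "('a, 'e::euclidean_space) manifold \<Rightarrow> ('a, 'e) chart \<Rightarrow> ('a \<Rightarrow> ('a, 'e) tvec \<Rightarrow> real) \<Rightarrow> 'e \<Rightarrow> 'e"
  where "form_coord M c \<omega> y = (let q = chart_inv c (proj (model M) y)
    in \<Sum>b\<in>Basis. \<omega> q (coord_vector M c q (proj (model M) b)) *\<^sub>R b)"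

text \<open>Because of the projection this is defined off the model space too, so that it is a
  vector field on a full Euclidean ball to which the flow lemmas apply.\<close>

definition field_coord ::
  "('a, 'e::euclidean_space) manifold \<Rightarrow> ('a, 'e) chart \<Rightarrow> ('a \<Rightarrow> ('a, 'e) tvec) \<Rightarrow> 'e \<Rightarrow> 'e"
  where "field_coord M c X y = X (chart_inv c (proj (model M) y)) c"

lemma form_coord_inner:
  assumes M: "smooth_manifold M" and \<omega>: "smooth_one_form M \<omega>" and c: "c \<in> charts_at M q"
    and w: "w \<in> model M"
  shows "form_coord M c \<omega> (snd c q) \<bullet> w = \<omega> q (coord_vector M c q w)"
proof -
  let ?E = "model M"
  note a = charts_atD[OF c]
  have E: "subspace ?E" by (rule smooth_manifold_subspace[OF M])
  have "snd c q \<in> ?E" using chart_image_subset[OF M a(1)] a by auto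
  then have q: "chart_inv c (proj ?E (snd c q)) = q"
    using proj(3)[OF E] chart_inv_left[OF M a] by simp
  \<comment> \<open>The covector, extended to the whole Euclidean space along the projection;
    \<open>form_coord\<close> is its Riesz vector.\<close>
  define h where "h x = \<omega> q (coord_vector M c q (proj ?E x))" for x
  have ct: "\<omega> q \<in> cotangent_space M q"
    using \<omega> a chart_subset_points[OF M a(1)] by (auto simp: smooth_one_form_def)
  have tan: "coord_vector M c q (proj ?E x) \<in> tangent_space M q" for x
    by (rule coord_vector_tangent(1)[OF M c proj(2)[OF E]])
  have lp: "linear (proj ?E)" using proj(1)[OF E] by (rule bounded_linear.linear)
  have "linear h"
  proof (rule linearI)
    fix x y and r :: real
    show "h (x + y) = h x + h y"
      using ct tan by (simp add: h_def linear_add[OF lp] linear_add[OF linear_coord_vector[OF M c]] cotangent_space_def)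
    show "h (r *\<^sub>R x) = r *\<^sub>R h x"
      using ct tan by (simp add: h_def linear_scale[OF lp] linear_scale[OF linear_coord_vector[OF M c]] cotangent_space_def)
  qed
  have "form_coord M c \<omega> (snd c q) \<bullet> w = (\<Sum>b\<in>Basis. (w \<bullet> b) * h b)"
    unfolding form_coord_def by (simp add: q h_def inner_sum_left Let_def mult.commute inner_commute[of w])
  also have "\<dots> = h (\<Sum>b\<in>Basis. (w \<bullet> b) *\<^sub>R b)"
    using \<open>linear h\<close> by (simp add: linear_sum linear_scale)
  also have "\<dots> = \<omega> q (coord_vector M c q w)"
    unfolding euclidean_representation h_def by (simp add: proj(3)[OF E w])
  finally show ?thesis .
qed

text \<open>For the converse inclusion, split the coordinates of \<open>v\<close> into a part in
  \<open>D p\<close> and an orthogonal part \<open>z2\<close>. Pairing with \<open>z2\<close> is a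
  covector that annihilates \<open>D p\<close>, hence a combination of the
  \<open>\<omega> i p\<close>, hence zero on \<open>v\<close>; so \<open>z2\<close> is orthogonal to
  itself.\<close>

lemma distribution_eq_kernel:
  fixes M :: "('a, 'e::euclidean_space) manifold"
  assumes M: "smooth_manifold M" and D: "smooth_distribution M m D"
    and \<omega>: "distribution_given_by M D n \<omega>" and p: "p \<in> points M"
  shows "v \<in> D p \<longleftrightarrow> v \<in> tangent_space M p \<and> (\<forall>i\<in>{1..n}. \<omega> i p v = 0)"
proof
  have span: "span ((\<lambda>i. \<omega> i p) ` {1..n}) = annihilator M D p"
    using \<omega> p by (simp add: distribution_given_by_def)
  have sub: "subspace (D p)" "D p \<subseteq> tangent_space M p"
    using D p by (auto simp: smooth_distribution_def)
  {
    assume v: "v \<in> D p"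
    have "\<omega> i p v = 0" if "i \<in> {1..n}" for i
    proof -
      have "\<omega> i p \<in> span ((\<lambda>i. \<omega> i p) ` {1..n})" by (rule span_base) (use that in auto)
      then have "\<omega> i p \<in> annihilator M D p" using span by simp
      then show ?thesis using v by (simp add: annihilator_def)
    qed
    then show "v \<in> tangent_space M p \<and> (\<forall>i\<in>{1..n}. \<omega> i p v = 0)" using v sub by auto
  }
  assume v: "v \<in> tangent_space M p \<and> (\<forall>i\<in>{1..n}. \<omega> i p v = 0)"
  obtain c where c: "c \<in> charts_at M p" by (rule charts_at_ex[OF M p])
  let ?V = "(\<lambda>u. u c) ` D p"
  have V: "subspace ?V" using linear_subspace_image[OF linear_component sub(1)] .
  obtain z1 z2 where z1: "z1 \<in> ?V" and z2: "\<And>x. x \<in> ?V \<Longrightarrow> orthogonal z2 x" and vz: "v c = z1 + z2"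
    using orthogonal_subspace_decomp_exists[of ?V "v c"] span_eq_iff[THEN iffD2, OF V] by metis
  define \<alpha> where "\<alpha> u = (if u \<in> tangent_space M p then u c \<bullet> z2 else 0)" for u :: "('a, 'e) tvec"
  have add: "u + w \<in> tangent_space M p \<and> r *\<^sub>R u \<in> tangent_space M p"
    if "u \<in> tangent_space M p" "w \<in> tangent_space M p" for u w r
  proof -
    have E: "subspace (model M)" by (rule smooth_manifold_subspace[OF M])
    note l = linear_coord_vector[OF M c]
    have "u + w = coord_vector M c p (u c + w c)" "r *\<^sub>R u = coord_vector M c p (r *\<^sub>R u c)"
      using tangent_space_coord(2)[OF that(1) c] tangent_space_coord(2)[OF that(2) c]
        linear_add[OF l, of "u c" "w c"] linear_scale[OF l, of r "u c"] by simp_all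
    then show ?thesis
      using coord_vector_tangent(1)[OF M c] tangent_space_coord(1)[OF that(1) c]
        tangent_space_coord(1)[OF that(2) c] subspace_add[OF E] subspace_scale[OF E] by metis
  qed
  have "\<alpha> \<in> cotangent_space M p"
    unfolding cotangent_space_def \<alpha>_def using add by (auto simp: inner_add_left scaleR_fun_apply)
  moreover have "\<alpha> u = 0" if "u \<in> D p" for u
    using z2[of "u c"] that sub by (auto simp: \<alpha>_def orthogonal_def inner_commute)
  ultimately have "\<alpha> \<in> annihilator M D p" by (simp add: annihilator_def)
  then have "\<alpha> \<in> span ((\<lambda>i. \<omega> i p) ` {1..n})" using span by simp
  then have "\<alpha> v = 0"
  proof (induction rule: span_induct_alt)
    case base
    then show ?case by simp
  next
    case (step r x y)
    then show ?case using v by (auto simp: scaleR_fun_apply)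
  qed
  then have "v c \<bullet> z2 = 0" using v by (simp add: \<alpha>_def)
  then have "z2 \<bullet> z2 = 0" using z2[OF z1] by (simp add: vz inner_add_left inner_add_right orthogonal_def inner_commute)
  then have "v c = z1" using vz by simp
  then obtain u where u: "u \<in> D p" "v c = u c" using z1 by auto
  then have "v = u"
    using tangent_space_coord(2)[of v M p c] tangent_space_coord(2)[of u M p c] v c sub by (metis subsetD)
  then show "v \<in> D p" using u by simp
qed

lemma finite_common_radius:
  assumes "finite A" "\<And>x. x \<in> A \<Longrightarrow> \<exists>r>0. P x (r::real)"
    and "\<And>x r s. x \<in> A \<Longrightarrow> P x r \<Longrightarrow> 0 < s \<Longrightarrow> s \<le> r \<Longrightarrow> P x s"
  shows "\<exists>r>0. \<forall>x\<in>A. P x r"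
  using assms
proof (induction A rule: finite_induct)
  case empty
  show ?case by (intro exI[of _ 1]) simp
next
  case (insert x A)
  have "\<exists>r>0. \<forall>x\<in>A. P x r"
    by (rule insert.IH) (use insert.prems in blast)+
  then obtain r where r: "r > 0" "\<forall>x\<in>A. P x r" by blast
  obtain s where s: "s > 0" "P x s" using insert.prems(1) by blast
  have "P y (min r s)" if "y \<in> insert x A" for y
    using that r s insert.prems(2)[of y r "min r s"] insert.prems(2)[of x s "min r s"] by (cases "y = x") simp_all
  then show ?case using r(1) s(1) by (intro exI[of _ "min r s"]) simp
qed

lemma kernel_coord:
  assumes M: "smooth_manifold M" and D: "smooth_distribution M m D"
    and \<omega>: "distribution_given_by M D n \<omega>" and c: "c \<in> charts_at M q"
  shows "{w \<in> model M. \<forall>i\<in>{1..n}. form_coord M c (\<omega> i) (snd c q) \<bullet> w = 0} = (\<lambda>u. u c) ` D q"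
proof -
  have q: "q \<in> points M" using chart_subset_points[OF M charts_atD(1)[OF c]] charts_atD(2)[OF c] by blast
  have sm: "smooth_one_form M (\<omega> i)" if "i \<in> {1..n}" for i
    using \<omega> that by (simp add: distribution_given_by_def)
  note ker = distribution_eq_kernel[OF M D \<omega> q]
  show ?thesis
  proof (intro equalityI subsetI)
    fix w assume "w \<in> {w \<in> model M. \<forall>i\<in>{1..n}. form_coord M c (\<omega> i) (snd c q) \<bullet> w = 0}"
    then have w: "w \<in> model M" "\<And>i. i \<in> {1..n} \<Longrightarrow> form_coord M c (\<omega> i) (snd c q) \<bullet> w = 0" by auto
    then have "coord_vector M c q w \<in> D q"
      using coord_vector_tangent(1)[OF M c] form_coord_inner[OF M sm c] by (auto simp: ker)
    then show "w \<in> (\<lambda>u. u c) ` D q"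
      using coord_vector_tangent(2)[OF M c w(1)] by (metis image_eqI)
  next
    fix w assume "w \<in> (\<lambda>u. u c) ` D q"
    then obtain u where u: "u \<in> D q" "w = u c" by auto
    then have t: "u \<in> tangent_space M q" "\<And>i. i \<in> {1..n} \<Longrightarrow> \<omega> i q u = 0" by (auto simp: ker)
    have wE: "w \<in> model M" and uw: "u = coord_vector M c q w"
      using tangent_space_coord[OF t(1) c] u by auto
    have "form_coord M c (\<omega> i) (snd c q) \<bullet> w = 0" if "i \<in> {1..n}" for i
      using form_coord_inner[OF M sm[OF that] c wE] t(2)[OF that] uw by simp
    then show "w \<in> {w \<in> model M. \<forall>i\<in>{1..n}. form_coord M c (\<omega> i) (snd c q) \<bullet> w = 0}" using wE by simp
  qed
qed

lemma field_coord_C1_on: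
  assumes M: "smooth_manifold M" and X: "smooth_vector_field_on M U X" "openin (topol M) U"
    and c: "c \<in> charts_at M p" and p: "p \<in> U"
  obtains r f' where "r > 0" "ball (snd c p) r \<inter> model M \<subseteq> snd c ` (fst c \<inter> U)"
    "C1_on (ball (snd c p) r) (field_coord M c X) f'"
proof -
  note ca = charts_atD[OF c]
  have sm: "smooth_on (snd c ` (fst c \<inter> U)) (\<lambda>y. X (chart_inv c y) c)"
    using X(1) ca by (simp add: smooth_vector_field_on_def)
  have y: "snd c p \<in> snd c ` (fst c \<inter> U)" using ca p by auto
  obtain r where r: "r > 0" "ball (snd c p) r \<inter> model M \<subseteq> snd c ` (fst c \<inter> U)"
    "\<And>k. C_times_on k (ball (snd c p) r) (\<lambda>y. X (chart_inv c (proj (model M) y)) c)"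
    using smooth_on_extension[OF smooth_manifold_subspace[OF M] chart_image_openin_Int[OF M ca(1) X(2)] sm y]
    by blast
  have "C1_on (ball (snd c p) r) (field_coord M c X)
      (\<lambda>x. Blinfun (frechet_derivative (field_coord M c X) (at x)))"
    by (rule C_times_on_imp_C1_on(1)[where k = 0]) (use r(3)[of "Suc 0"] in \<open>simp add: field_coord_def[abs_def]\<close>)
  then show thesis using that r by blast
qed

lemma form_coord_C1_on:
  fixes M :: "('a, 'e::euclidean_space) manifold"
  assumes M: "smooth_manifold M" and \<omega>: "smooth_one_form M \<omega>" and c: "c \<in> charts_at M p"
  obtains r a' where "r > 0" "C1_on (ball (snd c p) r) (form_coord M c \<omega>) a'"
proof -
  note ca = charts_atD[OF c]
  have E: "subspace (model M)" by (rule smooth_manifold_subspace[OF M])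
  define g where "g b y = (let q = chart_inv c (proj (model M) y) in \<omega> q (coord_vector M c q (proj (model M) b)))"
    for b :: 'e and y
  have "\<exists>r>0. \<forall>b\<in>Basis. C_times_on (Suc 0) (ball (snd c p) r) (g b)"
  proof (rule finite_common_radius[OF finite_Basis])
    fix b :: 'e
    have "smooth_on (snd c ` fst c) (\<lambda>y. \<omega> (chart_inv c y) (coord_vector M c (chart_inv c y) (proj (model M) b)))"
      using \<omega> ca proj(2)[OF E] by (simp add: smooth_one_form_def)
    then obtain r where "r > 0" "\<And>k. C_times_on k (ball (snd c p) r) (\<lambda>y. \<omega> (chart_inv c (proj (model M) y))
        (coord_vector M c (chart_inv c (proj (model M) y)) (proj (model M) b)))"
      by (rule smooth_on_extension[OF E chart_image_openin[OF M ca(1)] _ imageI[OF ca(2)]]) blast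
    then show "\<exists>r>0. C_times_on (Suc 0) (ball (snd c p) r) (g b)"
      unfolding g_def[abs_def] Let_def by blast
    show "C_times_on (Suc 0) (ball (snd c p) s) (g b)"
      if "C_times_on (Suc 0) (ball (snd c p) r) (g b)" "s \<le> r" for r s
      by (rule C_times_on_subset[OF that(1)]) (use that(2) in auto)
  qed
  then obtain r where r: "r > 0" "\<And>b. b \<in> Basis \<Longrightarrow> C_times_on (Suc 0) (ball (snd c p) r) (g b)"
    by blast
  have "form_coord M c \<omega> = (\<lambda>y. \<Sum>b\<in>Basis. g b y *\<^sub>R b)"
    by (rule ext) (simp add: form_coord_def g_def Let_def)
  then show thesis
    using C1_on_sum_scaleR[of Basis "ball (snd c p) r" g "\<lambda>b. b"] r that by metis
qed

text \<open>Collects on a single coordinate ball the data for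
  \<open>kernel_invariant_under_variation\<close>. The radius is the least of three: one for the
  domain of the local frame, one for the finitely many forms, one for the finitely many
  fields.\<close>

lemma adapted_chart:
  assumes M: "smooth_manifold M" and D: "smooth_distribution M m D"
    and \<omega>: "distribution_given_by M D n \<omega>" and c: "c \<in> charts_at M p"
  obtains r a' Z where "r > 0" "ball (snd c p) r \<inter> model M \<subseteq> snd c ` fst c"
    "\<And>i. i \<in> {1..n} \<Longrightarrow> C1_on (ball (snd c p) r) (form_coord M c (\<omega> i)) (a' i)"
    "\<And>j::nat. j \<in> {1..m} \<Longrightarrow> continuous_on (ball (snd c p) r) (Z j)"
    "\<And>y. y \<in> ball (snd c p) r \<inter> model M \<Longrightarrow> (\<lambda>u. u c) ` D (chart_inv c y) = span ((\<lambda>j. Z j y) ` {1..m})"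
proof -
  note ca = charts_atD[OF c]
  have E: "subspace (model M)" by (rule smooth_manifold_subspace[OF M])
  have p: "p \<in> points M" using chart_subset_points[OF M ca(1)] ca(2) by blast
  let ?y0 = "snd c p"
  obtain U Y where U: "openin (topol M) U" "p \<in> U"
    and Y: "\<And>i. i \<in> {1..m} \<Longrightarrow> smooth_vector_field_on M U (Y i)"
    and span: "\<And>q. q \<in> U \<Longrightarrow> D q = span ((\<lambda>i::nat. Y i q) ` {1..m})"
    using D p unfolding smooth_distribution_def by metis
  obtain r1 where r1: "r1 > 0" "ball ?y0 r1 \<inter> model M \<subseteq> snd c ` (fst c \<inter> U)"
    by (rule chart_ball[OF M ca(1) U(1) ca(2) U(2)])
  have "\<exists>r>0. \<forall>i\<in>{1..n}. \<exists>a'. C1_on (ball ?y0 r) (form_coord M c (\<omega> i)) a'"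
  proof (rule finite_common_radius)
    fix i assume "i \<in> {1..n}"
    then have "smooth_one_form M (\<omega> i)" using \<omega> by (simp add: distribution_given_by_def)
    from form_coord_C1_on[OF M this c]
    show "\<exists>r>0. \<exists>a'. C1_on (ball ?y0 r) (form_coord M c (\<omega> i)) a'" by blast
    show "\<exists>a'. C1_on (ball ?y0 s) (form_coord M c (\<omega> i)) a'"
      if "\<exists>a'. C1_on (ball ?y0 r) (form_coord M c (\<omega> i)) a'" "s \<le> r" for r s
      using that C1_on_subset[of "ball ?y0 r" _ _ "ball ?y0 s"] by (metis subset_ball)
  qed simp
  then obtain r2 a' where r2: "r2 > 0"
    and a': "\<And>i. i \<in> {1..n} \<Longrightarrow> C1_on (ball ?y0 r2) (form_coord M c (\<omega> i)) (a' i)" by metis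
  have "\<exists>r>0. \<forall>j\<in>{1..m}. continuous_on (ball ?y0 r) (field_coord M c (Y j))"
  proof (rule finite_common_radius)
    fix j assume "j \<in> {1..m}"
    from field_coord_C1_on[OF M Y[OF this] U(1) c U(2)]
    show "\<exists>r>0. continuous_on (ball ?y0 r) (field_coord M c (Y j))"
      using C1_on_imp_continuous_on by metis
    show "continuous_on (ball ?y0 s) (field_coord M c (Y j))"
      if "continuous_on (ball ?y0 r) (field_coord M c (Y j))" "s \<le> r" for r s
      using continuous_on_subset[OF that(1)] that(2) by (meson subset_ball)
  qed simp
  then obtain r3 where r3: "r3 > 0"
    and Z: "\<And>j. j \<in> {1..m} \<Longrightarrow> continuous_on (ball ?y0 r3) (field_coord M c (Y j))" by metis
  define r where "r = min r1 (min r2 r3)"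
  have r: "r > 0" and sub: "ball ?y0 r \<subseteq> ball ?y0 r1" "ball ?y0 r \<subseteq> ball ?y0 r2" "ball ?y0 r \<subseteq> ball ?y0 r3"
    using r1 r2 r3 by (auto simp: r_def)
  show thesis
  proof (rule that[OF r])
    show "ball ?y0 r \<inter> model M \<subseteq> snd c ` fst c" using r1(2) sub(1) by blast
    show "C1_on (ball ?y0 r) (form_coord M c (\<omega> i)) (a' i)" if "i \<in> {1..n}" for i
      by (rule C1_on_subset[OF a'[OF that] sub(2)])
    show "continuous_on (ball ?y0 r) (field_coord M c (Y j))" if "j \<in> {1..m}" for j
      by (rule continuous_on_subset[OF Z[OF that] sub(3)])
    fix y assume y: "y \<in> ball ?y0 r \<inter> model M"
    then obtain q where q: "q \<in> fst c" "q \<in> U" "y = snd c q" using r1(2) sub(1) by blast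
    have qq: "chart_inv c y = q" "proj (model M) y = y"
      using chart_inv_left[OF M ca(1) q(1)] q(3) proj(3)[OF E] y by auto
    show "(\<lambda>u. u c) ` D (chart_inv c y) = span ((\<lambda>j. field_coord M c (Y j) y) ` {1..m})"
      unfolding field_coord_def qq span[OF q(2)]
      using linear_span_image[OF linear_component[of c], of "(\<lambda>i. Y i q) ` {1..m}"] by (simp add: image_image)
  qed
qed

section \<open>Integral manifolds and involutivity\<close>

abbreviation incl_diff ::
  "('a, 'e::euclidean_space) manifold \<Rightarrow> ('a, 'e) manifold \<Rightarrow> 'a \<Rightarrow> ('a, 'e) tvec \<Rightarrow> ('a, 'e) tvec"
  where "incl_diff N M \<equiv> differential N M (\<lambda>q. q)"

lemma inclusion_chart_diff:
  assumes N: "immersed_submanifold N M" and M: "smooth_manifold M"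
    and cN: "cN \<in> charts_at N q" and c: "c \<in> charts_at M q"
  shows "openin (top_of_set (model N)) (snd cN ` (fst cN \<inter> fst c))"
    and "smooth_on (snd cN ` (fst cN \<inter> fst c)) (snd c \<circ> (\<lambda>q. q) \<circ> chart_inv cN)"
    and "chart_diff cN c (\<lambda>q. q) q"
proof -
  have a: "cN \<in> atlas N" "q \<in> fst cN" "c \<in> atlas M" "q \<in> fst c" using cN c by (auto simp: charts_at_def)
  have sN: "smooth_manifold N" and sm: "smooth_map N M (\<lambda>q. q)" using N by (auto simp: immersed_submanifold_def)
  have "openin (topol N) {x \<in> points N. x \<in> fst c}"
    by (rule openin_continuous_map_preimage[OF _ chart_openin[OF M a(3)]])
       (use sm in \<open>simp add: smooth_map_def\<close>)
  from chart_image_openin_Int[OF sN a(1) this]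
  have "openin (top_of_set (model N)) (snd cN ` (fst cN \<inter> {x \<in> points N. x \<in> fst c}))" .
  also have "fst cN \<inter> {x \<in> points N. x \<in> fst c} = fst cN \<inter> fst c"
    using chart_subset_points[OF sN a(1)] by blast
  finally show o: "openin (top_of_set (model N)) (snd cN ` (fst cN \<inter> fst c))" .
  show s: "smooth_on (snd cN ` (fst cN \<inter> fst c)) (snd c \<circ> (\<lambda>q. q) \<circ> chart_inv cN)"
    using sm a by (simp add: smooth_map_def)
  show "chart_diff cN c (\<lambda>q. q) q"
    unfolding chart_diff_def
    by (rule smooth_on_differentiable[OF smooth_manifold_subspace[OF sN] o s])
      (use a chart_image_subset[OF sN a(1)] in auto)
qed

text \<open>Since \<open>N\<close> has dimension \<open>m\<close>, the tangent map of its inclusion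
  is onto \<open>D p\<close>. Every pair in \<open>D p\<close> is therefore tangent to
  \<open>N\<close>, and \<open>closed_along_integral_immersion\<close> applies to the inclusion in
  charts.\<close>

lemma involutive_at_integral_point:
  fixes M :: "('a, 'e::euclidean_space) manifold"
  assumes M: "smooth_manifold M" and D: "smooth_distribution M m D"
    and \<omega>: "distribution_given_by M D n \<omega>"
    and N: "integral_manifold M D N" "mdim N = m" and p: "p \<in> points N"
    and c: "c \<in> charts_at M p" and i: "i \<in> {1..n}"
    and A: "(form_coord M c (\<omega> i) has_derivative A) (at (snd c p))"
    and u: "u \<in> (\<lambda>u. u c) ` D p" and w: "w \<in> (\<lambda>u. u c) ` D p"
  shows "A u \<bullet> w = A w \<bullet> u"
proof -
  have im: "immersed_submanifold N M" and sN: "smooth_manifold N" and NM: "points N \<subseteq> points M"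
    and inj: "inj_on (incl_diff N M p) (tangent_space N p)"
    and tD: "\<And>q. q \<in> points N \<Longrightarrow> incl_diff N M q ` tangent_space N q \<subseteq> D q"
    using N(1) p by (auto simp: integral_manifold_def immersed_submanifold_def)
  note ca = charts_atD[OF c]
  obtain k where k: "k \<in> charts_at N p" by (rule charts_at_ex[OF sN p])
  note ka = charts_atD[OF k]
  let ?E = "model N" and ?\<phi> = "snd c \<circ> (\<lambda>q. q) \<circ> chart_inv k" and ?z = "snd k p"
  have E: "subspace ?E" by (rule smooth_manifold_subspace[OF sN])
  let ?T = "snd k ` (fst k \<inter> fst c)"
  note T = inclusion_chart_diff(1)[OF im M k c] and \<phi>s = inclusion_chart_diff(2)[OF im M k c]
  have zT: "?z \<in> ?T" using ka ca by auto
  define \<psi> where "\<psi> y = ?\<phi> (proj ?E y)" for y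
  obtain r where r: "r > 0" "ball ?z r \<inter> ?E \<subseteq> ?T" "\<And>k. C_times_on k (ball ?z r) \<psi>"
    using smooth_on_extension[OF E T \<phi>s zT] unfolding \<psi>_def[abs_def] by blast
  have zE: "?z \<in> ?E" using T zT openin_imp_subset by blast
  have fd: "frechet_derivative \<psi> (at z) = (\<lambda>w. id_deriv k c (chart_inv k (proj ?E z)) (proj ?E w))"
    and pt: "chart_inv k (proj ?E z) \<in> fst k \<inter> fst c" "\<psi> z = snd c (chart_inv k (proj ?E z))"
    if z: "z \<in> ball ?z r" for z
  proof -
    have zT: "proj ?E z \<in> ?T" using proj_in_ball(2)[OF E zE z] r(2) by blast
    then obtain q where q: "q \<in> fst k" "q \<in> fst c" "proj ?E z = snd k q" by auto
    have iq: "chart_inv k (proj ?E z) = q" using chart_inv_left[OF sN ka(1) q(1)] q(3) by simp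
    then show "chart_inv k (proj ?E z) \<in> fst k \<inter> fst c" "\<psi> z = snd c (chart_inv k (proj ?E z))"
      using q by (auto simp: \<psi>_def)
    have ch: "k \<in> charts_at N q" "c \<in> charts_at M q" using ka ca q by (auto simp: charts_at_def)
    have "(?\<phi> has_derivative id_deriv k c q) (at (snd k q) within snd k ` fst k)"
      by (rule chart_diff_has_derivative[OF inclusion_chart_diff(3)[OF im M ch]])
    then have 1: "(\<psi> has_derivative (\<lambda>w. id_deriv k c q (proj ?E w))) (at (snd k q))"
      unfolding \<psi>_def[abs_def]
      by (rule has_derivative_compose_proj[OF E chart_image_openin[OF sN ka(1)], rotated]) (use q in auto)
    \<comment> \<open>The point \<open>z\<close> may lie off the model space. As
      \<open>\<psi>\<close> factors through the projection, its derivative at \<open>z\<close> is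
      read off at \<open>proj ?E z\<close>.\<close>
    have "((\<lambda>y. \<psi> (proj ?E y)) has_derivative (\<lambda>w. id_deriv k c q (proj ?E (proj ?E w)))) (at z)"
      by (rule has_derivative_compose[where f = "proj ?E", OF bounded_linear_imp_has_derivative[OF proj(1)[OF E]]])
         (use 1 q in simp)
    moreover have "(\<lambda>y. \<psi> (proj ?E y)) = \<psi>" by (rule ext) (simp add: \<psi>_def proj(2,3)[OF E])
    ultimately have "(\<psi> has_derivative (\<lambda>w. id_deriv k c q (proj ?E w))) (at z)"
      by (simp add: proj(2,3)[OF E])
    from frechet_derivative_at[OF this]
    show "frechet_derivative \<psi> (at z) = (\<lambda>w. id_deriv k c (chart_inv k (proj ?E z)) (proj ?E w))"
      unfolding iq by simp
  qed
  have inD: "id_deriv k c q w \<in> (\<lambda>u. u c) ` D q"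
    if q: "q \<in> fst k \<inter> fst c" and w: "w \<in> ?E" for q w
  proof -
    have ch: "k \<in> charts_at N q" "c \<in> charts_at M q" using ka ca q by (auto simp: charts_at_def)
    have qN: "q \<in> points N" using chart_subset_points[OF sN ka(1)] q by blast
    let ?v = "coord_vector N k q w"
    have v: "?v \<in> tangent_space N q" "?v k = w" by (rule coord_vector_tangent[OF sN ch(1) w])+
    have "incl_diff N M q ?v c = id_deriv k c q (?v k)"
      by (rule differential_coord[OF sN ch(1) _ _ v(1)]) (use ch inclusion_chart_diff(3)[OF im M] in auto)
    moreover have "incl_diff N M q ?v \<in> D q" using tD[OF qN] v(1) by blast
    ultimately show ?thesis using v(2) by (metis image_eqI)
  qed
  have van: "form_coord M c (\<omega> i) (\<psi> z) \<bullet> frechet_derivative \<psi> (at z) w = 0"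
    if z: "z \<in> ball ?z r" for z w
  proof -
    let ?q = "chart_inv k (proj ?E z)"
    have ch: "c \<in> charts_at M ?q" using pt(1)[OF z] ca by (auto simp: charts_at_def)
    have "frechet_derivative \<psi> (at z) w \<in>
        {w \<in> model M. \<forall>i\<in>{1..n}. form_coord M c (\<omega> i) (snd c ?q) \<bullet> w = 0}"
      unfolding fd[OF z] kernel_coord[OF M D \<omega> ch] by (rule inD[OF pt(1)[OF z] proj(2)[OF E]])
    then show ?thesis using i unfolding pt(2)[OF z] by blast
  qed
  have zb: "?z \<in> ball ?z r" using r(1) by simp
  have pz: "chart_inv k (proj ?E ?z) = p" using proj(3)[OF E zE] chart_inv_left[OF sN ka] by simp
  have \<psi>z: "\<psi> ?z = snd c p" using pt(2)[OF zb] pz by simp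
  have sym: "A (frechet_derivative \<psi> (at ?z) u) \<bullet> frechet_derivative \<psi> (at ?z) w
      = A (frechet_derivative \<psi> (at ?z) w) \<bullet> frechet_derivative \<psi> (at ?z) u" for u w
    by (rule closed_along_integral_immersion[OF open_ball zb r(3) _ van]) (use A \<psi>z in auto)
  let ?L = "id_deriv k c p"
  have L: "frechet_derivative \<psi> (at ?z) w = ?L w" if "w \<in> ?E" for w
    using fd[OF zb] pz proj(3)[OF E that] by simp
  have cdk: "chart_diff k c (\<lambda>q. q) p" by (rule inclusion_chart_diff(3)[OF im M k c])
  have linL: "linear ?L" by (rule chart_diff_linear[OF cdk])
  have injL: "inj_on ?L ?E"
  proof -
    have "w = 0" if w: "w \<in> ?E" "?L w = 0" for w
    proof -
      \<comment> \<open>\<open>inj\<close> concerns vectors as families over all charts. A vector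
        killed in the chart \<open>c\<close> is killed in every other chart by composing with a
        transition derivative.\<close>
      have dz: "incl_diff N M p (coord_vector N k p x) = 0" if x: "x \<in> ?E" "?L x = 0" for x
      proof
        fix c'
        show "incl_diff N M p (coord_vector N k p x) c' = 0 c'"
        proof (cases "c' \<in> charts_at M p")
          case True
          have "incl_diff N M p (coord_vector N k p x) c'
              = id_deriv k c' p (coord_vector N k p x k)"
            by (rule differential_coord[OF sN k _ _ coord_vector_tangent(1)[OF sN k x(1)]])
              (use True inclusion_chart_diff(3)[OF im M] in auto)
          also have "\<dots> = id_deriv k c' p x" by (simp add: coord_vector_tangent(2)[OF sN k x(1)])
          also have "\<dots> = id_deriv c c' p (?L x)"
          proof (rule local_deriv_chain(2)[where F = "\<lambda>q. q" and G = "\<lambda>q. q", OF sN k])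
            show "openin (topol N) {x \<in> points N. x \<in> fst c}"
              by (rule openin_continuous_map_preimage[OF _ chart_openin[OF M ca(1)]])
                (use im in \<open>simp add: immersed_submanifold_def smooth_map_def\<close>)
          qed (use p ca chart_inv_left[OF M ca(1)] cdk chart_diff_id[OF M c True] x(1) in auto)
          also have "\<dots> = 0"
            using linear_0[OF chart_diff_linear[OF chart_diff_id[OF M c True]]] x(2) by simp
          finally show ?thesis by simp
        next
          case False
          then show ?thesis by (simp add: differential_def Let_def)
        qed
      qed
      have 0: "(0::'e) \<in> ?E" "?L 0 = 0" using subspace_0[OF E] linear_0[OF linL] by auto
      have "coord_vector N k p w = coord_vector N k p 0"
        by (rule inj_onD[OF inj]) (simp_all add: dz w 0 coord_vector_tangent(1)[OF sN k])
      then show "w = 0"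
        using coord_vector_tangent(2)[OF sN k w(1)] coord_vector_tangent(2)[OF sN k 0(1)] by metis
    qed
    then show ?thesis using linear_injective_on_subspace_0[OF linL E] by blast
  qed
  let ?V = "(\<lambda>u. u c) ` D p"
  have pM: "p \<in> points M" using NM p by blast
  have V: "subspace ?V"
    by (rule linear_subspace_image[OF linear_component]) (use D pM in \<open>simp add: smooth_distribution_def\<close>)
  \<comment> \<open>The vectors of \<open>D p\<close> live in a function space, so the dimension of
    their coordinates is bounded by counting the spanning fields.\<close>
  have "dim ?V \<le> m"
  proof -
    obtain Y where "D p = span ((\<lambda>i::nat. Y i p) ` {1..m})"
      using D pM unfolding smooth_distribution_def by metis
    then have "?V = span ((\<lambda>u. u c) ` ((\<lambda>i. Y i p) ` {1..m}))"
      using linear_span_image[OF linear_component[of c], of "(\<lambda>i. Y i p) ` {1..m}"] by simp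
    then have "dim ?V \<le> card ((\<lambda>u. u c) ` ((\<lambda>i. Y i p) ` {1..m}))"
      by (intro dim_le_card) auto
    also have "\<dots> \<le> card {1..m}" by (simp only: image_image) (rule card_image_le, simp)
    finally show ?thesis by simp
  qed
  moreover have "dim (?L ` ?E) = m"
    using dim_image_eq[OF linL, of ?E] injL N(2) E by (simp add: span_eq_iff[THEN iffD2] mdim_def)
  moreover have "?L ` ?E \<subseteq> ?V" using inD[of p] ka ca by blast
  ultimately have "?L ` ?E = ?V"
    using subspace_dim_equal[OF linear_subspace_image[OF linL E] V] by simp
  then obtain u' w' where uw: "u' \<in> ?E" "u = ?L u'" "w' \<in> ?E" "w = ?L w'" using u w by blast
  show ?thesis using sym[of u' w'] by (simp add: L uw)
qed

section \<open>Constructing small integral manifolds\<close>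

lemma second_countable_subtopology:
  assumes "second_countable_space T"
  shows "second_countable_space (subtopology T U)"
proof -
  obtain B where B: "countable B" "\<And>W. W \<in> B \<Longrightarrow> openin T W"
    "\<And>V x. openin T V \<Longrightarrow> x \<in> V \<Longrightarrow> \<exists>W\<in>B. x \<in> W \<and> W \<subseteq> V"
    using assms unfolding second_countable_space_def by metis
  show ?thesis
    unfolding second_countable_space_def
  proof (intro exI[of _ "(\<lambda>W. W \<inter> U) ` B"] conjI ballI allI impI)
    show "countable ((\<lambda>W. W \<inter> U) ` B)" using B(1) by simp
    show "openin (subtopology T U) W" if "W \<in> (\<lambda>W. W \<inter> U) ` B" for W
      using that B(2) by (auto simp: openin_subtopology)
    fix V x assume "openin (subtopology T U) V \<and> x \<in> V"
    then obtain V' where V': "openin T V'" "V = V' \<inter> U" "x \<in> V'" "x \<in> U"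
      by (auto simp: openin_subtopology)
    then obtain W where "W \<in> B" "x \<in> W" "W \<subseteq> V'" using B(3) by blast
    then show "\<exists>W\<in>(\<lambda>W. W \<inter> U) ` B. x \<in> W \<and> W \<subseteq> V"
      using V' by (intro bexI[of _ "W \<inter> U"]) auto
  qed
qed

lemma smooth_on_mono_cong:
  assumes "smooth_on T f" "S \<subseteq> T" "\<And>x. x \<in> S \<Longrightarrow> f x = g x"
  shows "smooth_on S g"
  unfolding smooth_on_def
proof
  fix x assume "x \<in> S"
  then have "x \<in> T" using assms(2) by blast
  then obtain U h where U: "open U" "x \<in> U" "\<forall>k. C_times_on k U h" "\<forall>y\<in>U \<inter> T. h y = f y"
    using assms(1) unfolding smooth_on_def by blast
  have "\<forall>y\<in>U \<inter> S. h y = g y" using U(4) assms(2,3) by fastforce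
  with U(1-3) show "\<exists>U g'. open U \<and> x \<in> U \<and> (\<forall>k. C_times_on k U g') \<and> (\<forall>y\<in>U \<inter> S. g' y = g y)"
    by blast
qed

lemma smooth_on_const: "smooth_on S (\<lambda>x. c)"
  unfolding smooth_on_def by (intro ballI exI[of _ UNIV] exI[of _ "\<lambda>x. c"]) (simp add: C_times_on_const)

lemma smooth_on_ident: "smooth_on S (\<lambda>x. x)"
proof -
  have "C_times_on k UNIV (\<lambda>x::'a. x)" for k
    by (cases k) (simp_all add: frechet_derivative_ident C_times_on_const)
  then show ?thesis unfolding smooth_on_def by blast
qed

lemma smooth_on_singleton: "smooth_on {x} f"
  by (rule smooth_on_mono_cong[OF smooth_on_const subset_refl]) simp

lemma single_chart_manifold:
  assumes "Hausdorff_space T" "second_countable_space T" "subspace E"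
    and "openin (top_of_set E) (h ` topspace T)" "homeomorphic_map T (top_of_set (h ` topspace T)) h"
  shows "smooth_manifold \<lparr>topol = T, model = E, atlas = {(topspace T, h)}\<rparr>"
proof -
  have "inj_on h (topspace T)" by (rule homeomorphic_imp_injective_map[OF assms(5)])
  then have "smooth_on (h ` topspace T) (h \<circ> chart_inv (topspace T, h))"
    by (intro smooth_on_mono_cong[OF smooth_on_ident subset_refl]) (auto simp: chart_inv_def)
  then show ?thesis using assms by (simp add: smooth_manifold_def)
qed

text \<open>Makes the family of integral manifolds inside an open set nonempty, so that a largest
  dimension exists. The only tangent vector of the point is 0.\<close>

lemma point_integral_manifold:
  fixes M :: "('a, 'e::euclidean_space) manifold"
  assumes M: "smooth_manifold M" and D: "smooth_distribution M m D" and p: "p \<in> points M"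
  obtains N where "integral_manifold M D N" "points N = {p}"
proof -
  define k :: "('a, 'e) chart" where "k = ({p}, \<lambda>_. 0)"
  define N :: "('a, 'e) manifold" where
    "N = \<lparr>topol = subtopology (topol M) {p}, model = {0}, atlas = {k}\<rparr>"
  have pts: "points N = {p}" using p by (simp add: N_def)
  have inv: "chart_inv k 0 = p"
    unfolding chart_inv_def k_def by (simp add: inv_into_def)
  have "homeomorphic_maps (subtopology (subtopology (topol M) {p}) {p}) (top_of_set {0})
      (\<lambda>_. 0::'e) (\<lambda>_. p)"
    using p by (auto simp: homeomorphic_maps_def)
  then have hom: "homeomorphic_map (subtopology (subtopology (topol M) {p}) {p}) (top_of_set {0}) (\<lambda>_. 0::'e)"
    by (rule homeomorphic_maps_imp_map)
  have tp: "topspace (subtopology (topol M) {p}) = {p}" using p by auto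
  have sN: "smooth_manifold N"
    unfolding N_def k_def
    by (rule single_chart_manifold[where T = "subtopology (topol M) {p}" and h = "\<lambda>_. 0" and E = "{0}", unfolded tp])
      (use M hom in \<open>auto simp: smooth_manifold_def Hausdorff_space_subtopology
        second_countable_subtopology subspace_single_0 subtopology_subtopology\<close>)
  have tan: "v = 0" if "v \<in> tangent_space N q" for v q
  proof
    fix c
    show "v c = 0 c"
    proof (cases "c \<in> charts_at N q")
      case True
      then have "v c \<in> model N" using that unfolding tangent_space_def by blast
      then show ?thesis by (simp add: N_def)
    next
      case False
      then have "v c = 0" using that unfolding tangent_space_def by blast
      then show ?thesis by simp
    qed
  qed
  have d0: "incl_diff N M p 0 = 0"
  proof
    fix c' :: "('a, 'e) chart"
    have "charts_at N p = {k}" by (auto simp: charts_at_def N_def k_def)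
    then have "(SOME c. c \<in> charts_at N p) = k" by simp
    \<comment> \<open>A Frechet derivative is known to be linear only where the map is
      differentiable; on the one-point coordinate domain every map is smooth.\<close>
    moreover have "id_deriv k c' p 0 = 0"
    proof -
      have "(snd c' \<circ> (\<lambda>q. q) \<circ> chart_inv k) differentiable (at (snd k p) within snd k ` fst k)"
        by (rule smooth_on_differentiable[of "{0}" "{0}"])
          (auto simp: k_def subspace_single_0 smooth_on_singleton)
      then show ?thesis
        unfolding local_deriv_def using linear_0[OF linear_frechet_derivative] by blast
    qed
    ultimately show "incl_diff N M p 0 c' = 0 c'"
      unfolding differential_def Let_def by simp
  qed
  have "immersed_submanifold N M"
    unfolding immersed_submanifold_def
  proof (intro conjI ballI)
    show "points N \<subseteq> points M" using p pts by simp
    show "smooth_map N M (\<lambda>q. q)"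
      unfolding smooth_map_def
    proof (intro conjI ballI)
      show "continuous_map (topol N) (topol M) (\<lambda>q. q)"
        using continuous_map_from_subtopology[OF continuous_map_id, of "topol M" "{p}"] by (simp add: N_def id_def)
      fix c c' :: "('a, 'e) chart" assume "c \<in> atlas N"
      then have "snd c ` (fst c \<inter> (\<lambda>q. q) -` fst c') \<subseteq> {0}" by (auto simp: N_def k_def)
      then show "smooth_on (snd c ` (fst c \<inter> (\<lambda>q. q) -` fst c')) (snd c' \<circ> (\<lambda>q. q) \<circ> chart_inv c)"
        by (rule smooth_on_mono_cong[OF smooth_on_singleton]) simp
    qed
    show "inj_on (incl_diff N M q) (tangent_space N q)" for q
      using tan by (auto simp: inj_on_def)
  qed (rule sN)
  moreover have "incl_diff N M q v \<in> D q" if "q \<in> points N" "v \<in> tangent_space N q" for q v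
  proof -
    have "q = p" "v = 0" using that pts tan by auto
    moreover have "subspace (D p)" using D p by (simp add: smooth_distribution_def)
    ultimately show ?thesis using subspace_0[of "D p"] by (simp only: d0)
  qed
  ultimately have "integral_manifold M D N"
    unfolding integral_manifold_def using pts by blast
  then show thesis using that pts by blast
qed

text \<open>\<open>N'\<close> is the part in \<open>W\<close> of one chart domain of
  \<open>N\<close>, with that single chart. Tangent vectors are families over the charts of the
  manifold, so those of \<open>N'\<close> are translated into vectors of \<open>N\<close> by
  \<open>coord_vector\<close> before the differentials are compared.\<close>

lemma integral_manifold_restrict:
  fixes M :: "('a, 'e::euclidean_space) manifold"
  assumes M: "smooth_manifold M" and N: "integral_manifold M D N" and x: "x \<in> points N"
    and W: "openin (topol M) W" "x \<in> W"
  obtains N' where "integral_manifold M D N'" "mdim N' = mdim N" "points N' \<subseteq> W"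
proof -
  have im: "immersed_submanifold N M" and sN: "smooth_manifold N" and NM: "points N \<subseteq> points M"
    and sm: "smooth_map N M (\<lambda>q. q)"
    and inj: "\<And>q. q \<in> points N \<Longrightarrow> inj_on (incl_diff N M q) (tangent_space N q)"
    and tD: "\<And>q. q \<in> points N \<Longrightarrow> incl_diff N M q ` tangent_space N q \<subseteq> D q"
    using N by (auto simp: integral_manifold_def immersed_submanifold_def)
  obtain k where k: "k \<in> charts_at N x" by (rule charts_at_ex[OF sN x])
  note ka = charts_atD[OF k]
  have cont: "continuous_map (topol N) (topol M) (\<lambda>q. q)" using sm by (simp add: smooth_map_def)
  have oW: "openin (topol N) {q \<in> points N. q \<in> W}"
    by (rule openin_continuous_map_preimage[OF cont W(1)])
  define U where "U = fst k \<inter> {q \<in> points N. q \<in> W}"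
  define k' where "k' = (U, snd k)"
  define N' :: "('a, 'e) manifold" where
    "N' = \<lparr>topol = subtopology (topol N) U, model = model N, atlas = {k'}\<rparr>"
  have Uk: "U \<subseteq> fst k" "U \<subseteq> points N" "U \<subseteq> W" "x \<in> U" using ka x W by (auto simp: U_def)
  have oU: "openin (topol N) U" unfolding U_def using chart_openin[OF sN ka(1)] oW by blast
  have pts: "points N' = U" using Uk(2) by (auto simp: N'_def)
  have injk: "inj_on (snd k) U" using chart_inj[OF sN ka(1)] Uk(1) inj_on_subset by blast
  have inv: "chart_inv k' (snd k q) = q" if "q \<in> U" for q
    unfolding chart_inv_def k'_def using injk that by simp
  have kU: "openin (top_of_set (model N)) (snd k ` U)"
    unfolding U_def by (rule chart_image_openin_Int[OF sN ka(1) oW])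
  have "homeomorphic_map (subtopology (subtopology (topol N) (fst k)) U)
      (subtopology (top_of_set (snd k ` fst k)) (snd k ` U)) (snd k)"
    by (rule homeomorphic_map_subtopologies[OF chart_homeo[OF sN ka(1)]]) (use Uk in auto)
  moreover have "fst k \<inter> U = U" "snd k ` fst k \<inter> snd k ` U = snd k ` U" using Uk(1) by auto
  ultimately have hom: "homeomorphic_map (subtopology (topol N) U) (top_of_set (snd k ` U)) (snd k)"
    by (simp add: subtopology_subtopology)
  have tU: "topspace (subtopology (topol N) U) = U" using Uk(2) by auto
  have sN': "smooth_manifold N'"
    unfolding N'_def k'_def
    by (rule single_chart_manifold[where T = "subtopology (topol N) U" and h = "snd k" and E = "model N", unfolded tU])
      (use sN kU hom in \<open>auto simp: smooth_manifold_def Hausdorff_space_subtopology second_countable_subtopology\<close>)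
  have sm': "smooth_map N' M (\<lambda>q. q)"
    unfolding smooth_map_def
  proof (intro conjI ballI)
    show "continuous_map (topol N') (topol M) (\<lambda>q. q)"
      using continuous_map_from_subtopology[OF cont] by (simp add: N'_def)
    fix c c' assume "c \<in> atlas N'" and c': "c' \<in> atlas M"
    then have c: "c = k'" by (simp add: N'_def)
    have "smooth_on (snd k ` (fst k \<inter> (\<lambda>q. q) -` fst c')) (snd c' \<circ> (\<lambda>q. q) \<circ> chart_inv k)"
      using sm ka(1) c' unfolding smooth_map_def by blast
    then show "smooth_on (snd c ` (fst c \<inter> (\<lambda>q. q) -` fst c')) (snd c' \<circ> (\<lambda>q. q) \<circ> chart_inv c)"
      by (rule smooth_on_mono_cong)
        (use Uk(1) inv[unfolded k'_def] chart_inv_left[OF sN ka(1)] in \<open>auto simp: c k'_def\<close>)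
  qed
  have diff: "incl_diff N' M q v = incl_diff N M q (coord_vector N k q (v k'))"
    and vm: "v k' \<in> model N" and vc: "v = coord_vector N' k' q (v k')"
    if q: "q \<in> U" and v: "v \<in> tangent_space N' q" for q v
  proof -
    have kq: "k \<in> charts_at N q" and k'q: "k' \<in> charts_at N' q"
      using q Uk ka by (auto simp: charts_at_def N'_def k'_def)
    have only: "c = k'" if "c \<in> charts_at N' q" for c using that by (simp add: charts_at_def N'_def)
    show vm: "v k' \<in> model N" using tangent_space_coord(1)[OF v k'q] by (simp add: N'_def)
    show "v = coord_vector N' k' q (v k')" by (rule tangent_space_coord(2)[OF v k'q])
    note cv = coord_vector_tangent[OF sN kq vm]
    show "incl_diff N' M q v = incl_diff N M q (coord_vector N k q (v k'))"
    proof
      fix c'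
      show "incl_diff N' M q v c' = incl_diff N M q (coord_vector N k q (v k')) c'"
      proof (cases "c' \<in> charts_at M q")
        case True
        have "(snd c' \<circ> (\<lambda>q. q) \<circ> chart_inv k has_derivative id_deriv k c' q)
            (at (snd k q) within snd k ` U)"
          by (rule has_derivative_subset[OF chart_diff_has_derivative[OF inclusion_chart_diff(3)[OF im M kq True]]])
            (use Uk in auto)
        then have der: "((snd c' \<circ> (\<lambda>q. q) \<circ> chart_inv k') has_derivative id_deriv k c' q)
            (at (snd k' q) within snd k' ` fst k')"
          unfolding k'_def fst_conv snd_conv
          by (rule has_derivative_transform[rotated 2])
            (use q Uk(1) inv[unfolded k'_def] chart_inv_left[OF sN ka(1)] in auto)
        then have "chart_diff k' c' (\<lambda>q. q) q" by (auto simp: chart_diff_def differentiable_def)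
        then have "incl_diff N' M q v c' = id_deriv k' c' q (v k')"
          using only by (intro differential_coord[OF sN' k'q _ _ v]) (use True in auto)
        also have "\<dots> = id_deriv k c' q (v k')"
          by (rule local_deriv_unique[OF sN' k'q der]) (use vm in \<open>simp add: N'_def\<close>)
        also have "\<dots> = incl_diff N M q (coord_vector N k q (v k')) c'"
          using differential_coord[OF sN kq, of c' M "\<lambda>q. q", OF _ _ cv(1)] True
            inclusion_chart_diff(3)[OF im M] by (simp add: cv(2))
        finally show ?thesis .
      next
        case False
        then show ?thesis by (simp add: differential_def Let_def)
      qed
    qed
  qed
  have "integral_manifold M D N'"
    unfolding integral_manifold_def immersed_submanifold_def
  proof (intro conjI ballI)
    show "points N' \<subseteq> points M" "points N' \<noteq> {}" using pts Uk NM by auto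
    fix q assume "q \<in> points N'"
    then have q: "q \<in> U" "q \<in> points N" "k \<in> charts_at N q"
      using pts Uk ka by (auto simp: charts_at_def)
    show "inj_on (incl_diff N' M q) (tangent_space N' q)"
    proof (rule inj_onI)
      fix v w assume vw: "v \<in> tangent_space N' q" "w \<in> tangent_space N' q"
        and eq: "incl_diff N' M q v = incl_diff N' M q w"
      have cvw: "coord_vector N k q (v k') = coord_vector N k q (w k')"
      proof (rule inj_onD[OF inj[OF q(2)]])
        show "incl_diff N M q (coord_vector N k q (v k'))
            = incl_diff N M q (coord_vector N k q (w k'))"
          using eq unfolding diff[OF q(1) vw(1)] diff[OF q(1) vw(2)] .
        show "coord_vector N k q (v k') \<in> tangent_space N q" "coord_vector N k q (w k') \<in> tangent_space N q"
          by (rule coord_vector_tangent(1)[OF sN q(3) vm[OF q(1) vw(1)]],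
              rule coord_vector_tangent(1)[OF sN q(3) vm[OF q(1) vw(2)]])
      qed
      have "v k' = coord_vector N k q (v k') k"
        by (rule coord_vector_tangent(2)[OF sN q(3) vm[OF q(1) vw(1)], symmetric])
      also have "\<dots> = coord_vector N k q (w k') k" by (simp only: cvw)
      also have "\<dots> = w k'" by (rule coord_vector_tangent(2)[OF sN q(3) vm[OF q(1) vw(2)]])
      finally have vk: "v k' = w k'" .
      have "v = coord_vector N' k' q (v k')" by (rule vc[OF q(1) vw(1)])
      also have "\<dots> = coord_vector N' k' q (w k')" by (simp only: vk)
      also have "\<dots> = w" by (rule vc[OF q(1) vw(2), symmetric])
      finally show "v = w" .
    qed
    show "incl_diff N' M q ` tangent_space N' q \<subseteq> D q"
    proof (rule image_subsetI)
      fix v assume v: "v \<in> tangent_space N' q"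
      have "coord_vector N k q (v k') \<in> tangent_space N q"
        by (rule coord_vector_tangent(1)[OF sN q(3) vm[OF q(1) v]])
      then show "incl_diff N' M q v \<in> D q"
        unfolding diff[OF q(1) v] using tD[OF q(2)] by blast
    qed
  qed (use sN' sm' in auto)
  moreover have "mdim N' = mdim N" by (simp add: mdim_def N'_def)
  ultimately show thesis using that pts Uk(3) by blast
qed

text \<open>An integral manifold inside \<open>W\<close> of the largest possible dimension is maximal.\<close>

lemma integral_manifolds_dense:
  fixes M :: "('a, 'e::euclidean_space) manifold"
  assumes M: "smooth_manifold M" and D: "smooth_distribution M m D" and ci: "completely_integrable M m D"
    and W: "openin (topol M) W" "p \<in> W"
  obtains N where "integral_manifold M D N" "mdim N = m" "points N \<subseteq> W"
proof -
  define P where "P d \<longleftrightarrow> (\<exists>N. integral_manifold M D N \<and> points N \<subseteq> W \<and> mdim N = d)" for d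
  have "p \<in> points M" using W openin_subset by blast
  then obtain N0 where "integral_manifold M D N0" "points N0 = {p}"
    by (rule point_integral_manifold[OF M D])
  then have "P (mdim N0)" using W unfolding P_def by auto
  moreover have "d \<le> DIM('e)" if "P d" for d
    using that dim_subset_UNIV by (auto simp: P_def mdim_def)
  ultimately obtain d where d: "P d" "\<And>d'. P d' \<Longrightarrow> d' \<le> d"
    using GreatestI_nat[of P "mdim N0" "DIM('e)"] Greatest_le_nat[of P _ "DIM('e)"] by blast
  then obtain N where N: "integral_manifold M D N" "points N \<subseteq> W" "mdim N = d" by (auto simp: P_def)
  \<comment> \<open>\<open>W\<close> itself witnesses maximality at every point of \<open>N\<close>.
    A larger \<open>N'\<close> may leave \<open>W\<close>, but its restriction to \<open>W\<close>
    would be a competitor of larger dimension.\<close>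
  have "\<not> (\<exists>N'. integral_manifold M D N' \<and> mdim N' > mdim N \<and> points N \<inter> W \<subseteq> points N')"
  proof
    assume "\<exists>N'. integral_manifold M D N' \<and> mdim N' > mdim N \<and> points N \<inter> W \<subseteq> points N'"
    then obtain N' where N': "integral_manifold M D N'" "mdim N' > mdim N" "points N \<inter> W \<subseteq> points N'"
      by blast
    have "points N \<noteq> {}" using N(1) unfolding integral_manifold_def by blast
    then obtain x where "x \<in> points N" by blast
    then have "x \<in> points N'" "x \<in> W" using N(2) N'(3) by auto
    then obtain N'' where "integral_manifold M D N''" "mdim N'' = mdim N'" "points N'' \<subseteq> W"
      using integral_manifold_restrict[OF M N'(1) _ W(1)] by blast
    then have "P (mdim N')" by (auto simp: P_def)
    then show False using d(2) N'(2) N(3) by fastforce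
  qed
  then have "maximal_integral_manifold M D N"
    unfolding maximal_integral_manifold_def using N W(1) by blast
  then have "mdim N = m" using ci by (simp add: completely_integrable_def)
  then show thesis using that N by blast
qed

section \<open>From a dense set of integral points to involutivity everywhere\<close>

lemma bilinear_vanish_span:
  assumes "\<And>x y. x \<in> S \<Longrightarrow> y \<in> S \<Longrightarrow> A x \<bullet> y = A y \<bullet> (x :: 'e::euclidean_space)"
    and A: "linear A" and u: "u \<in> span S" and w: "w \<in> span S"
  shows "A u \<bullet> w = A w \<bullet> u"
proof -
  have "subspace {u. A u \<bullet> w = A w \<bullet> u}" for w
    using linear_0[OF A] linear_add[OF A] linear_scale[OF A]
    by (auto simp: subspace_def inner_add_left inner_add_right)
  note sub = this
  have 1: "A u \<bullet> y = A y \<bullet> u" if "y \<in> S" for y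
    using span_subspace_induct[OF u sub[of y]] assms(1) that by (auto simp: subset_iff)
  have "A w \<bullet> u = A u \<bullet> w"
    using span_subspace_induct[OF w sub[of u]] 1 by (auto simp: subset_iff)
  then show ?thesis by simp
qed

text \<open>By bilinearity the spanning fields suffice. They are used in place of fixed vectors
  because \<open>D\<close> varies with the point: a vector in \<open>D\<close> at \<open>y\<close>
  need not be in \<open>D\<close> nearby, whereas the \<open>Z j\<close> are, so the identity can be
  tested at integral points close to \<open>y\<close>.\<close>

lemma involutive:
  assumes M: "smooth_manifold M" and D: "smooth_distribution M m D"
    and \<omega>: "distribution_given_by M D n \<omega>" and ci: "completely_integrable M m D"
    and c: "c \<in> atlas M" and sub: "ball y0 r \<inter> model M \<subseteq> snd c ` fst c"
    and a': "C1_on (ball y0 r) (form_coord M c (\<omega> i)) a'" and i: "i \<in> {1..n}"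
    and Z: "\<And>j::nat. j \<in> {1..m} \<Longrightarrow> continuous_on (ball y0 r) (Z j)"
    and span: "\<And>y. y \<in> ball y0 r \<inter> model M \<Longrightarrow> (\<lambda>u. u c) ` D (chart_inv c y) = span ((\<lambda>j. Z j y) ` {1..m})"
    and y: "y \<in> ball y0 r \<inter> model M"
    and u: "u \<in> (\<lambda>u. u c) ` D (chart_inv c y)" and w: "w \<in> (\<lambda>u. u c) ` D (chart_inv c y)"
  shows "(a' y) u \<bullet> w = (a' y) w \<bullet> u"
proof -
  let ?S = "ball y0 r \<inter> model M"
  \<comment> \<open>The value of d(\<open>\<omega> i\<close>) on the fields \<open>Z j\<close> and
    \<open>Z l\<close>, a continuous function of the point.\<close>
  define h where "h j l y = blinfun_apply (a' y) (Z j y) \<bullet> Z l y - blinfun_apply (a' y) (Z l y) \<bullet> Z j y" for j l y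
  have ca': "continuous_on (ball y0 r) a'" using a' by (simp add: C1_on_def)
  have zero: "h j l y = 0" if jl: "j \<in> {1..m}" "l \<in> {1..m}" for j l
  proof (rule ccontr)
    assume "h j l y \<noteq> 0"
    moreover have "continuous_on (ball y0 r) (h j l)"
      unfolding h_def by (intro continuous_intros ca' Z jl)
    then have "isCont (h j l) y" using y by (simp add: continuous_on_eq_continuous_at)
    ultimately obtain e where e: "e > 0" "\<And>z. dist y z < e \<Longrightarrow> h j l z \<noteq> 0"
      using continuous_at_avoid by blast
    let ?W = "{q \<in> fst c. snd c q \<in> ball y0 r \<inter> ball y e}"
    have yS: "y \<in> snd c ` fst c" using y sub by blast
    have "chart_inv c y \<in> ?W"
      using chart_inv_in[OF M c yS] chart_inv_right[OF M c yS] y e(1) by auto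
    then obtain N where N: "integral_manifold M D N" "mdim N = m" "points N \<subseteq> ?W"
      by (rule integral_manifolds_dense[OF M D ci chart_preimage_openin[OF M c open_Int[OF open_ball open_ball]]])
    have "points N \<noteq> {}" using N(1) unfolding integral_manifold_def by blast
    then obtain q where q: "q \<in> points N" "q \<in> ?W" using N(3) by blast
    have cq: "c \<in> charts_at M q" using c q(2) by (simp add: charts_at_def)
    have qS: "snd c q \<in> ?S" using q(2) chart_image_subset[OF M c] by auto
    have iq: "chart_inv c (snd c q) = q" using chart_inv_left[OF M c] q(2) by auto
    have "Z k (snd c q) \<in> (\<lambda>u. u c) ` D q" if "k \<in> {1..m}" for k
      using span[OF qS] that unfolding iq by (auto intro: span_base)
    moreover have "(form_coord M c (\<omega> i) has_derivative (a' (snd c q))) (at (snd c q))"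
      using a' qS by (simp add: C1_on_def)
    ultimately have "h j l (snd c q) = 0"
      unfolding h_def using involutive_at_integral_point[OF M D \<omega> N(1,2) q(1) cq i] jl by simp
    then show False using e(2)[of "snd c q"] q(2) by auto
  qed
  show ?thesis
    by (rule bilinear_vanish_span[OF _ bounded_linear.linear[OF blinfun.bounded_linear_right] u[unfolded span[OF y]] w[unfolded span[OF y]]])
      (use zero in \<open>auto simp: h_def\<close>)
qed

section \<open>Integral curves\<close>

lemma integral_curve_preimage_open:
  assumes "integral_curve M X I g" "openin (topol M) V"
  shows "open {s \<in> I. g s \<in> V}"
proof -
  have "openin (top_of_set I) {s \<in> topspace (top_of_set I). g s \<in> V}"
    by (rule openin_continuous_map_preimage[OF _ assms(2)]) (use assms(1) in \<open>simp add: integral_curve_def\<close>)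
  then show ?thesis
    using assms(1) by (auto simp: integral_curve_def intro: openin_open_trans)
qed

lemma integral_curve_in_points:
  assumes "integral_curve M X I g" "s \<in> I"
  shows "g s \<in> points M"
proof -
  have "continuous_map (top_of_set I) (topol M) g" using assms(1) by (simp add: integral_curve_def)
  from continuous_map_image_subset_topspace[OF this] show ?thesis using assms(2) by auto
qed

lemma integral_curve_shift:
  assumes "integral_curve M X I g"
  shows "integral_curve M X {s. s + a \<in> I} (\<lambda>s. g (s + a))"
  unfolding integral_curve_def
proof (intro conjI ballI)
  have I: "open I" "is_interval I" "continuous_map (top_of_set I) (topol M) g"
    "\<And>t c. t \<in> I \<Longrightarrow> c \<in> charts_at M (g t) \<Longrightarrow> ((\<lambda>s. snd c (g s)) has_vector_derivative X (g t) c) (at t)"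
    using assms by (auto simp: integral_curve_def)
  have "open ((\<lambda>s. s + a) -` I)" by (intro open_vimage I(1) continuous_intros)
  then show "open {s. s + a \<in> I}" by (simp add: vimage_def)
  show "is_interval {s. s + a \<in> I}"
    using I(2) unfolding is_interval_1 by (metis add_le_cancel_right mem_Collect_eq)
  have "continuous_map (top_of_set {s. s + a \<in> I}) (top_of_set I) (\<lambda>s. s + a)"
    by (auto simp: continuous_map_in_subtopology intro!: continuous_intros)
  from continuous_map_compose[OF this I(3)]
  show "continuous_map (top_of_set {s. s + a \<in> I}) (topol M) (\<lambda>s. g (s + a))" by (simp add: o_def)
  fix t c assume "t \<in> {s. s + a \<in> I}" "c \<in> charts_at M (g (t + a))"
  then have d: "((\<lambda>s. snd c (g s)) has_vector_derivative X (g (t + a)) c) (at (t + a))" using I(4) by simp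
  have "((\<lambda>s. s + a) has_vector_derivative 1) (at t)" by (auto intro!: derivative_eq_intros)
  from vector_diff_chain_at[OF this d]
  show "((\<lambda>s. snd c (g (s + a))) has_vector_derivative X (g (t + a)) c) (at t)" by (simp add: o_def)
qed

lemma field_coord_at:
  assumes M: "smooth_manifold M" and c: "c \<in> charts_at M q"
  shows "field_coord M c X (snd c q) = X q c"
proof -
  have "snd c q \<in> model M" using chart_image_subset[OF M charts_atD(1)[OF c]] charts_atD(2)[OF c] by blast
  then show ?thesis
    unfolding field_coord_def
    by (simp add: proj(3)[OF smooth_manifold_subspace[OF M]] chart_inv_left[OF M charts_atD[OF c]])
qed

text \<open>Near \<open>t\<close> both curves stay in a coordinate ball on which the field is
  Lipschitz, and Gronwall's inequality is applied to the difference of their coordinates. From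
  \<open>local_flow_exists\<close> only the Lipschitz estimate is taken.\<close>

lemma integral_curves_agree_locally:
  assumes M: "smooth_manifold M" and X: "smooth_vector_field_on M (points M) X"
    and ic1: "integral_curve M X I1 g1" and ic2: "integral_curve M X I2 g2"
    and t: "t \<in> I1" "t \<in> I2" and eq: "g1 t = g2 t"
  shows "\<exists>\<eta>>0. \<forall>s\<in>ball t \<eta>. s \<in> I1 \<and> s \<in> I2 \<and> g1 s = g2 s"
proof -
  let ?p = "g1 t"
  have p: "?p \<in> points M" by (rule integral_curve_in_points[OF ic1 t(1)])
  obtain c where c: "c \<in> charts_at M ?p" by (rule charts_at_ex[OF M p])
  note ca = charts_atD[OF c]
  let ?y0 = "snd c ?p" and ?f = "field_coord M c X"
  obtain r f' where r: "r > 0" "ball ?y0 r \<inter> model M \<subseteq> snd c ` (fst c \<inter> points M)"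
    and f': "C1_on (ball ?y0 r) ?f f'"
    by (rule field_coord_C1_on[OF M X openin_topspace c p])
  obtain L where L: "L \<ge> 0" "\<And>y z. y \<in> cball ?y0 (r/2) \<Longrightarrow> z \<in> cball ?y0 (r/2) \<Longrightarrow>
      norm (?f y - ?f z) \<le> L * norm (y - z)"
    by (rule local_flow_exists[OF r(1) f']) blast
  define V where "V = {q \<in> fst c. snd c q \<in> ball ?y0 (r/2)}"
  have oV: "openin (topol M) V" unfolding V_def by (rule chart_preimage_openin[OF M ca(1) open_ball])
  have pV: "?p \<in> V" using ca r by (simp add: V_def)
  have "open ({s \<in> I1. g1 s \<in> V} \<inter> {s \<in> I2. g2 s \<in> V})"
    by (intro open_Int integral_curve_preimage_open[OF ic1 oV] integral_curve_preimage_open[OF ic2 oV])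
  moreover have "t \<in> {s \<in> I1. g1 s \<in> V} \<inter> {s \<in> I2. g2 s \<in> V}" using t pV eq by simp
  ultimately obtain \<eta> where \<eta>: "\<eta> > 0" "ball t \<eta> \<subseteq> {s \<in> I1. g1 s \<in> V} \<inter> {s \<in> I2. g2 s \<in> V}"
    using open_contains_ball by blast
  have der: "((\<lambda>s. snd c (g s)) has_vector_derivative ?f (snd c (g s))) (at s)"
    if "integral_curve M X I g" "s \<in> I" "g s \<in> V" for I g s
  proof -
    have cs: "c \<in> charts_at M (g s)" using that(3) ca by (simp add: V_def charts_at_def)
    then show ?thesis using that unfolding field_coord_at[OF M cs] integral_curve_def by blast
  qed
  have "g1 (t + h) = g2 (t + h)" if h: "\<bar>h\<bar> < \<eta>" for h
  proof -
    define u where "u s = snd c (g1 (t + s)) - snd c (g2 (t + s))" for s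
    have "(norm (u h))\<^sup>2 \<le> ((norm (u 0))\<^sup>2 + 0\<^sup>2) * exp ((2 * L + 1) * \<bar>h\<bar>)"
    proof (rule gronwall_norm[where u' = "\<lambda>s. ?f (snd c (g1 (t + s))) - ?f (snd c (g2 (t + s)))"])
      fix s assume "s \<in> closed_segment 0 h"
      then have "\<bar>s\<bar> < \<eta>" using h by (auto simp: closed_segment_eq_real_ivl split: if_splits)
      then have "t + s \<in> ball t \<eta>" by (simp add: dist_norm)
      then have s: "t + s \<in> I1" "g1 (t + s) \<in> V" "t + s \<in> I2" "g2 (t + s) \<in> V" using \<eta>(2) by blast+
      have sh: "((\<lambda>s. t + s) has_vector_derivative 1) (at s)" by (auto intro!: derivative_eq_intros)
      show "(u has_vector_derivative ?f (snd c (g1 (t + s))) - ?f (snd c (g2 (t + s)))) (at s)"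
        unfolding u_def
        using vector_diff_chain_at[OF sh der[OF ic1 s(1,2)]] vector_diff_chain_at[OF sh der[OF ic2 s(3,4)]]
        by (intro has_vector_derivative_diff) (simp_all add: o_def)
      show "norm (?f (snd c (g1 (t + s))) - ?f (snd c (g2 (t + s)))) \<le> L * norm (u s) + 0"
        using L(2)[of "snd c (g1 (t + s))" "snd c (g2 (t + s))"] s by (simp add: V_def u_def)
    qed (rule L(1))
    then have "u h = 0" using eq by (simp add: u_def)
    moreover have "t + h \<in> ball t \<eta>" using h by (simp add: dist_norm)
    then have "g1 (t + h) \<in> fst c" "g2 (t + h) \<in> fst c" using \<eta>(2) by (auto simp: V_def)
    ultimately show ?thesis using inj_onD[OF chart_inj[OF M ca(1)]] by (simp add: u_def)
  qed
  then have "g1 s = g2 s" if "s \<in> ball t \<eta>" for s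
    using that[unfolded mem_ball dist_real_def] \<open>\<And>h. \<bar>h\<bar> < \<eta> \<Longrightarrow> g1 (t + h) = g2 (t + h)\<close>[of "s - t"]
    by (simp add: abs_minus_commute)
  then show ?thesis using \<eta> by blast
qed

text \<open>Agreement is an open condition by the local statement, disagreement is open because the
  manifold is Hausdorff, and the common domain of two intervals is connected.\<close>

lemma integral_curve_unique:
  assumes M: "smooth_manifold M" and X: "smooth_vector_field_on M (points M) X"
    and ic1: "integral_curve M X I1 g1" and ic2: "integral_curve M X I2 g2"
    and a: "a \<in> I1" "a \<in> I2" "g1 a = g2 a" and b: "b \<in> I1" "b \<in> I2"
  shows "g1 b = g2 b"
proof (rule connected_induction_simple[where P = "\<lambda>s. g1 s = g2 s" and S = "I1 \<inter> I2"])
  have I: "open I1" "open I2" "is_interval I1" "is_interval I2"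
    using ic1 ic2 by (auto simp: integral_curve_def)
  show "connected (I1 \<inter> I2)"
    by (intro is_interval_connected is_interval_Int I)
  show "a \<in> I1 \<inter> I2" "b \<in> I1 \<inter> I2" "g1 a = g2 a" using a b by auto
  fix s assume s: "s \<in> I1 \<inter> I2"
  show "\<exists>T. openin (top_of_set (I1 \<inter> I2)) T \<and> s \<in> T \<and> (\<forall>x\<in>T. \<forall>y\<in>T. g1 x = g2 x \<longrightarrow> g1 y = g2 y)"
  proof (cases "g1 s = g2 s")
    case True
    obtain \<eta> where \<eta>: "\<eta> > 0" "\<And>u. u \<in> ball s \<eta> \<Longrightarrow> u \<in> I1 \<and> u \<in> I2 \<and> g1 u = g2 u"
      using integral_curves_agree_locally[OF M X ic1 ic2 _ _ True] s by blast
    show ?thesis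
    proof (intro exI[of _ "ball s \<eta>"] conjI ballI impI)
      show "openin (top_of_set (I1 \<inter> I2)) (ball s \<eta>)"
        by (rule open_openin_trans) (use \<eta> I in \<open>auto intro: open_Int\<close>)
    qed (use \<eta> in auto)
  next
    case False
    have "g1 s \<in> points M" "g2 s \<in> points M"
      using integral_curve_in_points[OF ic1] integral_curve_in_points[OF ic2] s by auto
    moreover have "Hausdorff_space (topol M)" using M by (simp add: smooth_manifold_def)
    ultimately obtain U V where UV: "openin (topol M) U" "openin (topol M) V" "g1 s \<in> U" "g2 s \<in> V" "disjnt U V"
      using False unfolding Hausdorff_space_def by metis
    let ?T = "{u \<in> I1. g1 u \<in> U} \<inter> {u \<in> I2. g2 u \<in> V}"
    show ?thesis
    proof (intro exI[of _ ?T] conjI ballI impI)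
      show "openin (top_of_set (I1 \<inter> I2)) ?T"
        by (rule open_openin_trans)
          (use I integral_curve_preimage_open[OF ic1 UV(1)] integral_curve_preimage_open[OF ic2 UV(2)]
            in \<open>auto intro: open_Int\<close>)
      show "s \<in> ?T" using s UV by auto
      show "g1 y = g2 y" if "x \<in> ?T" "g1 x = g2 x" for x y
        using that UV(5) by (auto simp: disjnt_iff)
    qed
  qed
qed

text \<open>Uniqueness on the overlap makes the glued curve equal to \<open>g2\<close> on all of
  \<open>I2\<close>, so both the derivative and the continuity can be checked on whichever interval
  contains the time.\<close>

lemma integral_curve_glue:
  fixes M :: "('a, 'e::euclidean_space) manifold"
  assumes M: "smooth_manifold M" and X: "smooth_vector_field_on M (points M) X"
    and ic1: "integral_curve M X I1 g1" and ic2: "integral_curve M X I2 g2"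
    and a: "a \<in> I1" "a \<in> I2" "g1 a = g2 a"
  shows "integral_curve M X (I1 \<union> I2) (\<lambda>s. if s \<in> I1 then g1 s else g2 s)"
proof -
  define h where "h s = (if s \<in> I1 then g1 s else g2 s)" for s
  have h1: "h s = g1 s" if "s \<in> I1" for s using that by (simp add: h_def)
  have h2: "h s = g2 s" if "s \<in> I2" for s
    using that integral_curve_unique[OF M X ic1 ic2 a] by (simp add: h_def)
  have I: "open I1" "open I2" "is_interval I1" "is_interval I2"
    and d1: "\<And>t c. t \<in> I1 \<Longrightarrow> c \<in> charts_at M (g1 t) \<Longrightarrow> ((\<lambda>s. snd c (g1 s)) has_vector_derivative X (g1 t) c) (at t)"
    and d2: "\<And>t c. t \<in> I2 \<Longrightarrow> c \<in> charts_at M (g2 t) \<Longrightarrow> ((\<lambda>s. snd c (g2 s)) has_vector_derivative X (g2 t) c) (at t)"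
    using ic1 ic2 unfolding integral_curve_def by blast+
  have "integral_curve M X (I1 \<union> I2) h"
    unfolding integral_curve_def
  proof (intro conjI ballI)
    show "open (I1 \<union> I2)" using I by blast
    have "connected (I1 \<union> I2)"
      using I a by (intro connected_Un is_interval_connected) auto
    then show "is_interval (I1 \<union> I2)" by (simp add: is_interval_connected_1)
    show "continuous_map (top_of_set (I1 \<union> I2)) (topol M) h"
      unfolding continuous_map_def
    proof (intro conjI allI impI)
      show "h \<in> topspace (top_of_set (I1 \<union> I2)) \<rightarrow> points M"
        using integral_curve_in_points[OF ic1] integral_curve_in_points[OF ic2] by (auto simp: h1 h2)
      fix V assume V: "openin (topol M) V"
      have "{s \<in> topspace (top_of_set (I1 \<union> I2)). h s \<in> V} = {s \<in> I1. g1 s \<in> V} \<union> {s \<in> I2. g2 s \<in> V}"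
        using h1 h2 by auto
      moreover have "openin (top_of_set (I1 \<union> I2)) ({s \<in> I1. g1 s \<in> V} \<union> {s \<in> I2. g2 s \<in> V})"
        by (rule open_openin_trans)
          (use I integral_curve_preimage_open[OF ic1 V] integral_curve_preimage_open[OF ic2 V] in auto)
      ultimately show "openin (top_of_set (I1 \<union> I2)) {s \<in> topspace (top_of_set (I1 \<union> I2)). h s \<in> V}" by simp
    qed
    fix t c assume t: "t \<in> I1 \<union> I2" and c: "c \<in> charts_at M (h t)"
    show "((\<lambda>s. snd c (h s)) has_vector_derivative X (h t) c) (at t)"
    proof (cases "t \<in> I1")
      case True
      then have "((\<lambda>s. snd c (g1 s)) has_vector_derivative X (h t) c) (at t)"
        using d1[OF True, of c] c by (simp add: h1)
      then show ?thesis
        by (rule has_vector_derivative_transform_within_open[OF _ I(1) True]) (simp add: h1)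
    next
      case False
      then have t2: "t \<in> I2" using t by blast
      then have "((\<lambda>s. snd c (g2 s)) has_vector_derivative X (h t) c) (at t)"
        using d2[OF t2, of c] c by (simp add: h2)
      then show ?thesis
        by (rule has_vector_derivative_transform_within_open[OF _ I(2) t2]) (simp add: h2)
    qed
  qed
  then show ?thesis by (simp add: h_def[abs_def])
qed

section \<open>Well-definedness of the flow and addition of times\<close>

context
  fixes M :: "('a, 'e::euclidean_space) manifold" and X
  assumes M: "smooth_manifold M" and X: "smooth_vector_field_on M (points M) X"
begin

lemma flow_rel_unique: "flow_rel M X t x y \<Longrightarrow> flow_rel M X t x z \<Longrightarrow> y = z"
  unfolding flow_rel_def by (elim exE conjE) (use integral_curve_unique[OF M X, of _ _ _ _ 0 t] in blast)

lemma flow_eqI: "flow_rel M X t x y \<Longrightarrow> flow M X t x = y"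
  unfolding flow_def by (rule the_equality) (auto intro: flow_rel_unique)

lemma flow_rel_flow:
  assumes "x \<in> flow_domain M X t"
  shows "flow_rel M X t x (flow M X t x)"
proof -
  obtain y where "flow_rel M X t x y" using assms by (auto simp: flow_domain_def)
  then show ?thesis using flow_eqI by simp
qed

text \<open>The second curve, delayed by \<open>s\<close>, meets the first at time \<open>s\<close>
  and is glued to it. The signs of \<open>s\<close> and \<open>h\<close> are arbitrary: if
  \<open>s + h\<close> already lies in \<open>I1\<close>, uniqueness gives the value there.\<close>

lemma flow_rel_trans:
  assumes "flow_rel M X s x y" "flow_rel M X h y z"
  shows "flow_rel M X (s + h) x z"
proof -
  obtain I1 g1 where 1: "integral_curve M X I1 g1" "0 \<in> I1" "s \<in> I1" "g1 0 = x" "g1 s = y"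
    using assms(1) by (auto simp: flow_rel_def)
  obtain I2 g2 where 2: "integral_curve M X I2 g2" "0 \<in> I2" "h \<in> I2" "g2 0 = y" "g2 h = z"
    using assms(2) by (auto simp: flow_rel_def)
  let ?I = "{u. u + - s \<in> I2}" and ?g = "\<lambda>u. g2 (u + - s)"
  have c2: "integral_curve M X ?I ?g" by (rule integral_curve_shift[OF 2(1)])
  have s2: "s \<in> ?I" "g1 s = ?g s" using 1 2 by auto
  let ?glue = "\<lambda>u. if u \<in> I1 then g1 u else ?g u"
  have "integral_curve M X (I1 \<union> ?I) ?glue"
    by (rule integral_curve_glue[OF M X 1(1) c2 1(3) s2])
  moreover have "?glue (s + h) = z"
    using integral_curve_unique[OF M X 1(1) c2 1(3) s2, of "s + h"] 2 by auto
  moreover have "?glue 0 = x" "0 \<in> I1 \<union> ?I" "s + h \<in> I1 \<union> ?I" using 1 2 by auto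
  ultimately show ?thesis unfolding flow_rel_def by blast
qed

end

section \<open>Maps preserving a distribution at a point\<close>

lemma chart_diff_cong:
  assumes M: "smooth_manifold M" and c: "c \<in> charts_at M p"
    and V: "openin (topol M) V" "p \<in> V" "\<And>q. q \<in> V \<Longrightarrow> F q = G q"
  shows "chart_diff c c' F p \<longleftrightarrow> chart_diff c c' G p" and "local_deriv c c' F p = local_deriv c c' G p"
proof -
  note ca = charts_atD[OF c]
  let ?S = "snd c ` fst c" and ?T = "snd c ` (fst c \<inter> V)" and ?y = "snd c p"
  have T: "openin (top_of_set (model M)) ?T" "?y \<in> ?T"
    using chart_image_openin_Int[OF M ca(1) V(1)] ca V by auto
  have within: "at ?y within ?S = at ?y within ?T"
    by (rule at_within_openin[OF T, symmetric]) (use chart_image_subset[OF M ca(1)] in auto)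
  have eq: "(snd c' \<circ> F \<circ> chart_inv c) y = (snd c' \<circ> G \<circ> chart_inv c) y" if "y \<in> ?T" for y
    using that V(3) by (auto simp: chart_inv_left[OF M ca(1)])
  have iff: "((snd c' \<circ> F \<circ> chart_inv c) has_derivative A) (at ?y within ?S) \<longleftrightarrow>
      ((snd c' \<circ> G \<circ> chart_inv c) has_derivative A) (at ?y within ?S)" for A
    unfolding within using has_derivative_transform[OF T(2), of "snd c' \<circ> F \<circ> chart_inv c" "snd c' \<circ> G \<circ> chart_inv c" A]
      has_derivative_transform[OF T(2), of "snd c' \<circ> G \<circ> chart_inv c" "snd c' \<circ> F \<circ> chart_inv c" A] eq by metis
  show "chart_diff c c' F p \<longleftrightarrow> chart_diff c c' G p" unfolding chart_diff_def differentiable_def iff ..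
  show "local_deriv c c' F p = local_deriv c c' G p"
    unfolding local_deriv_def frechet_derivative_def iff ..
qed

text \<open>A statement about one point that composes well. It includes continuity at
  \<open>p\<close> as well as differentiability in charts, since a composite must map a
  neighbourhood into the next chart domain. The image vector is one element \<open>u\<close> for all
  charts, so the last clause says that the differential maps \<open>D p\<close> into
  \<open>D (F p)\<close>.\<close>

definition preserves_at ::
  "('a, 'e::euclidean_space) manifold \<Rightarrow> ('a \<Rightarrow> ('a, 'e) tvec set) \<Rightarrow> ('a \<Rightarrow> 'a) \<Rightarrow> 'a \<Rightarrow> bool"
  where "preserves_at M D F p \<longleftrightarrow> p \<in> points M \<and> F p \<in> points M \<and>
    (\<forall>W. openin (topol M) W \<and> F p \<in> W \<longrightarrow> (\<exists>V. openin (topol M) V \<and> p \<in> V \<and> F ` V \<subseteq> W)) \<and>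
    (\<forall>c\<in>charts_at M p. \<forall>c'\<in>charts_at M (F p). chart_diff c c' F p) \<and>
    (\<forall>v\<in>D p. \<exists>u\<in>D (F p). \<forall>c\<in>charts_at M p. \<forall>c'\<in>charts_at M (F p). u c' = local_deriv c c' F p (v c))"

context
  fixes M :: "('a, 'e::euclidean_space) manifold" and D :: "'a \<Rightarrow> ('a, 'e) tvec set"
  assumes M: "smooth_manifold M" and Dt: "\<And>p. p \<in> points M \<Longrightarrow> D p \<subseteq> tangent_space M p"
begin

text \<open>One chart at each end suffices, because the chain rule with chart transitions on both
  sides carries differentiability and the image vector to all other charts.\<close>

lemma preserves_atI:
  assumes c: "c \<in> charts_at M p" and c': "c' \<in> charts_at M (F p)"
    and cont: "\<And>W. openin (topol M) W \<Longrightarrow> F p \<in> W \<Longrightarrow> \<exists>V. openin (topol M) V \<and> p \<in> V \<and> F ` V \<subseteq> W"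
    and diff: "chart_diff c c' F p"
    and pres: "\<And>v. v \<in> D p \<Longrightarrow> \<exists>u\<in>D (F p). u c' = local_deriv c c' F p (v c)"
  shows "preserves_at M D F p"
proof -
  note ca = charts_atD[OF c] and ca' = charts_atD[OF c']
  have p: "p \<in> points M" "F p \<in> points M"
    using chart_subset_points[OF M ca(1)] chart_subset_points[OF M ca'(1)] ca ca' by auto
  obtain V where V: "openin (topol M) V" "p \<in> V" "F ` V \<subseteq> fst c'"
    using cont[OF chart_openin[OF M ca'(1)] ca'(2)] by blast
  have 1: "chart_diff k c' F p" "w \<in> model M \<Longrightarrow>
      local_deriv k c' F p w = local_deriv c c' F p (id_deriv k c p w)"
    if k: "k \<in> charts_at M p" for k w
    using local_deriv_chain[where F = "\<lambda>q. q" and G = F, OF M k chart_openin[OF M ca(1)] ca(2) _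
        chart_inv_left[OF M ca(1)] chart_diff_id[OF M k c] diff] by auto
  have 2: "chart_diff k k' F p" "w \<in> model M \<Longrightarrow>
      local_deriv k k' F p w = id_deriv c' k' (F p) (local_deriv k c' F p w)"
    if k: "k \<in> charts_at M p" and k': "k' \<in> charts_at M (F p)" for k k' w
    using local_deriv_chain[where F = F and G = "\<lambda>q. q", OF M k V(1,2) _
        chart_inv_left[OF M ca'(1)] 1(1)[OF k] chart_diff_id[OF M c' k']] V(3) by auto
  have "\<exists>u\<in>D (F p). \<forall>k\<in>charts_at M p. \<forall>k'\<in>charts_at M (F p). u k' = local_deriv k k' F p (v k)"
    if v: "v \<in> D p" for v
  proof -
    obtain u where u: "u \<in> D (F p)" "u c' = local_deriv c c' F p (v c)" using pres[OF v] by blast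
    have "u k' = local_deriv k k' F p (v k)"
      if k: "k \<in> charts_at M p" and k': "k' \<in> charts_at M (F p)" for k k'
    proof -
      have vt: "v \<in> tangent_space M p" and ut: "u \<in> tangent_space M (F p)" using v u Dt p by auto
      have vk: "v k \<in> model M" by (rule tangent_space_coord(1)[OF vt k])
      have vc: "v c = id_deriv k c p (v k)" using vt k c unfolding tangent_space_def by blast
      have uk: "u k' = id_deriv c' k' (F p) (u c')" using ut k' c' unfolding tangent_space_def by blast
      show ?thesis unfolding uk 2(2)[OF k k' vk] 1(2)[OF k vk] u(2) vc ..
    qed
    then show ?thesis using u(1) by blast
  qed
  then show ?thesis unfolding preserves_at_def using p cont 2(1) by blast
qed

text \<open>\<open>H\<close> agrees with the composite only near \<open>p\<close>, which is the form
  in which the flow law for local flows is available.\<close>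

lemma preserves_at_compose:
  assumes F: "preserves_at M D F p" and G: "preserves_at M D G (F p)"
    and V: "openin (topol M) V" "p \<in> V" "\<And>q. q \<in> V \<Longrightarrow> H q = G (F q)"
  shows "preserves_at M D H p"
proof -
  have Hp: "H p = G (F p)" using V by blast
  have pts: "p \<in> points M" "F p \<in> points M" "G (F p) \<in> points M"
    using F G by (auto simp: preserves_at_def)
  obtain c where c: "c \<in> charts_at M p" by (rule charts_at_ex[OF M pts(1)])
  obtain c' where c': "c' \<in> charts_at M (F p)" by (rule charts_at_ex[OF M pts(2)])
  obtain c'' where c'': "c'' \<in> charts_at M (G (F p))" by (rule charts_at_ex[OF M pts(3)])
  note ca' = charts_atD[OF c']
  have contF: "\<exists>V. openin (topol M) V \<and> p \<in> V \<and> F ` V \<subseteq> W" if "openin (topol M) W" "F p \<in> W" for W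
    using F that unfolding preserves_at_def by blast
  have contG: "\<exists>V. openin (topol M) V \<and> F p \<in> V \<and> G ` V \<subseteq> W" if "openin (topol M) W" "G (F p) \<in> W" for W
    using G that unfolding preserves_at_def by blast
  have dF: "chart_diff c c' F p" and dG: "chart_diff c' c'' G (F p)"
    using F G c c' c'' unfolding preserves_at_def by blast+
  obtain V1 where V1: "openin (topol M) V1" "p \<in> V1" "F ` V1 \<subseteq> fst c'"
    using contF[OF chart_openin[OF M ca'(1)] ca'(2)] by blast
  have V1': "\<And>q. q \<in> V1 \<Longrightarrow> F q \<in> fst c'" using V1(3) by blast
  have chain1: "chart_diff c c'' (\<lambda>q. G (F q)) p"
    by (rule local_deriv_chain(1)[OF M c V1(1,2) V1' chart_inv_left[OF M ca'(1)] dF dG])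
  have chain2: "local_deriv c c'' (\<lambda>q. G (F q)) p w
      = local_deriv c' c'' G (F p) (local_deriv c c' F p w)" if "w \<in> model M" for w
    by (rule local_deriv_chain(2)[OF M c V1(1,2) V1' chart_inv_left[OF M ca'(1)] dF dG that])
  have cong: "chart_diff c c'' H p \<longleftrightarrow> chart_diff c c'' (\<lambda>q. G (F q)) p"
    "local_deriv c c'' H p = local_deriv c c'' (\<lambda>q. G (F q)) p"
    by (rule chart_diff_cong[OF M c V(1,2)], erule V(3))+
  show ?thesis
  proof (rule preserves_atI[where F = H and p = p, OF c c''[folded Hp]])
    fix W assume W: "openin (topol M) W" "H p \<in> W"
    obtain W' where W': "openin (topol M) W'" "F p \<in> W'" "G ` W' \<subseteq> W" using contG W Hp by auto
    obtain W'' where W'': "openin (topol M) W''" "p \<in> W''" "F ` W'' \<subseteq> W'" using contF W' by blast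
    show "\<exists>V. openin (topol M) V \<and> p \<in> V \<and> H ` V \<subseteq> W"
    proof (intro exI[of _ "V \<inter> W''"] conjI)
      show "openin (topol M) (V \<inter> W'')" using V(1) W''(1) by blast
      show "H ` (V \<inter> W'') \<subseteq> W" using V(3) W''(3) W'(3) by fastforce
    qed (use V W'' in auto)
  next
    show "chart_diff c c'' H p" using chain1 cong(1) by blast
  next
    fix v assume v: "v \<in> D p"
    then have vm: "v c \<in> model M" using Dt[OF pts(1)] tangent_space_coord(1)[OF _ c] by blast
    obtain u where u: "u \<in> D (F p)" "u c' = local_deriv c c' F p (v c)"
      using F v c c' unfolding preserves_at_def by blast
    obtain w where w: "w \<in> D (G (F p))" "w c'' = local_deriv c' c'' G (F p) (u c')"
      using G u c' c'' unfolding preserves_at_def by blast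
    show "\<exists>w\<in>D (H p). w c'' = local_deriv c c'' H p (v c)"
      using w unfolding Hp cong(2) chain2[OF vm] u(2) by blast
  qed
qed

lemma preserves_at_differential:
  assumes F: "preserves_at M D F p" and v: "v \<in> D p"
  shows "differential M M F p v \<in> D (F p)"
proof -
  have p: "p \<in> points M" "F p \<in> points M" using F by (auto simp: preserves_at_def)
  obtain c where c: "c \<in> charts_at M p" by (rule charts_at_ex[OF M p(1)])
  have vt: "v \<in> tangent_space M p" using v Dt p by blast
  obtain u where u: "u \<in> D (F p)"
    and uc: "\<And>c c'. c \<in> charts_at M p \<Longrightarrow> c' \<in> charts_at M (F p) \<Longrightarrow> u c' = local_deriv c c' F p (v c)"
    using F v unfolding preserves_at_def by metis
  have ut: "u \<in> tangent_space M (F p)" using u Dt p by blast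
  have "differential M M F p v c' = u c'" for c'
  proof (cases "c' \<in> charts_at M (F p)")
    case True
    have "chart_diff k c' F p" if "k \<in> charts_at M p" for k
      using F True that unfolding preserves_at_def by blast
    from differential_coord[OF M c True this vt] show ?thesis using uc[OF c True] by simp
  next
    case False
    then have "u c' = 0" using ut unfolding tangent_space_def by blast
    then show ?thesis using False by (simp add: differential_def Let_def)
  qed
  then have "differential M M F p v = u" by (rule ext)
  then show ?thesis using u by simp
qed

end

section \<open>The flow of a field in an involutive distribution\<close>

text \<open>The component of the curve off \<open>E\<close> starts at 0 and has zero derivative.
  Trajectories and solutions of the variational equation thus remain in the model space.\<close>

lemma has_vector_derivative_in_subspace:
  fixes g :: "real \<Rightarrow> 'e::euclidean_space"
  assumes E: "subspace E" and g: "\<And>s. \<bar>s\<bar> < \<epsilon> \<Longrightarrow> (g has_vector_derivative g' s) (at s)"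
    and g': "\<And>s. \<bar>s\<bar> < \<epsilon> \<Longrightarrow> g' s \<in> E" and g0: "g 0 \<in> E" and t: "\<bar>t\<bar> < \<epsilon>"
  shows "g t \<in> E"
proof -
  have "(norm (g t - proj E (g t)))\<^sup>2 \<le> ((norm (g 0 - proj E (g 0)))\<^sup>2 + 0\<^sup>2) * exp ((2 * 0 + 1) * \<bar>t\<bar>)"
  proof (rule gronwall_norm[where u' = "\<lambda>s. g' s - proj E (g' s)"])
    fix s assume "s \<in> closed_segment 0 t"
    then have s: "\<bar>s\<bar> < \<epsilon>" using t by (auto simp: closed_segment_eq_real_ivl split: if_splits)
    show "((\<lambda>s. g s - proj E (g s)) has_vector_derivative g' s - proj E (g' s)) (at s)"
      by (intro has_vector_derivative_diff g[OF s] bounded_linear.has_vector_derivative[OF proj(1)[OF E] g[OF s]])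
    show "norm (g' s - proj E (g' s)) \<le> 0 * norm (g s - proj E (g s)) + 0"
      using proj(3)[OF E g'[OF s]] by simp
  qed simp
  then have "g t = proj E (g t)" using proj(3)[OF E g0] by simp
  then show ?thesis using proj(2)[OF E] by metis
qed

text \<open>The differential equation is known in the chart \<open>c\<close> only. It passes to any
  other chart since the components of the tangent vector \<open>X ?q\<close> transform by the same
  transition derivative as velocities do.\<close>

lemma integral_curve_of_coord:
  assumes M: "smooth_manifold M" and X: "smooth_vector_field_on M (points M) X" and c: "c \<in> atlas M"
    and y: "\<And>s. \<bar>s\<bar> < \<epsilon> \<Longrightarrow> y s \<in> snd c ` fst c"
    and yd: "\<And>s. \<bar>s\<bar> < \<epsilon> \<Longrightarrow> (y has_vector_derivative field_coord M c X (y s)) (at s)"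
  shows "integral_curve M X {-\<epsilon><..<\<epsilon>} (\<lambda>s. chart_inv c (y s))"
  unfolding integral_curve_def
proof (intro conjI ballI)
  let ?I = "{-\<epsilon><..<\<epsilon>}"
  have I: "\<bar>s\<bar> < \<epsilon>" if "s \<in> ?I" for s using that by auto
  show "open ?I" "is_interval ?I" by (simp_all add: is_interval_oo)
  have "continuous_on ?I y"
    using yd I by (intro continuous_at_imp_continuous_on) (meson has_vector_derivative_continuous)
  then have "continuous_map (top_of_set ?I) (top_of_set (snd c ` fst c)) y"
    using y I by (auto simp: continuous_map_in_subtopology)
  from continuous_map_compose[OF this chart_inv_continuous_map[OF M c]]
  show "continuous_map (top_of_set ?I) (topol M) (\<lambda>s. chart_inv c (y s))" by (simp add: o_def)
  fix t k assume t: "t \<in> ?I" and k: "k \<in> charts_at M (chart_inv c (y t))"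
  let ?q = "chart_inv c (y t)"
  note t' = I[OF t]
  have q: "snd c ?q = y t" "?q \<in> fst c"
    using chart_inv_right[OF M c y[OF t']] chart_inv_in[OF M c y[OF t']] by auto
  have cq: "c \<in> charts_at M ?q" using q c by (simp add: charts_at_def)
  have "?q \<in> points M" using chart_subset_points[OF M c] q by blast
  then have "X ?q \<in> tangent_space M ?q" using X by (simp add: smooth_vector_field_on_def)
  then have Xk: "X ?q k = id_deriv c k ?q (X ?q c)"
    using k cq unfolding tangent_space_def by blast
  have cd: "chart_diff c k (\<lambda>q. q) ?q" by (rule chart_diff_id[OF M cq k])
  have "y ` ?I \<subseteq> snd c ` fst c" using y I by blast
  then have d1: "((snd k \<circ> (\<lambda>q. q) \<circ> chart_inv c) has_derivative id_deriv c k ?q) (at (y t) within y ` ?I)"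
    using has_derivative_subset[OF chart_diff_has_derivative[OF cd]] q(1) by simp
  have d2: "(y has_derivative (\<lambda>h. h *\<^sub>R X ?q c)) (at t within ?I)"
    using yd[OF t'] field_coord_at[OF M cq, of X] q(1)
    by (auto simp: has_vector_derivative_def intro: has_derivative_at_withinI)
  have "((\<lambda>s. snd k (chart_inv c (y s))) has_derivative (\<lambda>h. id_deriv c k ?q (h *\<^sub>R X ?q c))) (at t within ?I)"
    using has_derivative_in_compose[OF d2 d1] by (simp add: o_def)
  then show "((\<lambda>s. snd k (chart_inv c (y s))) has_vector_derivative X ?q k) (at t)"
    using t by (simp add: has_vector_derivative_def Xk linear_scale[OF chart_diff_linear[OF cd]] at_within_open[of t ?I])
qed

text \<open>In a chart the flow of \<open>X\<close> is the flow of the coordinate field, and its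
  derivative \<open>Y\<close> is kept in the kernel of the forms by
  \<open>kernel_invariant_under_variation\<close>. The same \<open>\<epsilon>\<close> serves all
  starting points in \<open>V\<close>, which the passage to large times relies on.\<close>

lemma local_flow_preserves:
  assumes M: "smooth_manifold M" and D: "smooth_distribution M m D"
    and \<omega>: "distribution_given_by M D n \<omega>" and ci: "completely_integrable M m D"
    and XD: "vector_field_in M X D" and p: "p \<in> points M"
  obtains \<epsilon> V where "\<epsilon> > 0" "openin (topol M) V" "p \<in> V"
    "\<And>q h. q \<in> V \<Longrightarrow> \<bar>h\<bar> < \<epsilon> \<Longrightarrow> q \<in> flow_domain M X h \<and> preserves_at M D (flow M X h) q"
proof -
  have X: "smooth_vector_field_on M (points M) X" and XinD: "\<And>q. q \<in> points M \<Longrightarrow> X q \<in> D q"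
    using XD by (auto simp: vector_field_in_def)
  have Dt: "\<And>q. q \<in> points M \<Longrightarrow> D q \<subseteq> tangent_space M q" using D by (simp add: smooth_distribution_def)
  obtain c where c: "c \<in> charts_at M p" by (rule charts_at_ex[OF M p])
  note ca = charts_atD[OF c]
  let ?E = "model M" and ?y0 = "snd c p" and ?f = "field_coord M c X"
  define a where "a i = form_coord M c (\<omega> i)" for i
  have E: "subspace ?E" by (rule smooth_manifold_subspace[OF M])
  have y0E: "?y0 \<in> ?E" using chart_image_subset[OF M ca(1)] ca(2) by blast
  obtain r1 a' Z where r1: "r1 > 0" "ball ?y0 r1 \<inter> ?E \<subseteq> snd c ` fst c"
    and a'1: "\<And>i. i \<in> {1..n} \<Longrightarrow> C1_on (ball ?y0 r1) (a i) (a' i)"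
    and Z1: "\<And>j::nat. j \<in> {1..m} \<Longrightarrow> continuous_on (ball ?y0 r1) (Z j)"
    and span1: "\<And>y. y \<in> ball ?y0 r1 \<inter> ?E \<Longrightarrow> (\<lambda>u. u c) ` D (chart_inv c y) = span ((\<lambda>j. Z j y) ` {1..m})"
    unfolding a_def by (rule adapted_chart[OF M D \<omega> c]) blast
  obtain r2 f' where r2: "r2 > 0" and f'2: "C1_on (ball ?y0 r2) ?f f'"
    by (rule field_coord_C1_on[OF M X openin_topspace c p])
  define r where "r = min r1 r2"
  have r: "r > 0" "ball ?y0 r \<subseteq> ball ?y0 r1" "ball ?y0 r \<subseteq> ball ?y0 r2" using r1 r2 by (auto simp: r_def)
  have S: "ball ?y0 r \<inter> ?E \<subseteq> snd c ` fst c" using r1(2) r(2) by blast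
  have a': "C1_on (ball ?y0 r) (a i) (a' i)" if "i \<in> {1..n}" for i
    by (rule C1_on_subset[OF a'1[OF that] r(2)])
  have Z: "continuous_on (ball ?y0 r) (Z j)" if "j \<in> {1..m}" for j
    by (rule continuous_on_subset[OF Z1[OF that] r(2)])
  have span: "(\<lambda>u. u c) ` D (chart_inv c y) = span ((\<lambda>j. Z j y) ` {1..m})" if "y \<in> ball ?y0 r \<inter> ?E" for y
    using span1 that r(2) by blast
  have f': "C1_on (ball ?y0 r) ?f f'" by (rule C1_on_subset[OF f'2 r(3)])
  have pt: "chart_inv c y \<in> fst c" "snd c (chart_inv c y) = y" "c \<in> charts_at M (chart_inv c y)"
      "chart_inv c y \<in> points M"
    if "y \<in> ball ?y0 r \<inter> ?E" for y
  proof -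
    have "y \<in> snd c ` fst c" using that S by blast
    then show q: "chart_inv c y \<in> fst c" "snd c (chart_inv c y) = y"
      using chart_inv_in[OF M ca(1)] chart_inv_right[OF M ca(1)] by auto
    then show "c \<in> charts_at M (chart_inv c y)" using ca(1) by (simp add: charts_at_def)
    show "chart_inv c y \<in> points M" using q chart_subset_points[OF M ca(1)] by blast
  qed
  have ker: "{w \<in> ?E. \<forall>i\<in>{1..n}. a i y \<bullet> w = 0} = (\<lambda>u. u c) ` D (chart_inv c y)"
    if y: "y \<in> ball ?y0 r \<inter> ?E" for y
    using kernel_coord[OF M D \<omega> pt(3)[OF y]] unfolding pt(2)[OF y] a_def .
  have pE: "proj ?E y \<in> ball ?y0 r \<inter> ?E" if "y \<in> ball ?y0 r" for y
    by (rule proj_in_ball(2)[OF E y0E that])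
  have fD: "?f y \<in> (\<lambda>u. u c) ` D (chart_inv c (proj ?E y))" if "y \<in> ball ?y0 r" for y
    unfolding field_coord_def using XinD[OF pt(4)[OF pE[OF that]]] by blast
  have fE: "?f y \<in> ?E" and af0: "\<And>i. i \<in> {1..n} \<Longrightarrow> a i (proj ?E y) \<bullet> ?f y = 0"
    if y: "y \<in> ball ?y0 r" for y
    using fD[OF y] unfolding ker[OF pE[OF y], symmetric] by blast+
  \<comment> \<open>Forms and field both factor through the projection, so
    \<open>a i y \<bullet> ?f y = 0\<close> extends from the model space to the full ball, where it
    can be differentiated in every direction.\<close>
  have aproj: "a i (proj ?E y) = a i y" for i y
    unfolding a_def form_coord_def by (simp add: proj(3)[OF E proj(2)[OF E]])
  have af: "a i y \<bullet> ?f y = 0" if "i \<in> {1..n}" "y \<in> ball ?y0 r" for i y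
    using af0[OF that(2,1)] by (simp add: aproj)
  \<comment> \<open>The coordinate field takes values in the model space, hence so does its
    derivative; this keeps solutions of the variational equation there.\<close>
  have f'E: "(f' y) v \<in> ?E" if y: "y \<in> ball ?y0 r" for y v
  proof (rule has_derivative_in_subspace[where E = UNIV and T = "ball ?y0 r" and x = y
        and f = ?f and F = "blinfun_apply (f' y)" and w = v])
    show "(?f has_derivative (f' y)) (at y within ball ?y0 r)"
      using f' y by (auto simp: C1_on_def intro: has_derivative_at_withinI)
  qed (use E y fE in auto)
  have invol: "(a' i y) u \<bullet> w = (a' i y) w \<bullet> u"
    if i: "i \<in> {1..n}" and y: "y \<in> ball ?y0 r \<inter> ?E" and u: "u \<in> ?E" "\<And>i. i \<in> {1..n} \<Longrightarrow> a i y \<bullet> u = 0"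
      and w: "w \<in> ?E" "\<And>i. i \<in> {1..n} \<Longrightarrow> a i y \<bullet> w = 0" for i y u w
  proof -
    have uw: "u \<in> (\<lambda>u. u c) ` D (chart_inv c y)" "w \<in> (\<lambda>u. u c) ` D (chart_inv c y)"
      unfolding ker[OF y, symmetric] using u w by auto
    show ?thesis
      by (rule involutive[where Z = Z, OF M D \<omega> ci ca(1) S a'[unfolded a_def, OF i] i _ _ y uw])
        (use Z span in auto)
  qed
  obtain \<epsilon> \<delta> \<phi> Y where \<epsilon>: "\<epsilon> > 0" and \<delta>: "\<delta> > 0" "\<delta> \<le> r"
    and \<phi>0: "\<And>x. x \<in> ball ?y0 \<delta> \<Longrightarrow> \<phi> x 0 = x"
    and \<phi>in: "\<And>x t. x \<in> ball ?y0 \<delta> \<Longrightarrow> \<bar>t\<bar> < \<epsilon> \<Longrightarrow> \<phi> x t \<in> ball ?y0 (r/2)"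
    and \<phi>d: "\<And>x t. x \<in> ball ?y0 \<delta> \<Longrightarrow> \<bar>t\<bar> < \<epsilon> \<Longrightarrow> (\<phi> x has_vector_derivative ?f (\<phi> x t)) (at t)"
    and \<phi>Y: "\<And>x t. x \<in> ball ?y0 \<delta> \<Longrightarrow> \<bar>t\<bar> < \<epsilon> \<Longrightarrow> ((\<lambda>x. \<phi> x t) has_derivative Y x t) (at x)"
    and Y0: "\<And>x v. x \<in> ball ?y0 \<delta> \<Longrightarrow> Y x 0 v = v"
    and Yd: "\<And>x t v. x \<in> ball ?y0 \<delta> \<Longrightarrow> \<bar>t\<bar> < \<epsilon> \<Longrightarrow>
      ((\<lambda>t. Y x t v) has_vector_derivative (f' (\<phi> x t)) (Y x t v)) (at t)"
    by (rule differentiable_local_flow_exists[OF r(1) f']) (rule that)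
  have \<phi>r: "\<phi> x t \<in> ball ?y0 r" if "x \<in> ball ?y0 \<delta>" "\<bar>t\<bar> < \<epsilon>" for x t
    using \<phi>in[OF that] r(1) by auto
  have \<phi>E: "\<phi> x t \<in> ?E" if x: "x \<in> ball ?y0 \<delta>" "x \<in> ?E" and t: "\<bar>t\<bar> < \<epsilon>" for x t
    by (rule has_vector_derivative_in_subspace[OF E \<phi>d[OF x(1)] fE[OF \<phi>r[OF x(1)]] _ t])
      (use x \<phi>0[OF x(1)] in auto)
  have YE: "Y x t v \<in> ?E" if x: "x \<in> ball ?y0 \<delta>" and v: "v \<in> ?E" and t: "\<bar>t\<bar> < \<epsilon>" for x v t
    by (rule has_vector_derivative_in_subspace[OF E Yd[OF x] f'E[OF \<phi>r[OF x]] _ t])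
      (use v Y0[OF x] in auto)
  define V where "V = {q \<in> fst c. snd c q \<in> ball ?y0 \<delta>}"
  have oV: "openin (topol M) V" unfolding V_def by (rule chart_preimage_openin[OF M ca(1) open_ball])
  have pV: "p \<in> V" using ca \<delta> by (simp add: V_def)
  have V: "q \<in> fst c" "snd c q \<in> ball ?y0 \<delta>" "snd c q \<in> ?E" "c \<in> charts_at M q" "q \<in> points M" if "q \<in> V" for q
    using that chart_image_subset[OF M ca(1)] chart_subset_points[OF M ca(1)] ca(1)
    by (auto simp: V_def charts_at_def)
  have rel: "flow_rel M X h q (chart_inv c (\<phi> (snd c q) h))" if q: "q \<in> V" and h: "\<bar>h\<bar> < \<epsilon>" for q h
  proof -
    have "integral_curve M X {-\<epsilon><..<\<epsilon>} (\<lambda>s. chart_inv c (\<phi> (snd c q) s))"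
    proof (rule integral_curve_of_coord[OF M X ca(1)])
      fix s assume s: "\<bar>s\<bar> < \<epsilon>"
      show "\<phi> (snd c q) s \<in> snd c ` fst c" using \<phi>r[OF V(2)[OF q] s] \<phi>E[OF V(2,3)[OF q] s] S by blast
      show "(\<phi> (snd c q) has_vector_derivative ?f (\<phi> (snd c q) s)) (at s)" by (rule \<phi>d[OF V(2)[OF q] s])
    qed
    moreover have "chart_inv c (\<phi> (snd c q) 0) = q"
      using \<phi>0[OF V(2)[OF q]] chart_inv_left[OF M ca(1) V(1)[OF q]] by simp
    ultimately show ?thesis
      unfolding flow_rel_def using \<epsilon> h
      by (intro exI[of _ "{-\<epsilon><..<\<epsilon>}"] exI[of _ "\<lambda>s. chart_inv c (\<phi> (snd c q) s)"]) auto
  qed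
  have fl: "flow M X h q = chart_inv c (\<phi> (snd c q) h)" if "q \<in> V" "\<bar>h\<bar> < \<epsilon>" for q h
    by (rule flow_eqI[OF M X rel[OF that]])
  have pres: "preserves_at M D (flow M X h) q" if q: "q \<in> V" and h: "\<bar>h\<bar> < \<epsilon>" for q h
  proof -
    let ?x = "snd c q" and ?F = "flow M X h"
    let ?z = "\<phi> ?x h"
    note x = V(2,3)[OF q]
    have z: "?z \<in> ball ?y0 r \<inter> ?E" using \<phi>r[OF x(1) h] \<phi>E[OF x h] by blast
    have Fq: "?F q = chart_inv c ?z" by (rule fl[OF q h])
    have cF: "c \<in> charts_at M (?F q)" unfolding Fq by (rule pt(3)[OF z])
    have oT: "openin (top_of_set ?E) (snd c ` (fst c \<inter> V))" by (rule chart_image_openin_Int[OF M ca(1) oV])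
    have xT: "?x \<in> snd c ` (fst c \<inter> V)" using q V(1)[OF q] by blast
    \<comment> \<open>On the coordinate image of \<open>V\<close> the time-\<open>h\<close> map is
      \<open>\<phi>\<close>, so the derivative of the flow in the chart is the solution
      \<open>Y\<close> of the variational equation.\<close>
    have der: "((snd c \<circ> ?F \<circ> chart_inv c) has_derivative Y ?x h) (at ?x within snd c ` fst c)"
    proof -
      have "((snd c \<circ> ?F \<circ> chart_inv c) has_derivative Y ?x h) (at ?x within snd c ` (fst c \<inter> V))"
      proof (rule has_derivative_transform[OF xT])
        show "((\<lambda>x. \<phi> x h) has_derivative Y ?x h) (at ?x within snd c ` (fst c \<inter> V))"
          by (rule has_derivative_at_withinI[OF \<phi>Y[OF x(1) h]])
        fix y assume "y \<in> snd c ` (fst c \<inter> V)"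
        then obtain q' where q': "q' \<in> V" "y = snd c q'" by blast
        have "\<phi> y h \<in> ball ?y0 r \<inter> ?E" using \<phi>r[OF V(2)[OF q'(1)] h] \<phi>E[OF V(2,3)[OF q'(1)] h] q'(2) by blast
        then show "(snd c \<circ> ?F \<circ> chart_inv c) y = \<phi> y h"
          using fl[OF q'(1) h] chart_inv_left[OF M ca(1) V(1)[OF q'(1)]] pt(2) q'(2) by simp
      qed
      moreover have "at ?x within snd c ` (fst c \<inter> V) = at ?x within snd c ` fst c"
        by (rule at_within_openin[OF oT xT]) (use chart_image_subset[OF M ca(1)] in auto)
      ultimately show ?thesis by simp
    qed
    show ?thesis
    proof (rule preserves_atI[where F = ?F and p = q, OF M Dt V(4)[OF q] cF])
      show "chart_diff c c ?F q" using der by (auto simp: chart_diff_def differentiable_def)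
    next
      fix W assume W: "openin (topol M) W" "?F q \<in> W"
      have Fc: "?F q \<in> fst c" using cF by (simp add: charts_at_def)
      obtain e where e: "e > 0" "ball (snd c (?F q)) e \<inter> ?E \<subseteq> snd c ` (fst c \<inter> W)"
        by (rule chart_ball[OF M ca(1) W(1) Fc W(2)])
      have zz: "snd c (?F q) = ?z" unfolding Fq by (rule pt(2)[OF z])
      have "isCont (\<lambda>x. \<phi> x h) ?x" using \<phi>Y[OF x(1) h] by (rule has_derivative_continuous)
      then obtain d where d: "d > 0" "\<And>x'. dist x' ?x < d \<Longrightarrow> dist (\<phi> x' h) ?z < e"
        using e(1) unfolding continuous_at_eps_delta by blast
      let ?V = "{q' \<in> fst c. snd c q' \<in> ball ?y0 \<delta> \<inter> ball ?x d}"
      show "\<exists>V. openin (topol M) V \<and> q \<in> V \<and> ?F ` V \<subseteq> W"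
      proof (intro exI[of _ ?V] conjI)
        show "openin (topol M) ?V" by (rule chart_preimage_openin[OF M ca(1)]) auto
        show "q \<in> ?V" using V(1)[OF q] x d(1) by simp
        show "?F ` ?V \<subseteq> W"
        proof (rule image_subsetI)
          fix q' assume "q' \<in> ?V"
          then have q': "q' \<in> V" "dist (snd c q') ?x < d" by (auto simp: V_def dist_commute)
          have "\<phi> (snd c q') h \<in> ball (snd c (?F q)) e \<inter> ?E"
            using d(2)[OF q'(2)] \<phi>E[OF V(2,3)[OF q'(1)] h] by (simp add: zz dist_commute)
          then obtain q'' where "q'' \<in> fst c" "q'' \<in> W" "\<phi> (snd c q') h = snd c q''" using e(2) by blast
          then show "?F q' \<in> W" using fl[OF q'(1) h] chart_inv_left[OF M ca(1)] by simp
        qed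
      qed
    next
      fix v assume v: "v \<in> D q"
      have qx: "chart_inv c ?x = q" by (rule chart_inv_left[OF M ca(1) V(1)[OF q]])
      have xr: "?x \<in> ball ?y0 r \<inter> ?E" using x \<delta> by auto
      have vk: "v c \<in> ?E" "\<And>i. i \<in> {1..n} \<Longrightarrow> a i ?x \<bullet> v c = 0"
        using ker[OF xr] v unfolding qx by blast+
      have ld: "local_deriv c c ?F q (v c) = Y ?x h (v c)"
        by (rule local_deriv_unique[OF M V(4)[OF q] der vk(1)])
      have "a i (\<phi> ?x h) \<bullet> Y ?x h (v c) = 0" if i: "i \<in> {1..n}" for i
      proof (rule kernel_invariant_under_variation[where \<rho> = "r/2" and r = r and ?y0.0 = "?y0" and E = ?E
            and I = "{1..n}" and J = "{1..m}" and f = ?f and f' = f' and a = a and a' = a' and Z = Z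
            and \<epsilon> = \<epsilon> and y = "\<phi> ?x" and Y = "\<lambda>t. Y ?x t (v c)" and t = h and i = i])
        show "{w \<in> ?E. \<forall>i\<in>{1..n}. a i y \<bullet> w = 0} = span ((\<lambda>j. Z j y) ` {1..m})"
          if "y \<in> ball ?y0 r \<inter> ?E" for y unfolding ker[OF that] by (rule span[OF that])
        show "\<phi> ?x t \<in> ball ?y0 (r/2) \<inter> ?E" if "\<bar>t\<bar> < \<epsilon>" for t
          using \<phi>in[OF x(1) that] \<phi>E[OF x that] by blast
        show "a i (\<phi> ?x 0) \<bullet> Y ?x 0 (v c) = 0" if "i \<in> {1..n}" for i
          using vk(2)[OF that] \<phi>0[OF x(1)] Y0[OF x(1)] by simp
        show "(a' i y) u \<bullet> w = (a' i y) w \<bullet> u"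
          if "i \<in> {1..n}" "y \<in> ball ?y0 r \<inter> ?E" "u \<in> ?E" "w \<in> ?E"
            "\<And>i. i \<in> {1..n} \<Longrightarrow> a i y \<bullet> u = 0" "\<And>i. i \<in> {1..n} \<Longrightarrow> a i y \<bullet> w = 0" for i y u w
          by (rule invol[OF that(1,2,3,5,4,6)])
      qed (use r E f' a' Z fE af \<phi>d[OF x(1)] YE[OF x(1) vk(1)] Yd[OF x(1)] h i in auto)
      moreover have "Y ?x h (v c) \<in> ?E" by (rule YE[OF x(1) vk(1) h])
      ultimately have "Y ?x h (v c) \<in> (\<lambda>u. u c) ` D (chart_inv c ?z)"
        unfolding ker[OF z, symmetric] by blast
      then show "\<exists>u\<in>D (?F q). u c = local_deriv c c ?F q (v c)"
        unfolding ld Fq by (metis imageE)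
    qed
  qed
  show thesis
  proof (rule that[OF \<epsilon> oV pV])
    fix q h assume qh: "q \<in> V" "\<bar>h\<bar> < \<epsilon>"
    show "q \<in> flow_domain M X h \<and> preserves_at M D (flow M X h) q"
      unfolding flow_domain_def using rel[OF qh] pres[OF qh] by blast
  qed
qed

text \<open>Connectedness of \<open>I\<close> replaces a subdivision of the time interval into short
  steps: near each time \<open>b\<close>, the property passes between any two times, forwards or
  backwards, by one short flow around \<open>g b\<close>.\<close>

lemma flow_preserves:
  assumes M: "smooth_manifold M" and D: "smooth_distribution M m D"
    and \<omega>: "distribution_given_by M D n \<omega>" and ci: "completely_integrable M m D"
    and XD: "vector_field_in M X D" and x: "x \<in> flow_domain M X t"
  shows "preserves_at M D (flow M X t) x"
proof -
  have X: "smooth_vector_field_on M (points M) X" using XD by (simp add: vector_field_in_def)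
  have Dt: "\<And>q. q \<in> points M \<Longrightarrow> D q \<subseteq> tangent_space M q" using D by (simp add: smooth_distribution_def)
  obtain I g where ic: "integral_curve M X I g" "0 \<in> I" "t \<in> I" "g 0 = x"
    using x by (auto simp: flow_domain_def flow_rel_def)
  have fl: "flow M X s x = g s" if "s \<in> I" for s
    by (rule flow_eqI[OF M X]) (use ic that in \<open>auto simp: flow_rel_def\<close>)
  have I: "open I" "is_interval I" using ic(1) by (auto simp: integral_curve_def)
  note loc = local_flow_preserves[OF M D \<omega> ci XD]
  \<comment> \<open>A whole neighbourhood of \<open>x\<close> in the flow domain is part of the
    induction. Otherwise the composite of two flows would be known at \<open>x\<close> alone, and
    nothing about the derivative at \<open>x\<close> would follow.\<close>
  define P where "P s \<longleftrightarrow> (\<exists>V. openin (topol M) V \<and> x \<in> V \<and> V \<subseteq> flow_domain M X s) \<and> preserves_at M D (flow M X s) x"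
    for s
  have "P t"
  proof (rule connected_induction_simple[where S = I and a = 0])
    show "connected I" using I(2) by (rule is_interval_connected)
    have "x \<in> points M" using integral_curve_in_points[OF ic(1,2)] ic(4) by simp
    then obtain \<epsilon> V where "\<epsilon> > 0" "openin (topol M) V" "x \<in> V"
      "\<And>q h. q \<in> V \<Longrightarrow> \<bar>h\<bar> < \<epsilon> \<Longrightarrow> q \<in> flow_domain M X h \<and> preserves_at M D (flow M X h) q"
      by (rule loc) blast
    then show "P 0" unfolding P_def by (metis abs_zero subsetI)
    fix b assume b: "b \<in> I"
    obtain \<epsilon> V where V: "\<epsilon> > 0" "openin (topol M) V" "g b \<in> V"
      and VP: "\<And>q h. q \<in> V \<Longrightarrow> \<bar>h\<bar> < \<epsilon> \<Longrightarrow> q \<in> flow_domain M X h \<and> preserves_at M D (flow M X h) q"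
      by (rule loc[OF integral_curve_in_points[OF ic(1) b]]) blast
    \<comment> \<open>The radius \<open>\<epsilon>/2\<close> makes any two times in
      \<open>?T\<close> differ by less than \<open>\<epsilon>\<close>.\<close>
    let ?T = "{s \<in> I. g s \<in> V} \<inter> ball b (\<epsilon>/2)"
    have step: "P s'" if s: "s \<in> ?T" "s' \<in> ?T" and P: "P s" for s s'
    proof -
      obtain U where U: "openin (topol M) U" "x \<in> U" "U \<subseteq> flow_domain M X s"
        and pr: "preserves_at M D (flow M X s) x" using P unfolding P_def by blast
      have "\<bar>b - s\<bar> < \<epsilon>/2" "\<bar>b - s'\<bar> < \<epsilon>/2" using s by (auto simp: dist_real_def)
      then have h: "\<bar>s' - s\<bar> < \<epsilon>" by linarith
      have gs: "flow M X s x \<in> V" using s fl by auto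
      obtain U' where U': "openin (topol M) U'" "x \<in> U'" "flow M X s ` U' \<subseteq> V"
        using pr gs V(2) unfolding preserves_at_def by blast
      let ?U = "U \<inter> U'"
      have oU: "openin (topol M) ?U" "x \<in> ?U" using U U' by auto
      have rel: "flow_rel M X s' q (flow M X (s' - s) (flow M X s q))" if q: "q \<in> ?U" for q
      proof -
        have 1: "flow_rel M X s q (flow M X s q)" using flow_rel_flow[OF M X] q U(3) by blast
        have "flow M X s q \<in> flow_domain M X (s' - s)" using VP[OF _ h] q U'(3) by blast
        from flow_rel_trans[OF M X 1 flow_rel_flow[OF M X this]] show ?thesis by simp
      qed
      have "preserves_at M D (flow M X s') x"
        by (rule preserves_at_compose[OF M Dt pr _ oU])
          (use VP[OF gs h] flow_eqI[OF M X rel] in auto)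
      moreover have "?U \<subseteq> flow_domain M X s'" using rel by (auto simp: flow_domain_def)
      ultimately show ?thesis unfolding P_def using oU by blast
    qed
    have "openin (top_of_set I) ?T"
      by (rule open_openin_trans) (use I integral_curve_preimage_open[OF ic(1) V(2)] in auto)
    moreover have "b \<in> ?T" using b V by simp
    ultimately show "\<exists>T. openin (top_of_set I) T \<and> b \<in> T \<and> (\<forall>s\<in>T. \<forall>s'\<in>T. P s \<longrightarrow> P s')"
      using step by blast
  qed (use ic in auto)
  then show ?thesis by (simp add: P_def)
qed

theorem theorem12:
  fixes M :: "('a, 'e::euclidean_space) manifold"
    and m n :: nat
    and D :: "'a \<Rightarrow> ('a, 'e) tvec set"
    and \<omega> :: "nat \<Rightarrow> 'a \<Rightarrow> ('a, 'e) tvec \<Rightarrow> real"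
    and X :: "'a \<Rightarrow> ('a, 'e) tvec"
  assumes "smooth_manifold M"
    and "mdim M = m + n"
    and "smooth_distribution M m D"
    and "distribution_given_by M D n \<omega>"
    and "completely_integrable M m D"
    and "vector_field_in M X D"
  shows "\<forall>t. \<forall>i\<in>{1..n}.
           vanishes_on (flow_domain M X t) (pullback_form M M (flow M X t) (\<omega> i)) D"
  unfolding vanishes_on_def
proof (intro allI ballI)
  fix t i p v assume i: "i \<in> {1..n}" and p: "p \<in> flow_domain M X t" and v: "v \<in> D p"
  have pres: "preserves_at M D (flow M X t) p"
    by (rule flow_preserves[OF assms(1,3-6) p])
  have Dt: "\<And>q. q \<in> points M \<Longrightarrow> D q \<subseteq> tangent_space M q"
    using assms(3) by (simp add: smooth_distribution_def)
  have "differential M M (flow M X t) p v \<in> D (flow M X t p)"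
    by (rule preserves_at_differential[OF assms(1) Dt pres v])
  moreover have "flow M X t p \<in> points M" using pres by (simp add: preserves_at_def)
  ultimately have "\<omega> i (flow M X t p) (differential M M (flow M X t) p v) = 0"
    using distribution_eq_kernel[OF assms(1,3,4)] i by blast
  then show "pullback_form M M (flow M X t) (\<omega> i) p v = 0" by (simp add: pullback_form_def)
qed

end
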